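(* Let $F$ be a finite field of characteristic $2$. Let $n\ge m\ge 1$, $k\ge 3$, $l\in\{1,2\}$, $H_1\cong D_8$, $H_2\cong Q_8$, and let $$G_l\cong M_2(n+1,1)\mathbin{\mathsf Y}M_2(m+1,1,1)\mathbin{\mathsf Y}H_l\mathbin{\mathsf Y}D_8^{\mathsf Y(k-3)},$$ with derived subgroup $\langle c\rangle$ of order $2$. Then: (i) If $n=1$, then $|\Omega_1(G_1)|=2^{2k}+2^{k+1}=|\Omega_c(G_2)|$ and $|\Omega_c(G_1)|=2^{2k}-2^{k+1}=|\Omega_1(G_2)|$. If $n\ge 2$, then $|\Omega_1(G_l)|=2^{2k}=|\Omega_c(G_l)|$ for $l=1,2$. (ii) $|V_*(FG_l)|=2|F|^{\frac{|G_l|+|\Omega_1(G_l)|}{2}-1}$ if $n=1$, and $|V_*(FG_l)|=4|F|^{\frac{|G_l|+|\Omega_1(G_l)|}{2}-1}$ if $n\ge 2$.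
   Context: $V(FG)=\{\sum_{g}\alpha_g g\in FG:\sum_g\alpha_g=1\}$; $(\sum_g\alpha_g g)^*=\sum_g\alpha_g g^{-1}$; $V_*(FG)=\{x\in V(FG):x^*=x^{-1}\}$. $\Omega_1(G)=\{g\in G:g^2=1\}$ and $\Omega_c(G)=\{g\in G: g^2=c\}$. $D_8$, $Q_8$ are the dihedral and quaternion groups of order $8$. $M_2(u,v)=\langle a,b\mid a^{2^u}=b^{2^v}=1,\ a^b=a^{1+2^{u-1}}\rangle$ for $u\ge2,v\ge1$ (so $M_2(2,1)\cong D_8$). $M_2(w,1,1)=\langle a,b,d\mid a^{2^w}=b^{2}=d^2=1,\ [a,b]=d,\ [d,a]=[d,b]=1\rangle$ for $w\ge 1$. $H\mathbin{\mathsf Y}K$ denotes the central product; here all factors have derived subgroup of order $2$, and the central product is formed by identifying these derived subgroups with one common subgroup $\langle c\rangle$, so that factors intersect exactly in $\langle c\rangle$. $D_8^{\mathsf Y j}$ is the central product of $j$ copies of $D_8$ (omitted if $j=0$). *)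

theory Defs
  imports "HOL-Algebra.Product_Groups" "HOL-Algebra.Ring" "HOL-Library.Cardinality"
begin

section \<open>Groups given by generators and relations\<close>

text \<open>
  A letter \<open>(x, False)\<close> stands for the generator \<open>x\<close> and \<open>(x, True)\<close> for its formal inverse.
  The group presented by generators \<open>X\<close> and relations \<open>R\<close> (pairs of words to be identified) is the
  set of all words over \<open>X\<close> modulo the least congruence that cancels adjacent inverse letters and
  contains \<open>R\<close>.
\<close>

type_synonym 'x gword = "('x \<times> bool) list"

definition words_over :: "'x set \<Rightarrow> 'x gword set" where
  "words_over X = lists (X \<times> UNIV)"

inductive_set pres_cong :: "'x set \<Rightarrow> ('x gword \<times> 'x gword) set \<Rightarrow> ('x gword \<times> 'x gword) set"
  for X :: "'x set" and R :: "('x gword \<times> 'x gword) set" where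
  refl: "w \<in> words_over X \<Longrightarrow> (w, w) \<in> pres_cong X R"
| sym: "(v, w) \<in> pres_cong X R \<Longrightarrow> (w, v) \<in> pres_cong X R"
| trans: "(u, v) \<in> pres_cong X R \<Longrightarrow> (v, w) \<in> pres_cong X R \<Longrightarrow> (u, w) \<in> pres_cong X R"
| cancel: "us \<in> words_over X \<Longrightarrow> vs \<in> words_over X \<Longrightarrow> x \<in> X \<Longrightarrow>
    (us @ [(x, e), (x, \<not> e)] @ vs, us @ vs) \<in> pres_cong X R"
| rel: "us \<in> words_over X \<Longrightarrow> vs \<in> words_over X \<Longrightarrow> (l, r) \<in> R \<Longrightarrow>
    l \<in> words_over X \<Longrightarrow> r \<in> words_over X \<Longrightarrow> (us @ l @ vs, us @ r @ vs) \<in> pres_cong X R"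

definition presented_group ::
    "'x set \<Rightarrow> ('x gword \<times> 'x gword) set \<Rightarrow> 'x gword set monoid" where
  "presented_group X R =
    \<lparr>carrier = words_over X // pres_cong X R,
     monoid.mult = (\<lambda>A B. \<Union>u\<in>A. \<Union>v\<in>B. pres_cong X R `` {u @ v}),
     one = pres_cong X R `` {[]}\<rparr>"

definition wpow :: "'x \<Rightarrow> nat \<Rightarrow> 'x gword" where
  "wpow x i = replicate i (x, False)"

definition winv :: "'x \<Rightarrow> 'x gword" where
  "winv x = [(x, True)]"

definition wconj :: "'x \<Rightarrow> 'x \<Rightarrow> 'x gword" where
  "wconj x y = winv y @ wpow x 1 @ wpow y 1"

definition wcomm :: "'x \<Rightarrow> 'x \<Rightarrow> 'x gword" where
  "wcomm x y = winv x @ winv y @ wpow x 1 @ wpow y 1"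

datatype gen = Ga | Gb | Gd

definition M2 :: "nat \<Rightarrow> nat \<Rightarrow> gen gword set monoid" where
  "M2 u v = presented_group {Ga, Gb}
    {(wpow Ga (2 ^ u), []), (wpow Gb (2 ^ v), []),
     (wconj Ga Gb, wpow Ga (1 + 2 ^ (u - 1)))}"

text \<open>The group \<open>M\<^sub>2(w, 1, 1)\<close>.\<close>

definition M2_1_1 :: "nat \<Rightarrow> gen gword set monoid" where
  "M2_1_1 w = presented_group {Ga, Gb, Gd}
    {(wpow Ga (2 ^ w), []), (wpow Gb 2, []), (wpow Gd 2, []),
     (wcomm Ga Gb, wpow Gd 1), (wcomm Gd Ga, []), (wcomm Gd Gb, [])}"

definition D8 :: "gen gword set monoid" where
  "D8 = presented_group {Ga, Gb}
    {(wpow Ga 4, []), (wpow Gb 2, []), (wconj Ga Gb, winv Ga)}"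

definition Q8 :: "gen gword set monoid" where
  "Q8 = presented_group {Ga, Gb}
    {(wpow Ga 4, []), (wpow Gb 2, wpow Ga 2), (wconj Ga Gb, winv Ga)}"


section \<open>Central products\<close>

text \<open>
  For factors whose derived subgroups all have order 2, the central product amalgamating these
  subgroups is the direct product modulo the kernel of the map that sends a tuple of elements of
  the derived subgroups to the product of their images in the common group of order 2.
  A tuple lies in this kernel iff it has an even number of nontrivial entries.
\<close>

definition amalg_kernel :: "('a, 'b) monoid_scheme list \<Rightarrow> (nat \<Rightarrow> 'a) set" where
  "amalg_kernel Ks =
    {z \<in> (\<Pi>\<^sub>E i\<in>{..<length Ks}. derived (Ks ! i) (carrier (Ks ! i))).
       even (card {i \<in> {..<length Ks}. z i \<noteq> \<one>\<^bsub>Ks ! i\<^esub>})}"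

definition central_product :: "('a, 'b) monoid_scheme list \<Rightarrow> (nat \<Rightarrow> 'a) set monoid" where
  "central_product Ks =
    product_group {..<length Ks} (\<lambda>i. Ks ! i) Mod amalg_kernel Ks"


section \<open>Group algebras and unitary units\<close>

definition group_algebra :: "('g, 'r) monoid_scheme \<Rightarrow> ('g \<Rightarrow> 'f::field) ring" where
  "group_algebra G =
    \<lparr>carrier = {x. finite {g. x g \<noteq> 0} \<and> {g. x g \<noteq> 0} \<subseteq> carrier G},
     monoid.mult = (\<lambda>x y g. if g \<in> carrier G
        then \<Sum>h | x h \<noteq> 0. x h * y (inv\<^bsub>G\<^esub> h \<otimes>\<^bsub>G\<^esub> g) else 0),
     one = (\<lambda>g. if g = \<one>\<^bsub>G\<^esub> then 1 else 0),
     zero = (\<lambda>g. 0),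
     add = (\<lambda>x y g. x g + y g)\<rparr>"

definition normalized :: "('g, 'r) monoid_scheme \<Rightarrow> ('g \<Rightarrow> 'f::field) set" where
  "normalized G = {x \<in> carrier (group_algebra G). (\<Sum>g | x g \<noteq> 0. x g) = 1}"

definition star :: "('g, 'r) monoid_scheme \<Rightarrow> ('g \<Rightarrow> 'f::field) \<Rightarrow> 'g \<Rightarrow> 'f" where
  "star G x = (\<lambda>g. if g \<in> carrier G then x (inv\<^bsub>G\<^esub> g) else 0)"

definition normalized_unitary :: "('g, 'r) monoid_scheme \<Rightarrow> ('g \<Rightarrow> 'f::field) set" where
  "normalized_unitary G =
    {x \<in> normalized G. x \<in> Units (group_algebra G) \<and> star G x = inv\<^bsub>group_algebra G\<^esub> x}"

definition square_roots :: "('g, 'r) monoid_scheme \<Rightarrow> 'g \<Rightarrow> 'g set" where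
  "square_roots G c = {g \<in> carrier G. g [^]\<^bsub>G\<^esub> (2::nat) = c}"

abbreviation Omega1 :: "('g, 'r) monoid_scheme \<Rightarrow> 'g set" where
  "Omega1 G \<equiv> square_roots G \<one>\<^bsub>G\<^esub>"

end

theory Submission
  imports Defs "HOL-Library.Function_Algebras" "HOL-Algebra.Multiplicative_Group"
begin

text \<open>
  Let \<open>\<pi> : G \<rightarrow> A\<close> be a surjection onto an abelian group with kernel \<open>{1, c}\<close> of order 2.  If \<open>x\<close> lifts
  a unitary unit of \<open>FA\<close>, then \<open>x x\<^sup>* = 1 + (1 + c) s\<close> with \<open>s \<in> FA\<close> symmetric, and replacing the lift
  changes \<open>s\<close> by an arbitrary \<open>z + z\<^sup>*\<close>.  Hence the lift can be corrected to a unitary unit iff \<open>s\<close>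
  vanishes on the involutions \<open>T\<close> of \<open>A\<close> whose lifts square to \<open>c\<close>.  The map \<open>x \<mapsto> s|T\<close> is a
  homomorphism to the additive group of functions on \<open>T\<close>, and the elements \<open>1 + \<beta> (1 + t) w\<close> with
  \<open>w\<^sup>2 \<in> {1, t}\<close> show that it is surjective or has image of index two.  The order of the unitary group
  thus passes from \<open>A\<close> to \<open>G\<close>; this gives the abelian case by induction, and then the theorem with
  \<open>A = G/\<langle>c\<rangle>\<close>.  The square roots of 1 and \<open>c\<close> in a central product are counted by multiplying signed
  counts over the factors.
\<close>

section \<open>Finite fields of characteristic two and involutions on finite sets\<close>

text \<open>The constant in front of the power of |F| is unchanged in a step whose obstruction map
  is onto and doubles in a step with image of index two. Index two arises only for abelian groups of
  exponent four in which \<open>c\<close> is a square: there the values of \<open>s\<close> on T add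
  up to an element \<open>v + v^2\<close>, and these form a subgroup of index two in F. For larger
  exponent \<open>c\<close> is chosen to be a fourth power, where the map is onto, so no
  decomposition into cyclic groups is needed. The constant that accumulates is the number of squares
  of order at most two. For \<open>A = G/<c>\<close>, a product of groups C(2^w) x C(2), it is 2 or
  4: \<open>M2_1_1\<close> always contributes a factor 2, and \<open>M2\<close> does so exactly for
  n at least 2. The last step, from A to G, contributes nothing, for two different reasons: if n =
  1, every square root of \<open>c\<close> fails to commute with some involution; if n is at least
  2, \<open>c\<close> has a central square root that is itself a square.\<close>

lemma char2_two:
  assumes "CHAR('f::{field,finite}) = 2"
  shows "(2::'f) = 0"
proof -
  have "of_nat CHAR('f) = (0::'f)" by (rule of_nat_CHAR)
  then show ?thesis unfolding assms by simp
qed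

lemma char2_add_self:
  assumes "CHAR('f::{field,finite}) = 2"
  shows "(x::'f) + x = 0"
  unfolding mult_2[symmetric] char2_two[OF assms] by simp

lemma char2_add_eq_iff:
  assumes "CHAR('f::{field,finite}) = 2"
  shows "(x::'f) + y = w \<longleftrightarrow> y = x + w"
proof -
  have "x + (x + v) = v" for v
    unfolding add.assoc[symmetric] char2_add_self[OF assms] by simp
  then show ?thesis by metis
qed

lemma char2_fun_add_self:
  assumes "CHAR('f::{field,finite}) = 2"
  shows "(x::'a \<Rightarrow> 'f) + x = 0"
  by (rule ext) (simp only: plus_fun_apply zero_fun_apply char2_add_self[OF assms])

text \<open>Squaring is additive with trivial kernel, hence injective, hence onto by finiteness. It
  is needed because the explicit unitary units below realise only coefficients of the form
  \<open>b\<^sup>2\<close>.\<close>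

lemma char2_square_surj:
  assumes "CHAR('f::{field,finite}) = 2"
  shows "\<exists>b::'f. b\<^sup>2 = a"
proof -
  have "inj (\<lambda>b::'f. b\<^sup>2)"
  proof (rule injI)
    fix x y :: 'f
    assume "x\<^sup>2 = y\<^sup>2"
    moreover have "(x + y)\<^sup>2 = x\<^sup>2 + y\<^sup>2 + (x * y + x * y)"
      by (simp add: power2_eq_square algebra_simps)
    ultimately have "(x + y)\<^sup>2 = 0"
      by (simp add: char2_two[OF assms])
    then have "x + y = 0" by simp
    then show "x = y" using char2_add_eq_iff[OF assms, of y x 0] by (simp add: add.commute)
  qed
  then have "surj (\<lambda>b::'f. b\<^sup>2)" by (simp add: finite_UNIV_inj_surj)
  then show ?thesis by (metis surjD)
qed

text \<open>The additive map \<open>b + b\<^sup>2\<close> has kernel {0, 1}, so its range is a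
  subgroup with half the elements of the field. Index two is expressed by a translation that
  exchanges the range with its complement, the form in which it is used to count functions by their
  sum.\<close>

lemma artin_schreier_index_two:
  assumes "CHAR('f::{field,finite}) = 2"
  shows "\<exists>k::'f. \<forall>x. (x \<in> range (\<lambda>b. b + b\<^sup>2)) \<longleftrightarrow> (x + k \<notin> range (\<lambda>b. b + b\<^sup>2))"
proof -
  note z = char2_add_self[OF assms]
  define p where "p = (\<lambda>b::'f. b + b\<^sup>2)"
  have p_add: "p (a + b) = p a + p b" for a b
  proof -
    have "p (a + b) = p a + p b + (a * b + a * b)"
      by (simp add: p_def power2_eq_square algebra_simps)
    then show ?thesis by (simp add: char2_two[OF assms])
  qed
  have p0: "p x = 0 \<longleftrightarrow> x = 0 \<or> x = 1" for x
  proof -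
    have "p x = x * (x + 1)" by (simp add: p_def power2_eq_square algebra_simps)
    moreover have "x + 1 = 0 \<longleftrightarrow> x = 1"
      using char2_add_eq_iff[OF assms, of 1 x 0] by (simp add: add.commute)
    ultimately show ?thesis by simp
  qed
  have fib: "p x = p y \<longleftrightarrow> y = x \<or> y = x + 1" for x y
  proof -
    have "p x = p y \<longleftrightarrow> p (x + y) = 0"
      using char2_add_eq_iff[OF assms, of "p x" "p y" 0] by (auto simp: p_add)
    also have "\<dots> \<longleftrightarrow> x + y = 0 \<or> x + y = 1" by (rule p0)
    also have "\<dots> \<longleftrightarrow> y = x \<or> y = x + 1" by (simp add: char2_add_eq_iff[OF assms])
    finally show ?thesis .
  qed
  have "card (UNIV::'f set) = (\<Sum>y\<in>range p. card {x. p x = y})"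
    using sum.group[of "UNIV::'f set" "range p" p "\<lambda>_. 1::nat"] by simp
  also have "\<dots> = (\<Sum>y\<in>range p. 2)"
  proof (rule sum.cong[OF HOL.refl])
    fix y assume "y \<in> range p"
    then obtain x where x: "y = p x" by auto
    have "{x'. p x' = y} = {x, x + 1}" unfolding x eq_commute[of _ "p x"] fib by blast
    then show "card {x. p x = y} = 2" by simp
  qed
  finally have card: "card (UNIV::'f set) = 2 * card (range p)" by simp
  \<comment> \<open>The fibre count makes the range exactly half of the field, so something lies
    outside; any such element serves as \<open>k\<close>.\<close>
  have "range p \<noteq> UNIV"
    using card by (metis card_gt_0_iff finite UNIV_not_empty less_irrefl mult_2 less_add_same_cancel1)
  then obtain k where k: "k \<notin> range p" by auto
  have closed: "x + y \<in> range p" if "x \<in> range p" "y \<in> range p" for x y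
    using that by (auto simp: p_add[symmetric])
  let ?S = "(\<lambda>x. x + k) ` range p"
  have disj: "range p \<inter> ?S = {}"
  proof (rule ccontr)
    assume "range p \<inter> ?S \<noteq> {}"
    then obtain y where y: "y \<in> range p" "y \<in> ?S" by (meson Int_emptyI)
    from y(2) obtain x where x: "x \<in> range p" "y = x + k" by (rule imageE)
    have "x \<in> range p" "x + k \<in> range p" using x y(1) by simp_all
    then have "x + (x + k) \<in> range p" by (rule closed)
    then show False using k z[of x] by (simp add: add.assoc[symmetric])
  qed
  have "card ?S = card (range p)" by (rule card_image) (simp add: inj_on_def)
  then have "card (range p \<union> ?S) = card (UNIV::'f set)"
    using card card_Un_disjoint[OF _ _ disj] by simp
  then have un: "range p \<union> ?S = UNIV" by (rule card_eq_UNIV_imp_eq_UNIV[rotated]) (rule finite)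
  have "x \<in> range p \<longleftrightarrow> x + k \<notin> range p" for x
  proof
    assume "x \<in> range p"
    then have "x + k \<in> ?S" by (rule imageI)
    then show "x + k \<notin> range p" using disj by (meson disjoint_iff)
  next
    assume a: "x + k \<notin> range p"
    have "x + k \<in> range p \<union> ?S" unfolding un by (rule UNIV_I)
    then have "x + k \<in> ?S" using a by (meson UnE)
    then obtain x' where "x' \<in> range p" "x + k = x' + k" by (rule imageE)
    then show "x \<in> range p" by simp
  qed
  then have "\<exists>k. \<forall>x. x \<in> range p \<longleftrightarrow> x + k \<notin> range p" by blast
  then show ?thesis unfolding p_def .
qed

text \<open>The two members of an orbit of length two contribute equal terms, which cancel in
  characteristic 2; orbits are removed one at a time until only fixed points remain.\<close>

lemma char2_sum_involution:
  fixes m :: "'a \<Rightarrow> 'f::{field,finite}"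
  assumes char: "CHAR('f) = 2" and "finite S"
    and "\<And>a. a \<in> S \<Longrightarrow> i a \<in> S" "\<And>a. a \<in> S \<Longrightarrow> i (i a) = a"
    and "\<And>a. a \<in> S \<Longrightarrow> m (i a) = m a"
  shows "sum m S = sum m {a \<in> S. i a = a}"
  using assms(2-)
proof (induction "card S" arbitrary: S rule: less_induct)
  case less
  show ?case
  proof (cases "\<exists>b\<in>S. i b \<noteq> b")
    case False
    then have "{a \<in> S. i a = a} = S" by auto
    then show ?thesis by simp
  next
    case True
    then obtain b where b: "b \<in> S" "i b \<noteq> b" by auto
    define S' where "S' = S - {b, i b}"
    have ib: "i b \<in> S" using less b by auto
    have "sum m S' = sum m {a \<in> S'. i a = a}"
    proof (rule less(1))
      show "card S' < card S"
        unfolding S'_def using b less(2) by (intro psubset_card_mono) auto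
      fix a assume "a \<in> S'"
      then have a: "a \<in> S" "a \<noteq> b" "a \<noteq> i b" by (auto simp: S'_def)
      show "i a \<in> S'" using a less(3,4) b unfolding S'_def by (metis Diff_iff insert_iff empty_iff)
      show "i (i a) = a" "m (i a) = m a" using a less by auto
    qed (use less(2) in \<open>auto simp: S'_def\<close>)
    moreover have "{a \<in> S'. i a = a} = {a \<in> S. i a = a}"
      using b less(4)[OF b(1)] unfolding S'_def by auto
    moreover have "sum m S = m b + m (i b) + sum m S'"
    proof -
      have "sum m S = sum m {b, i b} + sum m S'"
        unfolding S'_def using b ib less(2) by (metis add.commute empty_subsetI insert_subset sum.subset_diff)
      then show ?thesis using b by auto
    qed
    ultimately show ?thesis using less(5)[OF b(1)] char2_add_self[OF char] by simp
  qed
qed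

lemma involution_transversal:
  assumes "finite S" "\<And>a. a \<in> S \<Longrightarrow> i a \<in> S" "\<And>a. a \<in> S \<Longrightarrow> i (i a) = a"
    and "\<And>a. a \<in> S \<Longrightarrow> i a \<noteq> a"
  obtains R where "R \<subseteq> S" "R \<inter> i ` R = {}" "R \<union> i ` R = S" "card S = 2 * card R"
proof -
  obtain f :: "'a \<Rightarrow> nat" where f: "inj_on f S"
    using finite_imp_inj_to_nat_seg[OF assms(1)] by blast
  \<comment> \<open>An arbitrary injective numbering decides which member of each pair is
    taken.\<close>
  define R where "R = {a \<in> S. f a < f (i a)}"
  have 1: "R \<subseteq> S" by (auto simp: R_def)
  have 2: "R \<inter> i ` R = {}"
  proof -
    have "i a \<notin> R" if "a \<in> R" for a
      using that assms(3)[of a] unfolding R_def by simp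
    then show ?thesis by blast
  qed
  have 3: "R \<union> i ` R = S"
  proof
    show "R \<union> i ` R \<subseteq> S" using 1 assms(2) by blast
    show "S \<subseteq> R \<union> i ` R"
    proof
      fix a assume a: "a \<in> S"
      have "f a \<noteq> f (i a)" using inj_on_eq_iff[OF f a assms(2)[OF a]] assms(4)[OF a] by simp
      then consider "f a < f (i a)" | "f (i a) < f a" by linarith
      then show "a \<in> R \<union> i ` R"
      proof cases
        case 1
        then have "a \<in> R" using a unfolding R_def by blast
        then show ?thesis by blast
      next
        case 2
        then have "i a \<in> R" using assms(2)[OF a] assms(3)[OF a] unfolding R_def by simp
        then have "i (i a) \<in> i ` R" by (rule imageI)
        then show ?thesis using assms(3)[OF a] by simp
      qed
    qed
  qed
  have "inj_on i R"
    by (rule inj_on_inverseI[of R i i]) (use assms(3) 1 in blast)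
  moreover have "finite R" using 1 assms(1) finite_subset by blast
  ultimately have "card S = 2 * card R"
    using card_Un_disjoint[of R "i ` R"] 2 3 by (simp add: card_image)
  then show thesis using that 1 2 3 by blast
qed

lemma card_supported_functions:
  assumes "finite S"
  shows "card {x::'a \<Rightarrow> 'f::{finite,zero}. \<forall>a. a \<notin> S \<longrightarrow> x a = 0} = CARD('f) ^ card S"
proof -
  have "bij_betw (\<lambda>x. restrict x S) {x::'a \<Rightarrow> 'f. \<forall>a. a \<notin> S \<longrightarrow> x a = 0} (S \<rightarrow>\<^sub>E UNIV)"
    by (rule bij_betw_byWitness[where f' = "\<lambda>y a. if a \<in> S then y a else 0"])
       (auto simp: fun_eq_iff PiE_def extensional_def)
  from bij_betw_same_card[OF this] show ?thesis by (simp add: card_funcsetE[OF assms])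
qed

text \<open>The solutions are determined by their values on the fixed points and on a transversal.\<close>

lemma card_symmetrization_fiber:
  fixes s :: "'a \<Rightarrow> 'f::{field,finite}"
  assumes char: "CHAR('f) = 2" and fin: "finite S"
    and i: "\<And>a. a \<in> S \<Longrightarrow> i a \<in> S" "\<And>a. a \<in> S \<Longrightarrow> i (i a) = a"
    and s: "\<And>a. a \<in> S \<Longrightarrow> s (i a) = s a" "\<And>a. a \<in> S \<Longrightarrow> i a = a \<Longrightarrow> s a = 0"
  shows "card {z. (\<forall>a. a \<notin> S \<longrightarrow> z a = 0) \<and> (\<forall>a\<in>S. z a + z (i a) = s a)} =
    CARD('f) ^ ((card S + card {a \<in> S. i a = a}) div 2)"
    and "even (card S + card {a \<in> S. i a = a})"
proof -
  note z = char2_add_self[OF char]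
  \<comment> \<open>At a fixed point the equation reads \<open>0 = s a\<close>, which the hypothesis
    on \<open>s\<close> grants, so the value of \<open>z\<close> there is free.\<close>
  define B where "B = {a \<in> S. i a = a}"
  obtain R where R: "R \<subseteq> S - B" "R \<inter> i ` R = {}" "R \<union> i ` R = S - B" "card (S - B) = 2 * card R"
  proof (rule involution_transversal[of "S - B" i])
    show "finite (S - B)" using fin by simp
    show "i a \<in> S - B" "i (i a) = a" "i a \<noteq> a" if "a \<in> S - B" for a
      using i[of a] that by (auto simp: B_def)
  qed
  have fB: "finite B" and BS: "B \<subseteq> S" using fin by (auto simp: B_def)
  have cS: "card S = card B + 2 * card R"
    using R(4) fB BS fin by (metis card_Diff_subset card_mono le_add_diff_inverse)
  then show "even (card S + card {a \<in> S. i a = a})" unfolding B_def[symmetric] by simp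
  have fR: "finite R" using R(1) fin by (meson finite_Diff finite_subset)
  have card: "card (B \<union> R) = (card S + card B) div 2"
    using card_Un_disjoint[OF fB fR] R(1) cS by auto
  let ?Z = "{z. (\<forall>a. a \<notin> S \<longrightarrow> z a = 0) \<and> (\<forall>a\<in>S. z a + z (i a) = s a)}"
  let ?Y = "{x::'a \<Rightarrow> 'f. \<forall>a. a \<notin> B \<union> R \<longrightarrow> x a = 0}"
  let ?f = "\<lambda>z a. if a \<in> B \<union> R then z a else (0::'f)"
  \<comment> \<open>Off \<open>B \<union> R\<close> the partner of a point lies in \<open>R\<close>,
    and the equation determines the value from it.\<close>
  let ?g = "\<lambda>y a. if a \<in> B \<union> R then y a else if a \<in> S then y (i a) + s a else (0::'f)"
  note eq = char2_add_eq_iff[OF char]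
  have iR: "i a \<in> R" if a: "a \<in> S" "a \<notin> B \<union> R" for a
  proof -
    have "a \<in> R \<union> i ` R" using a R(3) by blast
    then obtain r where r: "r \<in> R" "a = i r" using a by blast
    then have "r \<in> S" using R(1) by blast
    then show ?thesis using r i(2) by simp
  qed
  have "bij_betw ?f ?Z ?Y"
  proof (rule bij_betw_byWitness[where f' = ?g])
    show "\<forall>z\<in>?Z. ?g (?f z) = z"
    proof (intro ballI ext)
      fix z a assume zZ: "z \<in> ?Z"
      show "?g (?f z) a = z a"
        using zZ iR[of a] i[of a] eq[of "z (i a)" "z a" "s a"] by (auto simp: add.commute)
    qed
    show "\<forall>y\<in>?Y. ?f (?g y) = y" by (auto simp: fun_eq_iff)
    show "?f ` ?Z \<subseteq> ?Y" by auto
    show "?g ` ?Y \<subseteq> ?Z"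
    proof
      fix z assume "z \<in> ?g ` ?Y"
      then obtain y where y: "y \<in> ?Y" "z = ?g y" by auto
      have "z a = 0" if "a \<notin> S" for a using that R(1) BS y(2) by auto
      moreover have "z b + z (i b) = s b" if b: "b \<in> S" for b
      proof -
        consider "b \<in> B" | "b \<in> R" | "b \<notin> B \<union> R" by blast
        then show ?thesis
        proof cases
          case 1
          then have "i b = b" "s b = 0" using s by (auto simp: B_def)
          then show ?thesis using z by simp
        next
          case 2
          then have "i b \<notin> R" "i b \<notin> B" using R(2,3) by blast+
          then show ?thesis using 2 b i s z y(2) by (simp add: add.assoc[symmetric])
        next
          case 3
          then have "i b \<in> R" using iR b by blast
          then show ?thesis using 3 b i z y(2) by (simp add: add.commute add.left_commute)
        qed
      qed
      ultimately show "z \<in> ?Z" by blast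
    qed
  qed
  then have "card ?Z = card ?Y" by (rule bij_betw_same_card)
  also have "\<dots> = CARD('f) ^ card (B \<union> R)"
    by (rule card_supported_functions) (use fB fR in auto)
  finally show "card ?Z = CARD('f) ^ ((card S + card {a \<in> S. i a = a}) div 2)"
    using card by (simp add: B_def)
qed

section \<open>Group algebras of finite groups as function spaces\<close>

text \<open>Elements are functions on the whole type that vanish off the carrier, so that equality
  and addition are those of functions.\<close>

definition galg :: "('g, 'r) monoid_scheme \<Rightarrow> ('g \<Rightarrow> 'f::field) set" where
  "galg G = {x. \<forall>g. g \<notin> carrier G \<longrightarrow> x g = 0}"

text \<open>The sum runs over the carrier instead of the support of \<open>x\<close>, so that it can
  be reindexed by translations and by inversion; \<open>mult_group_algebra\<close> identifies it
  with the given product.\<close>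

definition conv :: "('g, 'r) monoid_scheme \<Rightarrow> ('g \<Rightarrow> 'f::field) \<Rightarrow> ('g \<Rightarrow> 'f) \<Rightarrow> 'g \<Rightarrow> 'f" where
  "conv G x y = (\<lambda>g. if g \<in> carrier G then \<Sum>h\<in>carrier G. x h * y (inv\<^bsub>G\<^esub> h \<otimes>\<^bsub>G\<^esub> g) else 0)"

definition point :: "'g \<Rightarrow> 'f \<Rightarrow> 'g \<Rightarrow> 'f::field" where
  "point g b = (\<lambda>h. if h = g then b else 0)"

text \<open>One equation is convenient for counting; that the inverse is two-sided and that the
  augmentation is 1 are consequences in a finite group algebra of characteristic 2.\<close>

definition unitary :: "('g, 'r) monoid_scheme \<Rightarrow> ('g \<Rightarrow> 'f::field) set" where
  "unitary G = {x \<in> galg G. conv G x (star G x) = point \<one>\<^bsub>G\<^esub> 1}"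

lemma galgD: "x \<in> galg G \<Longrightarrow> g \<notin> carrier G \<Longrightarrow> x g = 0"
  by (simp add: galg_def)

lemma galg_eqI:
  assumes "x \<in> galg G" "y \<in> galg G" "\<And>g. g \<in> carrier G \<Longrightarrow> x g = y g"
  shows "x = y"
  using assms by (fastforce simp: galg_def)

lemma galg_add: "x \<in> galg G \<Longrightarrow> y \<in> galg G \<Longrightarrow> x + y \<in> galg G"
  by (simp add: galg_def)

lemma galg_zero: "0 \<in> galg G"
  by (simp add: galg_def)

lemma galg_point: "g \<in> carrier G \<Longrightarrow> point g b \<in> galg G"
  by (auto simp: galg_def point_def)

lemma galg_conv: "conv G x y \<in> galg G"
  by (simp add: galg_def conv_def)

lemma galg_star: "star G x \<in> galg G"
  by (simp add: galg_def star_def)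

lemma conv_add_left: "conv G (x + y) z = conv G x z + conv G y z"
  by (rule ext) (simp add: conv_def distrib_right sum.distrib)

lemma conv_add_right: "conv G x (y + z) = conv G x y + conv G x z"
  by (rule ext) (simp add: conv_def distrib_left sum.distrib)

lemma conv_zero: "conv G x 0 = 0" "conv G 0 x = 0"
  by (rule ext, simp add: conv_def)+

lemma star_add: "star G (x + y) = star G x + star G y"
  by (rule ext) (simp add: star_def)

lemma point_zero: "point g 0 = 0"
  by (rule ext) (simp add: point_def)

lemma card_galg:
  "finite (carrier G) \<Longrightarrow> card (galg G :: ('g \<Rightarrow> 'f::{field,finite}) set) = CARD('f) ^ card (carrier G)"
  unfolding galg_def by (rule card_supported_functions)

lemma finite_galg:
  assumes "finite (carrier G)"
  shows "finite (galg G :: ('g \<Rightarrow> 'f::{field,finite}) set)"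
proof (rule card_ge_0_finite)
  show "0 < card (galg G :: ('g \<Rightarrow> 'f) set)" unfolding card_galg[OF assms] by simp
qed

lemma finite_unitary:
  "finite (carrier G) \<Longrightarrow> finite (unitary G :: ('g \<Rightarrow> 'f::{field,finite}) set)"
  unfolding unitary_def by (rule finite_subset[OF _ finite_galg]) auto

locale finite_group = group +
  assumes finite_carrier: "finite (carrier G)"
begin

lemma bij_left: "a \<in> carrier G \<Longrightarrow> bij_betw (\<lambda>g. a \<otimes> g) (carrier G) (carrier G)"
  by (rule bij_betw_byWitness[where f' = "\<lambda>g. inv a \<otimes> g"]) (auto simp: m_assoc[symmetric])

lemma bij_right: "a \<in> carrier G \<Longrightarrow> bij_betw (\<lambda>g. g \<otimes> a) (carrier G) (carrier G)"
  by (rule bij_betw_byWitness[where f' = "\<lambda>g. g \<otimes> inv a"]) (auto simp: m_assoc)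

lemma bij_inv: "bij_betw (\<lambda>g. inv g) (carrier G) (carrier G)"
  by (rule bij_betw_byWitness[where f' = "\<lambda>g. inv g"]) auto

lemma conv_point_left:
  assumes "g \<in> carrier G" "h \<in> carrier G"
  shows "conv G (point g b) x h = b * x (inv g \<otimes> h)"
proof -
  have "conv G (point g b) x h = (\<Sum>k\<in>carrier G. if k = g then b * x (inv g \<otimes> h) else 0)"
    unfolding conv_def using assms by (auto intro!: sum.cong simp: point_def)
  then show ?thesis using finite_carrier assms by simp
qed

lemma conv_point:
  assumes "g \<in> carrier G" "h \<in> carrier G"
  shows "conv G (point g b) (point h c) = point (g \<otimes> h) (b * c)"
proof (rule galg_eqI)
  fix k assume k: "k \<in> carrier G"
  have "inv g \<otimes> k = h \<longleftrightarrow> k = g \<otimes> h" using inv_solve_left[of h g k] k assms by metis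
  then show "conv G (point g b) (point h c) k = point (g \<otimes> h) (b * c) k"
    unfolding conv_point_left[OF assms(1) k] by (simp add: point_def)
qed (use assms in \<open>auto intro: galg_point galg_conv\<close>)

lemma conv_one_left:
  assumes "x \<in> galg G"
  shows "conv G (point \<one> 1) x = x"
proof (rule galg_eqI[OF galg_conv assms])
  fix k assume k: "k \<in> carrier G"
  show "conv G (point \<one> 1) x k = x k" by (simp add: conv_point_left[OF one_closed k] k)
qed

text \<open>Substituting \<open>inv h \<otimes> g\<close> for \<open>h\<close> turns the sum around;
  this mirrored form is what the reversal of products by \<open>star\<close> and commutativity are
  checked against.\<close>

lemma conv_alt:
  assumes "g \<in> carrier G"
  shows "conv G x y g = (\<Sum>h\<in>carrier G. x (g \<otimes> inv h) * y h)"
proof -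
  have "bij_betw (\<lambda>h. inv h \<otimes> g) (carrier G) (carrier G)"
    using bij_betw_trans[OF bij_inv bij_right[OF assms]] by (simp add: comp_def)
  then have "(\<Sum>h\<in>carrier G. x (g \<otimes> inv h) * y h) =
      (\<Sum>h\<in>carrier G. x (g \<otimes> inv (inv h \<otimes> g)) * y (inv h \<otimes> g))"
    by (rule sum.reindex_bij_betw[symmetric])
  also have "\<dots> = (\<Sum>h\<in>carrier G. x h * y (inv h \<otimes> g))"
    using assms by (intro sum.cong) (auto simp: inv_mult_group m_assoc[symmetric])
  finally show ?thesis using assms by (simp add: conv_def)
qed

lemma conv_assoc: "conv G (conv G x y) z = conv G x (conv G y z)"
proof (rule galg_eqI[OF galg_conv galg_conv])
  fix g assume g: "g \<in> carrier G"
  have "conv G (conv G x y) z g =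
      (\<Sum>h\<in>carrier G. \<Sum>k\<in>carrier G. x k * y (inv k \<otimes> h) * z (inv h \<otimes> g))"
    using g by (simp add: conv_def sum_distrib_right)
  also have "\<dots> = (\<Sum>k\<in>carrier G. \<Sum>h\<in>carrier G. x k * y (inv k \<otimes> h) * z (inv h \<otimes> g))"
    by (rule sum.swap)
  also have "\<dots> = (\<Sum>k\<in>carrier G. \<Sum>h\<in>carrier G. x k * y h * z (inv (k \<otimes> h) \<otimes> g))"
  proof (rule sum.cong[OF HOL.refl])
    fix k assume k: "k \<in> carrier G"
    have "(\<Sum>h\<in>carrier G. x k * y (inv k \<otimes> h) * z (inv h \<otimes> g)) =
        (\<Sum>h\<in>carrier G. x k * y (inv k \<otimes> (k \<otimes> h)) * z (inv (k \<otimes> h) \<otimes> g))"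
      by (rule sum.reindex_bij_betw[OF bij_left[OF k], symmetric])
    also have "\<dots> = (\<Sum>h\<in>carrier G. x k * y h * z (inv (k \<otimes> h) \<otimes> g))"
      using k by (intro sum.cong) (auto simp: m_assoc[symmetric])
    finally show "(\<Sum>h\<in>carrier G. x k * y (inv k \<otimes> h) * z (inv h \<otimes> g)) = \<dots>" .
  qed
  also have "\<dots> = conv G x (conv G y z) g"
    using g by (auto simp: conv_def sum_distrib_left inv_mult_group m_assoc mult.assoc intro!: sum.cong)
  finally show "conv G (conv G x y) z g = conv G x (conv G y z) g" .
qed

lemma star_star: "x \<in> galg G \<Longrightarrow> star G (star G x) = x"
  by (rule galg_eqI[OF galg_star]) (auto simp: star_def)

lemma star_point: "g \<in> carrier G \<Longrightarrow> star G (point g b) = point (inv g) b"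
  by (rule galg_eqI[OF galg_star galg_point]) (auto simp: star_def point_def)

lemma star_conv: "star G (conv G x y) = conv G (star G y) (star G x)"
proof (rule galg_eqI[OF galg_star galg_conv])
  fix g assume g: "g \<in> carrier G"
  have "star G (conv G x y) g = (\<Sum>h\<in>carrier G. x h * y (inv h \<otimes> inv g))"
    using g by (simp add: conv_def star_def)
  also have "\<dots> = (\<Sum>h\<in>carrier G. star G y (g \<otimes> inv (inv h)) * star G x (inv h))"
    using g by (intro sum.cong) (auto simp: star_def inv_mult_group)
  also have "\<dots> = (\<Sum>h\<in>carrier G. star G y (g \<otimes> inv h) * star G x h)"
    by (rule sum.reindex_bij_betw[OF bij_inv])
  finally show "star G (conv G x y) g = conv G (star G y) (star G x) g"
    by (simp only: conv_alt[OF g])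
qed

lemma conv_one_right:
  assumes "x \<in> galg G"
  shows "conv G x (point \<one> 1) = x"
proof -
  have "star G (conv G x (point \<one> 1)) = star G x"
    by (simp add: star_conv star_point conv_one_left galg_star)
  then show ?thesis using star_star assms galg_conv by metis
qed

lemma one_unitary: "point \<one> 1 \<in> unitary G"
  by (simp add: unitary_def galg_point star_point conv_point)

lemma conv_unitary:
  assumes "x \<in> unitary G" "y \<in> unitary G"
  shows "conv G x y \<in> unitary G"
proof -
  have "conv G (conv G x y) (star G (conv G x y)) =
      conv G x (conv G (conv G y (star G y)) (star G x))"
    by (simp add: star_conv conv_assoc)
  also have "\<dots> = point \<one> 1" using assms by (simp add: unitary_def conv_one_left galg_star)
  finally show ?thesis by (simp add: unitary_def galg_conv)
qed

text \<open>A one-sided inverse in a finite monoid is two-sided.\<close>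

lemma unitary_star_left:
  assumes "x \<in> unitary (G :: ('a, 'b) monoid_scheme)"
  shows "conv G (star G x) x = point \<one> (1::'f::{field,finite})"
proof -
  let ?U = "unitary G :: ('a \<Rightarrow> 'f) set"
  have x: "x \<in> galg G" "conv G x (star G x) = point \<one> 1" using assms by (auto simp: unitary_def)
  have "inj_on (\<lambda>y. conv G y x) ?U"
  proof (rule inj_onI)
    fix y z assume yz: "y \<in> ?U" "z \<in> ?U" "conv G y x = conv G z x"
    then have "conv G (conv G y x) (star G x) = conv G (conv G z x) (star G x)" by simp
    moreover have "y \<in> galg G" "z \<in> galg G" using yz by (simp_all add: unitary_def)
    ultimately show "y = z" by (simp only: conv_assoc x conv_one_right)
  qed
  moreover have "(\<lambda>y. conv G y x) ` ?U \<subseteq> ?U" using assms conv_unitary by blast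
  ultimately have "(\<lambda>y. conv G y x) ` ?U = ?U"
    by (rule endo_inj_surj[OF finite_unitary[OF finite_carrier], rotated])
  then obtain y where y: "y \<in> ?U" "conv G y x = point \<one> 1" using one_unitary by (metis imageE)
  have "y = conv G y (conv G x (star G x))"
    using y(1) by (simp add: x conv_one_right unitary_def)
  also have "\<dots> = star G x" by (simp add: conv_assoc[symmetric] y(2) conv_one_left galg_star)
  finally show ?thesis using y by simp
qed

lemma star_unitary:
  assumes "x \<in> unitary (G :: ('a, 'b) monoid_scheme)"
  shows "star G x \<in> (unitary G :: ('a \<Rightarrow> 'f::{field,finite}) set)"
  using unitary_star_left[OF assms] assms by (simp add: unitary_def galg_star star_star)

lemma sum_conv:
  "(\<Sum>g\<in>carrier G. conv G x y g) = (\<Sum>g\<in>carrier G. x g) * (\<Sum>g\<in>carrier G. y g)"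
proof -
  have "(\<Sum>g\<in>carrier G. conv G x y g) =
      (\<Sum>g\<in>carrier G. \<Sum>h\<in>carrier G. x h * y (inv h \<otimes> g))"
    by (simp add: conv_def)
  also have "\<dots> = (\<Sum>h\<in>carrier G. \<Sum>g\<in>carrier G. x h * y (inv h \<otimes> g))"
    by (rule sum.swap)
  also have "\<dots> = (\<Sum>h\<in>carrier G. x h * (\<Sum>g\<in>carrier G. y g))"
  proof (rule sum.cong[OF HOL.refl])
    fix h assume h: "h \<in> carrier G"
    have "(\<Sum>g\<in>carrier G. y (inv h \<otimes> g)) = (\<Sum>g\<in>carrier G. y g)"
      by (rule sum.reindex_bij_betw[OF bij_left]) (simp add: h)
    then show "(\<Sum>g\<in>carrier G. x h * y (inv h \<otimes> g)) = x h * (\<Sum>g\<in>carrier G. y g)"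
      by (simp add: sum_distrib_left[symmetric])
  qed
  finally show ?thesis by (simp add: sum_distrib_right)
qed

lemma sum_star: "(\<Sum>g\<in>carrier G. star G x g) = (\<Sum>g\<in>carrier G. x g)"
proof -
  have "(\<Sum>g\<in>carrier G. star G x g) = (\<Sum>g\<in>carrier G. x (inv g))" by (simp add: star_def)
  also have "\<dots> = (\<Sum>g\<in>carrier G. x g)" by (rule sum.reindex_bij_betw[OF bij_inv])
  finally show ?thesis .
qed

text \<open>The augmentation is multiplicative and invariant under \<open>star\<close>, so its
  square is 1, and in characteristic 2 only 1 has square 1.\<close>

lemma sum_unitary:
  assumes char: "CHAR('f::{field,finite}) = 2" and x: "x \<in> (unitary G :: ('a \<Rightarrow> 'f) set)"
  shows "(\<Sum>g\<in>carrier G. x g) = 1"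
proof -
  let ?e = "\<Sum>g\<in>carrier G. x g"
  have "(\<Sum>g\<in>carrier G. conv G x (star G x) g) = 1"
    using x finite_carrier by (simp add: unitary_def point_def)
  then have "?e * ?e = 1" unfolding sum_conv sum_star .
  then have "(?e + 1) * (?e + 1) = 0"
    by (simp add: algebra_simps char2_two[OF char])
  then have "?e + 1 = 0" by simp
  then show ?thesis using char2_add_eq_iff[OF char, of 1 ?e 0] by (simp add: add.commute)
qed

lemma monoid_group_algebra: "monoid (group_algebra G :: ('a \<Rightarrow> 'f::{field,finite}) ring)"
  and carrier_group_algebra: "carrier (group_algebra G :: ('a \<Rightarrow> 'f) ring) = galg G"
  and mult_group_algebra: "x \<in> galg G \<Longrightarrow>
    x \<otimes>\<^bsub>group_algebra G\<^esub> y = (conv G x y :: 'a \<Rightarrow> 'f)"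
  and one_group_algebra: "\<one>\<^bsub>group_algebra G\<^esub> = (point \<one> 1 :: 'a \<Rightarrow> 'f)"
proof -
  show c: "carrier (group_algebra G :: ('a \<Rightarrow> 'f) ring) = galg G"
    unfolding group_algebra_def galg_def using finite_carrier
    by (auto intro: finite_subset)
  show m: "x \<otimes>\<^bsub>group_algebra G\<^esub> y = conv G x y" if x: "x \<in> galg G" for x y :: "'a \<Rightarrow> 'f"
  proof -
    have "(\<Sum>h | x h \<noteq> 0. x h * y (inv h \<otimes> g)) = (\<Sum>h\<in>carrier G. x h * y (inv h \<otimes> g))" for g
      by (rule sum.mono_neutral_left[OF finite_carrier]) (use galgD[OF x] in auto)
    then show ?thesis by (auto simp: group_algebra_def conv_def)
  qed
  show o: "\<one>\<^bsub>group_algebra G\<^esub> = (point \<one> 1 :: 'a \<Rightarrow> 'f)"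
    by (simp add: group_algebra_def point_def)
  show "monoid (group_algebra G :: ('a \<Rightarrow> 'f) ring)"
    by (rule monoidI) (simp_all add: c m o galg_conv galg_point conv_assoc conv_one_left conv_one_right)
qed

text \<open>Bridge to the notion in the statement: counting supplies the second inverse equation and
  characteristic 2 the augmentation.\<close>

lemma normalized_unitary_eq:
  assumes char: "CHAR('f::{field,finite}) = 2"
  shows "normalized_unitary G = (unitary G :: ('a \<Rightarrow> 'f) set)"
proof -
  let ?R = "group_algebra G :: ('a \<Rightarrow> 'f) ring"
  interpret R: monoid ?R by (rule monoid_group_algebra)
  note simps = carrier_group_algebra mult_group_algebra one_group_algebra
  have "x \<in> normalized_unitary G" if x: "x \<in> unitary G" for x :: "'a \<Rightarrow> 'f"
  proof -
    have xg: "x \<in> galg G" using x by (simp add: unitary_def)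
    have "x \<otimes>\<^bsub>?R\<^esub> star G x = \<one>\<^bsub>?R\<^esub>" "star G x \<otimes>\<^bsub>?R\<^esub> x = \<one>\<^bsub>?R\<^esub>"
      using x unitary_star_left[OF x] by (simp_all add: simps xg galg_star unitary_def)
    moreover have "star G x \<in> carrier ?R" "x \<in> carrier ?R" by (simp_all add: simps galg_star xg)
    moreover have "(\<Sum>g | x g \<noteq> 0. x g) = (\<Sum>g\<in>carrier G. x g)"
      by (rule sum.mono_neutral_left[OF finite_carrier]) (use galgD[OF xg] in auto)
    ultimately show ?thesis
      using sum_unitary[OF char x] R.inv_char[of x "star G x"] R.inv_unique'[of x "star G x"]
      by (auto simp: normalized_unitary_def normalized_def Units_def)
  qed
  moreover have "x \<in> unitary G" if x: "x \<in> normalized_unitary G" for x :: "'a \<Rightarrow> 'f"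
  proof -
    have "x \<in> Units ?R" "star G x = inv\<^bsub>?R\<^esub> x" "x \<in> galg G"
      using x by (auto simp: normalized_unitary_def normalized_def simps)
    then show ?thesis using R.Units_r_inv[of x] by (simp add: unitary_def simps)
  qed
  ultimately show ?thesis by blast
qed

end

lemma (in comm_group) conv_comm:
  assumes "finite (carrier G)"
  shows "conv G x y = conv G y x"
proof -
  interpret finite_group G by unfold_locales (rule assms)
  show ?thesis
  proof (rule galg_eqI[OF galg_conv galg_conv])
    fix g assume g: "g \<in> carrier G"
    show "conv G x y g = conv G y x g"
    proof -
      have "g \<otimes> inv h = inv h \<otimes> g" if "h \<in> carrier G" for h
        using that g by (simp add: m_comm)
      then show ?thesis
        using g conv_alt[OF g, of x y] by (simp add: conv_def mult.commute)
    qed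
  qed
qed

section \<open>Unitary units and central extensions of abelian groups by an involution\<close>

lemma char2_fun_add_eq_iff:
  assumes "CHAR('f::{field,finite}) = 2"
  shows "(x :: 'b \<Rightarrow> 'f) + y = w \<longleftrightarrow> y = x + w"
proof -
  have "x + (x + v) = v" for v
    unfolding add.assoc[symmetric] char2_fun_add_self[OF assms] by simp
  then show ?thesis by metis
qed

text \<open>\<open>G\<close> may be non-abelian, so one locale serves both the induction on abelian
  groups and the final step. The type argument fixes the coefficient field, whose characteristic is
  thereby an assumption of the locale.\<close>

locale central_extension = finite_group G + A: comm_group A
  for G (structure) and A +
  fixes \<pi> :: "'a \<Rightarrow> 'c" and c :: 'a and F :: "'f::{field,finite} itself"
  assumes hom: "\<pi> \<in> hom G A" and surj: "\<pi> ` carrier G = carrier A"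
    and kernel: "{g \<in> carrier G. \<pi> g = \<one>\<^bsub>A\<^esub>} = {\<one>, c}" and c_not_one: "c \<noteq> \<one>"
    and char: "CHAR('f) = 2"
begin

sublocale A: finite_group A
  by unfold_locales (use surj finite_carrier in \<open>metis finite_imageI\<close>)

lemma hom_closed: "g \<in> carrier G \<Longrightarrow> \<pi> g \<in> carrier A"
  using surj by blast

lemma hom_mult: "g \<in> carrier G \<Longrightarrow> h \<in> carrier G \<Longrightarrow> \<pi> (g \<otimes> h) = \<pi> g \<otimes>\<^bsub>A\<^esub> \<pi> h"
  using hom by (rule hom_mult)

lemma group_hom: "group_hom G A \<pi>"
  by (simp add: group_hom_def group_hom_axioms_def hom A.group_axioms group_axioms)

lemma hom_inv: "g \<in> carrier G \<Longrightarrow> \<pi> (inv g) = inv\<^bsub>A\<^esub> \<pi> g"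
  by (rule group_hom.hom_inv[OF group_hom])

lemma hom_one: "\<pi> \<one> = \<one>\<^bsub>A\<^esub>"
  by (rule group_hom.hom_one[OF group_hom])

lemma c_closed: "c \<in> carrier G" and hom_c: "\<pi> c = \<one>\<^bsub>A\<^esub>"
  using kernel by blast+

lemma kernelD: "g \<in> carrier G \<Longrightarrow> \<pi> g = \<one>\<^bsub>A\<^esub> \<Longrightarrow> g = \<one> \<or> g = c"
  using kernel by blast

lemma c_c: "c \<otimes> c = \<one>"
  using kernelD[of "c \<otimes> c"] c_closed c_not_one by (auto simp: hom_mult hom_c)

lemma inv_c: "inv c = c"
  by (rule inv_equality) (simp_all add: c_c c_closed)

text \<open>A normal subgroup of order two is central: a conjugate of \<open>c\<close> lies in the
  kernel and is not \<open>\<one>\<close>.\<close>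

lemma c_comm:
  assumes g: "g \<in> carrier G"
  shows "c \<otimes> g = g \<otimes> c"
proof -
  have "\<pi> (inv g \<otimes> c \<otimes> g) = \<one>\<^bsub>A\<^esub>"
    using g c_closed hom_closed[OF g] by (simp add: hom_mult hom_c hom_inv)
  moreover have "inv g \<otimes> c \<otimes> g \<noteq> \<one>"
  proof
    assume "inv g \<otimes> c \<otimes> g = \<one>"
    then have "g \<otimes> (inv g \<otimes> c \<otimes> g) \<otimes> inv g = \<one>" using g by simp
    moreover have "g \<otimes> (inv g \<otimes> c \<otimes> g) \<otimes> inv g = (g \<otimes> inv g) \<otimes> c \<otimes> (g \<otimes> inv g)"
      using g c_closed by (simp only: m_assoc m_closed inv_closed)
    ultimately show False using g c_closed c_not_one by simp
  qed
  ultimately have "inv g \<otimes> c \<otimes> g = c" using kernelD[of "inv g \<otimes> c \<otimes> g"] g c_closed by simp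
  then have "g \<otimes> (inv g \<otimes> c \<otimes> g) = g \<otimes> c" by simp
  then show ?thesis using g c_closed by (simp add: m_assoc[symmetric])
qed

lemma hom_eq_iff:
  assumes "g \<in> carrier G" "h \<in> carrier G"
  shows "\<pi> h = \<pi> g \<longleftrightarrow> h = g \<or> h = g \<otimes> c"
proof
  assume "\<pi> h = \<pi> g"
  then have "\<pi> (inv g \<otimes> h) = \<one>\<^bsub>A\<^esub>" using assms hom_closed by (simp add: hom_mult hom_inv)
  then have "inv g \<otimes> h = \<one> \<or> inv g \<otimes> h = c" using kernelD assms by simp
  then have "h = g \<otimes> \<one> \<or> h = g \<otimes> c"
    using assms c_closed inv_solve_left[of _ g h] by (metis one_closed)
  then show "h = g \<or> h = g \<otimes> c" using assms by simp
next
  assume "h = g \<or> h = g \<otimes> c"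
  then show "\<pi> h = \<pi> g" using assms c_closed hom_closed by (auto simp: hom_mult hom_c)
qed

lemma mult_c_neq: "g \<in> carrier G \<Longrightarrow> g \<otimes> c \<noteq> g"
  using c_closed c_not_one by simp

lemma fiber: "g \<in> carrier G \<Longrightarrow> {h \<in> carrier G. \<pi> h = \<pi> g} = {g, g \<otimes> c}"
  using hom_eq_iff c_closed by auto

section \<open>Fibre sums and inflation between the two group algebras\<close>

definition sec :: "'c \<Rightarrow> 'a" where
  "sec a = (SOME g. g \<in> carrier G \<and> \<pi> g = a)"

lemma sec:
  assumes "a \<in> carrier A"
  shows "sec a \<in> carrier G" "\<pi> (sec a) = a"
proof -
  have "a \<in> \<pi> ` carrier G" unfolding surj by (rule assms)
  then obtain g where "g \<in> carrier G \<and> \<pi> g = a" by auto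
  from someI[of "\<lambda>g. g \<in> carrier G \<and> \<pi> g = a", OF this]
  have "sec a \<in> carrier G \<and> \<pi> (sec a) = a" unfolding sec_def .
  then show "sec a \<in> carrier G" "\<pi> (sec a) = a" by (rule conjunct1, rule conjunct2)
qed

text \<open>The linear extension of \<open>\<pi>\<close>, hence a homomorphism of algebras
  (\<open>push_conv\<close>).\<close>

definition push :: "('a \<Rightarrow> 'f) \<Rightarrow> 'c \<Rightarrow> 'f" where
  "push x = (\<lambda>a. \<Sum>g | g \<in> carrier G \<and> \<pi> g = a. x g)"

text \<open>This is \<open>1 + c\<close> times any lift of \<open>y\<close>. Thus
  \<open>pull\<close> identifies the algebra of \<open>A\<close> with the ideal generated by
  \<open>1 + c\<close>, which is the kernel of \<open>push\<close>.\<close>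

definition pull :: "('c \<Rightarrow> 'f) \<Rightarrow> 'a \<Rightarrow> 'f" where
  "pull y = (\<lambda>g. if g \<in> carrier G then y (\<pi> g) else 0)"

lemma push_apply: "g \<in> carrier G \<Longrightarrow> push x (\<pi> g) = x g + x (g \<otimes> c)"
  unfolding push_def fiber using mult_c_neq[of g] by (subst sum.insert) auto

lemma galg_push: "push x \<in> galg A"
  unfolding galg_def push_def
  by (auto intro!: sum.neutral simp: hom_closed)

lemma galg_pull: "pull y \<in> galg G"
  by (simp add: galg_def pull_def)

lemma push_add: "push (x + y) = push x + push y"
  by (rule ext) (simp add: push_def sum.distrib)

lemma pull_add: "pull (x + y) = pull x + pull y"
  by (rule ext) (simp add: pull_def)

lemma pull_zero: "pull 0 = 0"
  by (rule ext) (simp add: pull_def)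

lemma push_pull: "push (pull y) = 0"
proof (rule galg_eqI[OF galg_push galg_zero])
  fix a assume "a \<in> carrier A"
  then obtain g where g: "g \<in> carrier G" "a = \<pi> g" using surj by blast
  then show "push (pull y) a = 0 a"
    using c_closed hom_closed
    by (simp only: g(2) push_apply) (simp add: pull_def hom_mult hom_c char2_two[OF char])
qed

lemma pull_inj:
  assumes "y \<in> galg A" "y' \<in> galg A" "pull y = pull y'"
  shows "y = y'"
proof (rule galg_eqI[OF assms(1,2)])
  fix a assume "a \<in> carrier A"
  then obtain g where g: "g \<in> carrier G" "a = \<pi> g" using surj by blast
  have "pull y g = pull y' g" using assms(3) by simp
  then show "y a = y' a" using g by (simp add: pull_def)
qed

text \<open>In characteristic 2 a vanishing sum over the fibre \<open>{g, g \<otimes> c}\<close>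
  means equal values, so the element is constant on fibres. Together with \<open>push_pull\<close>
  this is exactness in the middle.\<close>

lemma push_zeroE:
  assumes x: "x \<in> galg G" "push x = 0"
  obtains y where "y \<in> galg A" "x = pull y"
proof
  let ?y = "\<lambda>a. if a \<in> carrier A then x (sec a) else 0"
  show "?y \<in> galg A" by (simp add: galg_def)
  show "x = pull ?y"
  proof (rule galg_eqI[OF x(1) galg_pull])
    fix g assume g: "g \<in> carrier G"
    have "push x (\<pi> g) = 0" using x(2) by simp
    then have "x (g \<otimes> c) = x g"
      using char2_add_eq_iff[OF char, of "x g" "x (g \<otimes> c)" 0] g by (simp add: push_apply)
    moreover have "sec (\<pi> g) = g \<or> sec (\<pi> g) = g \<otimes> c"
      using hom_eq_iff[OF g] sec hom_closed[OF g] by blast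
    ultimately show "x g = pull ?y g" using g hom_closed by (auto simp: pull_def)
  qed
qed

lemma sum_fibers: "(\<Sum>h\<in>carrier G. x h * f (\<pi> h)) = (\<Sum>b\<in>carrier A. push x b * f b)"
proof -
  have "(\<Sum>h\<in>carrier G. x h * f (\<pi> h)) =
      (\<Sum>b\<in>carrier A. \<Sum>h | h \<in> carrier G \<and> \<pi> h = b. x h * f (\<pi> h))"
    by (rule sum.group[symmetric]) (use finite_carrier A.finite_carrier surj in auto)
  also have "\<dots> = (\<Sum>b\<in>carrier A. push x b * f b)"
    unfolding push_def sum_distrib_right by (intro sum.cong) auto
  finally show ?thesis .
qed

lemma sum_push: "(\<Sum>b\<in>carrier A. push x b) = (\<Sum>h\<in>carrier G. x h)"
  using sum_fibers[of x "\<lambda>_. 1"] by simp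

lemma push_conv: "push (conv G x y) = conv A (push x) (push y)"
proof (rule galg_eqI[OF galg_push galg_conv])
  fix a assume a: "a \<in> carrier A"
  have 1: "(\<Sum>g | g \<in> carrier G \<and> \<pi> g = a. y (inv h \<otimes> g)) = push y (inv\<^bsub>A\<^esub> \<pi> h \<otimes>\<^bsub>A\<^esub> a)"
    if h: "h \<in> carrier G" for h
    unfolding push_def
  proof (rule sum.reindex_bij_betw, rule bij_betw_byWitness[where f' = "\<lambda>k. h \<otimes> k"])
    show "(\<lambda>g. inv h \<otimes> g) ` {g \<in> carrier G. \<pi> g = a} \<subseteq>
        {g \<in> carrier G. \<pi> g = inv\<^bsub>A\<^esub> \<pi> h \<otimes>\<^bsub>A\<^esub> a}"
      using h by (auto simp: hom_mult hom_inv)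
    show "(\<lambda>k. h \<otimes> k) ` {g \<in> carrier G. \<pi> g = inv\<^bsub>A\<^esub> \<pi> h \<otimes>\<^bsub>A\<^esub> a} \<subseteq>
        {g \<in> carrier G. \<pi> g = a}"
      using h a hom_closed[OF h] by (auto simp: hom_mult A.m_assoc[symmetric])
  qed (use h in \<open>auto simp: m_assoc[symmetric]\<close>)
  have "push (conv G x y) a =
      (\<Sum>g | g \<in> carrier G \<and> \<pi> g = a. \<Sum>h\<in>carrier G. x h * y (inv h \<otimes> g))"
    unfolding push_def by (intro sum.cong) (auto simp: conv_def)
  also have "\<dots> = (\<Sum>h\<in>carrier G. x h * (\<Sum>g | g \<in> carrier G \<and> \<pi> g = a. y (inv h \<otimes> g)))"
    by (subst sum.swap) (simp add: sum_distrib_left)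
  also have "\<dots> = (\<Sum>h\<in>carrier G. x h * push y (inv\<^bsub>A\<^esub> \<pi> h \<otimes>\<^bsub>A\<^esub> a))"
    using 1 by (intro sum.cong) auto
  also have "\<dots> = conv A (push x) (push y) a"
    using sum_fibers[of x "\<lambda>b. push y (inv\<^bsub>A\<^esub> b \<otimes>\<^bsub>A\<^esub> a)"] a by (simp add: conv_def)
  finally show "push (conv G x y) a = conv A (push x) (push y) a" .
qed

text \<open>Projection formula: on functions constant along the fibres, \<open>x\<close> acts only
  through its image in the algebra of \<open>A\<close>.\<close>

lemma conv_pull: "conv G x (pull y) = pull (conv A (push x) y)"
proof (rule galg_eqI[OF galg_conv galg_pull])
  fix g assume g: "g \<in> carrier G"
  have "conv G x (pull y) g = (\<Sum>h\<in>carrier G. x h * y (inv\<^bsub>A\<^esub> \<pi> h \<otimes>\<^bsub>A\<^esub> \<pi> g))"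
    using g by (auto simp: conv_def pull_def hom_mult hom_inv intro!: sum.cong)
  also have "\<dots> = pull (conv A (push x) y) g"
    using sum_fibers[of x "\<lambda>b. y (inv\<^bsub>A\<^esub> b \<otimes>\<^bsub>A\<^esub> \<pi> g)"] g hom_closed[OF g]
    by (simp add: conv_def pull_def)
  finally show "conv G x (pull y) g = pull (conv A (push x) y) g" .
qed

lemma push_star: "push (star G x) = star A (push x)"
proof (rule galg_eqI[OF galg_push galg_star])
  fix a assume a: "a \<in> carrier A"
  then obtain g where g: "g \<in> carrier G" "a = \<pi> g" using surj by blast
  have "inv (g \<otimes> c) = inv g \<otimes> c" using g c_closed c_comm by (simp add: inv_mult_group inv_c)
  then show "push (star G x) a = star A (push x) a"
    using g a c_closed push_apply[of g] push_apply[of "inv g" x]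
    by (simp add: star_def hom_inv)
qed

lemma star_pull: "star G (pull y) = pull (star A y)"
  by (rule galg_eqI[OF galg_star galg_pull]) (auto simp: star_def pull_def hom_inv hom_closed)

text \<open>Follows from \<open>conv_pull\<close> by applying \<open>star\<close>, which reverses
  products.\<close>

lemma pull_conv:
  assumes "x \<in> galg G" "y \<in> galg A"
  shows "conv G (pull y) x = pull (conv A y (push x))"
proof -
  have "star G (conv G (pull y) x) = star G (pull (conv A y (push x)))"
    by (simp add: star_conv star_pull conv_pull push_star A.star_conv)
  then show ?thesis by (metis star_star galg_conv galg_pull)
qed

lemma push_point:
  assumes g: "g \<in> carrier G"
  shows "push (point g b) = point (\<pi> g) b"
proof (rule galg_eqI[OF galg_push galg_point])
  show "\<pi> g \<in> carrier A" using g by (rule hom_closed)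
  fix a assume "a \<in> carrier A"
  have "push (point g b) a = (\<Sum>h | h \<in> carrier G \<and> \<pi> h = a. if h = g then b else 0)"
    by (simp add: push_def point_def)
  also have "\<dots> = point (\<pi> g) b a" using finite_carrier g by (auto simp: point_def)
  finally show "push (point g b) a = point (\<pi> g) b a" .
qed

section \<open>Lifts of unitary units and their defects\<close>

definition lift :: "('c \<Rightarrow> 'f) \<Rightarrow> 'a \<Rightarrow> 'f" where
  "lift y = (\<lambda>g. if g \<in> carrier G \<and> sec (\<pi> g) = g then y (\<pi> g) else 0)"

lemma galg_lift: "lift y \<in> galg G"
  by (simp add: galg_def lift_def)

lemma push_lift:
  assumes "y \<in> galg A"
  shows "push (lift y) = y"
proof (rule galg_eqI[OF galg_push assms])
  fix a assume a: "a \<in> carrier A"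
  define g where "g = sec a"
  have g: "g \<in> carrier G" "\<pi> g = a" "sec a = g" using sec[OF a] by (auto simp: g_def)
  then have "\<pi> (g \<otimes> c) = a" "g \<otimes> c \<noteq> g" using hom_eq_iff[of g "g \<otimes> c"] c_closed mult_c_neq by auto
  then show "push (lift y) a = y a"
    using push_apply[of g "lift y"] g c_closed by (simp add: lift_def)
qed

abbreviation norm :: "('a \<Rightarrow> 'f) \<Rightarrow> 'a \<Rightarrow> 'f" where
  "norm x \<equiv> conv G x (star G x)"

text \<open>The function \<open>s\<close> of the overview, with \<open>+\<close> in place of
  subtraction. Reading it off at one chosen representative is legitimate when \<open>push x\<close>
  is unitary, since \<open>norm x\<close> and 1 then differ by a function constant on
  fibres.\<close>

definition defect :: "('a \<Rightarrow> 'f) \<Rightarrow> 'c \<Rightarrow> 'f" where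
  "defect x = (\<lambda>a. if a \<in> carrier A then norm x (sec a) + point \<one> 1 (sec a) else 0)"

lemma galg_defect: "defect x \<in> galg A"
  by (simp add: galg_def defect_def)

lemma defect_unique:
  assumes "norm x = point \<one> 1 + pull y" "y \<in> galg A"
  shows "defect x = y"
proof (rule galg_eqI[OF galg_defect assms(2)])
  fix a assume a: "a \<in> carrier A"
  then show "defect x a = y a"
    using sec[OF a] char2_add_self[OF char, of "point \<one> 1 (sec a)"] unfolding assms(1) defect_def
    by (simp add: pull_def add.assoc add.commute[of "y a"] add.left_commute[of _ "y a"])
qed

lemma push_norm: "push (norm x) = conv A (push x) (star A (push x))"
  by (simp add: push_conv push_star)

lemma norm_eq_defect:
  assumes "push x \<in> unitary A"
  shows "norm x = point \<one> 1 + pull (defect x)"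
proof -
  have "push (norm x + point \<one> 1) = point \<one>\<^bsub>A\<^esub> 1 + point \<one>\<^bsub>A\<^esub> 1"
    using assms by (simp add: push_add push_norm push_point hom_one unitary_def)
  then have "push (norm x + point \<one> 1) = 0" by (simp only: char2_fun_add_self[OF char])
  then obtain y where y: "y \<in> galg A" "norm x + point \<one> 1 = pull y"
    using push_zeroE[of "norm x + point \<one> 1"] galg_add[OF galg_conv galg_point[OF one_closed]] by blast
  then have "norm x = point \<one> 1 + pull y"
    using char2_fun_add_eq_iff[OF char, of "point \<one> 1" "norm x" "pull y"] by (simp add: add.commute)
  then show ?thesis using defect_unique y(1) by metis
qed

lemma defect_apply:
  assumes "push x \<in> unitary A" "g \<in> carrier G"
  shows "defect x (\<pi> g) = norm x g + point \<one> 1 g"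
proof -
  have "norm x g = point \<one> 1 g + defect x (\<pi> g)"
    using norm_eq_defect[OF assms(1)] assms(2) by (simp add: pull_def)
  then have "defect x (\<pi> g) = point \<one> 1 g + norm x g"
    using char2_add_eq_iff[OF char, of "point \<one> 1 g" "defect x (\<pi> g)" "norm x g"] by metis
  then show ?thesis by (simp only: add.commute)
qed

text \<open>The norm of a product is \<open>norm y\<close> conjugated by \<open>x\<close> as
  \<open>conv G x (conv G (norm y) (star G x))\<close>; the defect of \<open>y\<close> lives in the
  commutative algebra of \<open>A\<close>, where this conjugation by a unitary element does
  nothing.\<close>

lemma defect_conv:
  assumes x: "x \<in> galg G" "push x \<in> unitary A" and y: "push y \<in> unitary A"
  shows "defect (conv G x y) = defect x + defect y"
proof (rule defect_unique)
  have d: "conv A (push x) (conv A (defect y) (star A (push x))) = defect y"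
  proof -
    have "conv A (push x) (conv A (defect y) (star A (push x))) =
        conv A (defect y) (conv A (push x) (star A (push x)))"
      using A.conv_comm[OF A.finite_carrier] by (metis A.conv_assoc)
    then show ?thesis using x(2) by (simp add: unitary_def A.conv_one_right galg_defect)
  qed
  have "norm (conv G x y) = conv G x (conv G (norm y) (star G x))"
    by (simp add: star_conv conv_assoc)
  also have "\<dots> = norm x + conv G x (conv G (pull (defect y)) (star G x))"
    by (simp add: norm_eq_defect[OF y] conv_add_left conv_add_right conv_one_left galg_star)
  also have "\<dots> = norm x + pull (defect y)"
    by (simp add: pull_conv galg_star galg_defect push_star conv_pull d)
  finally show "norm (conv G x y) = point \<one> 1 + pull (defect x + defect y)"
    by (simp add: norm_eq_defect[OF x(2)] pull_add add.assoc)
qed (simp add: galg_add galg_defect)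

text \<open>The two mixed terms of the expanded norm are \<open>z\<close> and its
  \<open>star\<close>. The quadratic term carries the factor \<open>(1 + c)^2\<close>, which is 0 in
  characteristic 2.\<close>

lemma defect_add_pull:
  assumes x: "x \<in> galg G" "push x \<in> unitary A" and y: "y \<in> galg A"
  defines "z \<equiv> conv A y (star A (push x))"
  shows "defect (x + pull y) = defect x + (z + star A z)"
proof (rule defect_unique)
  have "norm (x + pull y) =
      norm x + (conv G (pull y) (star G x) + conv G x (pull (star A y)) + conv G (pull y) (pull (star A y)))"
    by (simp add: star_add star_pull conv_add_left conv_add_right add_ac)
  also have "conv G (pull y) (pull (star A y)) = 0"
    by (simp add: conv_pull push_pull conv_zero pull_zero)
  also have "conv G (pull y) (star G x) = pull z"
    by (simp add: pull_conv galg_star y push_star z_def)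
  also have "conv G x (pull (star A y)) = pull (star A z)"
    by (simp add: conv_pull z_def A.star_conv A.star_star galg_push)
  finally show "norm (x + pull y) = point \<one> 1 + pull (defect x + (z + star A z))"
    by (simp only: norm_eq_defect[OF x(2)] pull_add add_ac add_0_right add_0_left)
  show "defect x + (z + star A z) \<in> galg A"
    by (simp add: z_def galg_add galg_defect galg_conv galg_star)
qed

text \<open>A norm is fixed by \<open>star\<close>, and \<open>pull\<close> carries the
  \<open>star\<close> of \<open>A\<close> to that of \<open>G\<close>.\<close>

lemma defect_sym:
  assumes "x \<in> galg G" "push x \<in> unitary A" "a \<in> carrier A"
  shows "defect x (inv\<^bsub>A\<^esub> a) = defect x a"
proof -
  have "norm x = star G (norm x)" unfolding star_conv star_star[OF assms(1)] ..
  also have "\<dots> = point \<one> 1 + pull (star A (defect x))"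
    unfolding norm_eq_defect[OF assms(2)] star_add star_pull star_point[OF one_closed] inv_one ..
  finally have "norm x = point \<one> 1 + pull (star A (defect x))" .
  then have "defect x = star A (defect x)" by (rule defect_unique) (rule galg_star)
  then have "defect x a = star A (defect x) a" by (rule fun_cong)
  then show ?thesis using assms(3) by (simp add: star_def)
qed

lemma square_sum: "(\<Sum>g\<in>S. x g :: 'f)\<^sup>2 = (\<Sum>g\<in>S. (x g)\<^sup>2)"
  by (induction S rule: infinite_finite_induct) (simp_all add: power2_sum char2_two[OF char])

text \<open>The coefficient at an involution \<open>g\<close> is the sum of
  \<open>x h * x (g \<otimes> h)\<close>, and \<open>h\<close> and \<open>g \<otimes> h\<close> are
  distinct indices with the same term.\<close>

lemma norm_involution:
  assumes g: "g \<in> carrier G" "g \<otimes> g = \<one>" "g \<noteq> \<one>" and x: "x \<in> galg G"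
  shows "norm x g = 0"
proof -
  have ig: "inv g = g" by (rule inv_equality) (use g in auto)
  have "norm x g = (\<Sum>h\<in>carrier G. x h * x (g \<otimes> h))"
    using g(1) unfolding conv_def by (auto simp: star_def inv_mult_group ig intro!: sum.cong)
  also have "\<dots> = (\<Sum>h\<in>{h \<in> carrier G. g \<otimes> h = h}. x h * x (g \<otimes> h))"
    by (rule char2_sum_involution[OF char finite_carrier])
       (use g in \<open>auto simp: m_assoc[symmetric] mult.commute\<close>)
  also have "{h \<in> carrier G. g \<otimes> h = h} = {}" using g by auto
  finally show ?thesis by simp
qed

text \<open>The coefficient at the identity is a sum of squares, which in characteristic 2 is the
  square of the augmentation.\<close>

lemma norm_one:
  assumes "x \<in> galg G" "push x \<in> unitary A"
  shows "norm x \<one> = 1"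
proof -
  have "norm x \<one> = (\<Sum>h\<in>carrier G. (x h)\<^sup>2)"
    unfolding conv_def by (auto simp: star_def power2_eq_square intro!: sum.cong)
  also have "\<dots> = (\<Sum>h\<in>carrier G. x h)\<^sup>2" by (simp add: square_sum)
  also have "\<dots> = 1" using A.sum_unitary[OF char assms(2)] by (simp add: sum_push)
  finally show ?thesis .
qed

text \<open>Where an element of \<open>A\<close> lifts to an element of square 1, every lift
  \<open>x\<close> of a unitary unit has defect zero. Among the self-inverse elements this leaves
  only those whose lifts square to \<open>c\<close> as a possible obstruction.\<close>

lemma defect_involution:
  assumes "x \<in> galg G" "push x \<in> unitary A" "g \<in> carrier G" "g \<otimes> g = \<one>"
  shows "defect x (\<pi> g) = 0"
proof (cases "g = \<one>")
  case True
  then show ?thesis using assms by (simp add: defect_apply norm_one point_def char2_two[OF char])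
next
  case False
  then show ?thesis using assms by (simp add: defect_apply norm_involution point_def)
qed

section \<open>The obstruction to a unitary lift\<close>

definition ram :: "'c set" where
  "ram = \<pi> ` square_roots G c"

text \<open>Restriction to \<open>ram\<close> makes the choice of lift irrelevant: a correction
  \<open>z + star A z\<close> vanishes at self-inverse elements in characteristic 2.\<close>

definition obstruction :: "('c \<Rightarrow> 'f) \<Rightarrow> 'c \<Rightarrow> 'f" where
  "obstruction y = (\<lambda>a. if a \<in> ram then defect (lift y) a else 0)"

lemma square_rootsD: "g \<in> square_roots G d \<Longrightarrow> g \<in> carrier G \<and> g \<otimes> g = d"
  by (auto simp: square_roots_def numeral_2_eq_2)

lemma square_rootsI: "g \<in> carrier G \<Longrightarrow> g \<otimes> g = d \<Longrightarrow> g \<in> square_roots G d"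
  by (auto simp: square_roots_def numeral_2_eq_2)

lemma ramD:
  assumes "a \<in> ram"
  obtains g where "g \<in> carrier G" "g \<otimes> g = c" "a = \<pi> g"
  using assms square_rootsD unfolding ram_def by blast

lemma ram_inv: "a \<in> ram \<Longrightarrow> a \<in> carrier A \<and> inv\<^bsub>A\<^esub> a = a"
proof (elim ramD)
  fix g assume g: "g \<in> carrier G" "g \<otimes> g = c" "a = \<pi> g"
  then have "a \<otimes>\<^bsub>A\<^esub> a = \<one>\<^bsub>A\<^esub>" using hom_mult[of g g] hom_c by simp
  then show ?thesis using g A.inv_equality[of a a] hom_closed by simp
qed

lemma defect_eq_obstruction:
  assumes x: "x \<in> galg G" "push x \<in> unitary A" and a: "a \<in> ram"
  shows "defect x a = obstruction (push x) a"
proof -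
  let ?l = "lift (push x)"
  have l: "?l \<in> galg G" "push ?l = push x" by (simp_all add: galg_lift push_lift galg_push)
  have "push (x + ?l) = 0" by (simp only: push_add l char2_fun_add_self[OF char])
  then obtain y where y: "y \<in> galg A" "x + ?l = pull y"
    using push_zeroE[of "x + ?l"] galg_add x(1) l(1) by blast
  then have x_eq: "x = ?l + pull y" using char2_fun_add_eq_iff[OF char, of ?l x "pull y"] by (simp add: add.commute)
  define z where "z = conv A y (star A (push x))"
  have "defect x = defect ?l + (z + star A z)"
    using defect_add_pull[of ?l y] l x y(1) x_eq by (simp add: z_def)
  moreover have "star A z a = z a" using ram_inv[OF a] by (simp add: star_def)
  ultimately show ?thesis using a by (simp add: obstruction_def char2_two[OF char])
qed

text \<open>The chosen lifts need not be multiplicative, but the product of two lifts is a lift of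
  the product, and any lift may be used on \<open>ram\<close>.\<close>

lemma obstruction_conv:
  assumes "x \<in> unitary A" "y \<in> unitary A"
  shows "obstruction (conv A x y) = obstruction x + obstruction y"
proof
  fix a
  have g: "x \<in> galg A" "y \<in> galg A" using assms by (auto simp: unitary_def)
  let ?z = "conv G (lift x) (lift y)"
  have p: "push ?z = conv A x y" by (simp add: push_conv push_lift g)
  show "obstruction (conv A x y) a = (obstruction x + obstruction y) a"
  proof (cases "a \<in> ram")
    case True
    have "obstruction (conv A x y) a = defect ?z a"
      using defect_eq_obstruction[OF galg_conv, of "lift x" "lift y" a] p True A.conv_unitary[OF assms] by simp
    also have "\<dots> = defect (lift x) a + defect (lift y) a"
      using defect_conv[of "lift x" "lift y"] g assms by (simp add: galg_lift push_lift)
    finally show ?thesis using True by (simp add: obstruction_def)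
  qed (simp add: obstruction_def)
qed

text \<open>Unitary preimages of \<open>y\<close> correspond to solutions of
  \<open>z + star A z = defect l\<close> for a fixed lift \<open>l\<close>. Such an equation is
  solvable iff its right-hand side vanishes at the self-inverse elements, and the number of
  solutions does not depend on that side.\<close>

lemma card_fiber:
  assumes y: "y \<in> unitary A"
  shows "card {x \<in> unitary G. push x = y} =
    (if obstruction y = 0 then CARD('f) ^ ((card (carrier A) + card {a \<in> carrier A. inv\<^bsub>A\<^esub> a = a}) div 2)
     else 0)"
proof -
  have yg: "y \<in> galg A" using y by (simp add: unitary_def)
  define l where "l = lift y"
  have l: "l \<in> galg G" "push l = y" by (simp_all add: l_def galg_lift push_lift yg)
  let ?Z = "{z \<in> galg A. z + star A z = defect l}"
  let ?X = "{x \<in> unitary G. push x = y}"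
  have yy: "conv A y (star A y) = point \<one>\<^bsub>A\<^esub> 1" "conv A (star A y) y = point \<one>\<^bsub>A\<^esub> 1"
    using y A.unitary_star_left[OF y] by (auto simp: unitary_def)
  have zy: "conv A (conv A z y) (star A y) = z" "conv A (conv A z (star A y)) y = z"
    if "z \<in> galg A" for z
    using that by (simp_all add: A.conv_assoc yy A.conv_one_right)
  have unit_iff: "x \<in> unitary G \<longleftrightarrow> defect x = 0" if "x \<in> galg G" "push x = y" for x
  proof
    assume "x \<in> unitary G"
    then show "defect x = 0"
      by (intro defect_unique) (auto simp: unitary_def pull_zero galg_zero)
  next
    assume "defect x = 0"
    then show "x \<in> unitary G"
      using norm_eq_defect[of x] that y by (simp add: unitary_def pull_zero)
  qed
  have def: "defect (l + pull (conv A z y)) = defect l + (z + star A z)" if "z \<in> galg A" for z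
    using defect_add_pull[of l "conv A z y"] l y that by (simp add: zy galg_conv)
  have p: "push (l + pull w) = y" for w by (simp add: push_add push_pull l)
  have lg: "l + pull w \<in> galg G" for w by (simp add: galg_add l galg_pull)
  have iff: "defect l + w = 0 \<longleftrightarrow> w = defect l" for w using char2_fun_add_eq_iff[OF char, of "defect l" w 0] by simp
  \<comment> \<open>The factor \<open>y\<close> in the correction cancels the
    \<open>star A y\<close> produced by the norm, so the defect changes by exactly
    \<open>z + star A z\<close>.\<close>
  have "bij_betw (\<lambda>z. l + pull (conv A z y)) ?Z ?X"
    unfolding bij_betw_def
  proof (intro conjI inj_onI equalityI subsetI)
    fix z z' assume z: "z \<in> ?Z" "z' \<in> ?Z" "l + pull (conv A z y) = l + pull (conv A z' y)"
    then have "conv A z y = conv A z' y" using pull_inj[OF galg_conv galg_conv] by simp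
    then have "conv A (conv A z y) (star A y) = conv A (conv A z' y) (star A y)" by simp
    then show "z = z'" using z by (simp add: zy)
  next
    fix x assume "x \<in> (\<lambda>z. l + pull (conv A z y)) ` ?Z"
    then obtain z where z: "z \<in> ?Z" "x = l + pull (conv A z y)" by blast
    then show "x \<in> ?X"
      using unit_iff[OF lg p] p def[of z] by (auto simp: char2_fun_add_self[OF char] iff)
  next
    fix x assume x: "x \<in> ?X"
    then have xg: "x \<in> galg G" by (simp add: unitary_def)
    have "push (x + l) = 0" using x by (simp add: push_add l char2_fun_add_self[OF char])
    then obtain w where w: "w \<in> galg A" "x + l = pull w"
      using push_zeroE[of "x + l"] galg_add xg l(1) by blast
    define z where "z = conv A w (star A y)"
    have "x = l + pull w" using w(2) char2_fun_add_eq_iff[OF char, of l x "pull w"] by (simp add: add.commute)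
    then have x_eq: "x = l + pull (conv A z y)" by (simp add: z_def zy w)
    moreover have "z \<in> ?Z"
      using def[of z] unit_iff[of x] x xg x_eq by (simp add: z_def galg_conv iff)
    ultimately show "x \<in> (\<lambda>z. l + pull (conv A z y)) ` ?Z" by blast
  qed
  then have card: "card ?X = card ?Z" by (simp add: bij_betw_same_card)
  have Z: "?Z = {z. (\<forall>a. a \<notin> carrier A \<longrightarrow> z a = 0) \<and> (\<forall>a\<in>carrier A. z a + z (inv\<^bsub>A\<^esub> a) = defect l a)}"
  proof -
    have "z + star A z = defect l \<longleftrightarrow> (\<forall>a\<in>carrier A. z a + z (inv\<^bsub>A\<^esub> a) = defect l a)"
      if "z \<in> galg A" for z
    proof
      assume *: "z + star A z = defect l"
      show "\<forall>a\<in>carrier A. z a + z (inv\<^bsub>A\<^esub> a) = defect l a"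
        unfolding *[symmetric] by (simp add: star_def)
    next
      assume *: "\<forall>a\<in>carrier A. z a + z (inv\<^bsub>A\<^esub> a) = defect l a"
      show "z + star A z = defect l"
        by (rule galg_eqI[OF galg_add[OF that galg_star] galg_defect]) (use * in \<open>simp add: star_def\<close>)
    qed
    then show ?thesis unfolding galg_def by blast
  qed
  show ?thesis
  proof (cases "obstruction y = 0")
    case True
    \<comment> \<open>A self-inverse element of \<open>A\<close> lifts to an element of square 1 or
      \<open>c\<close>: the first case is \<open>defect_involution\<close>, the second puts it in
      \<open>ram\<close>.\<close>
    have "defect l a = 0" if a: "a \<in> carrier A" "inv\<^bsub>A\<^esub> a = a" for a
    proof -
      obtain g where g: "g \<in> carrier G" "a = \<pi> g" using surj a by blast
      have "\<pi> (g \<otimes> g) = \<one>\<^bsub>A\<^esub>" using g a A.r_inv[OF a(1)] by (simp add: hom_mult)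
      then consider "g \<otimes> g = \<one>" | "g \<otimes> g = c" using kernelD[of "g \<otimes> g"] g(1) by blast
      then show ?thesis
      proof cases
        case 1
        then show ?thesis using defect_involution l y g by simp
      next
        case 2
        then have "a \<in> ram" using g square_rootsI unfolding ram_def by blast
        then have "defect l a = obstruction y a" by (simp add: obstruction_def l_def)
        then show ?thesis using True by simp
      qed
    qed
    then have "card ?Z = CARD('f) ^ ((card (carrier A) + card {a \<in> carrier A. inv\<^bsub>A\<^esub> a = a}) div 2)"
      unfolding Z by (intro card_symmetrization_fiber[OF char A.finite_carrier])
        (use l y defect_sym in auto)
    then show ?thesis using True card by simp
  next
    case False
    then obtain a where a: "obstruction y a \<noteq> 0" by (auto simp: fun_eq_iff)
    then have "a \<in> ram" "defect l a \<noteq> 0" by (auto simp: obstruction_def l_def split: if_splits)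
    then have "z a + z (inv\<^bsub>A\<^esub> a) \<noteq> defect l a" for z
      using ram_inv[of a] by (simp add: char2_two[OF char])
    then have "?Z = {}" unfolding Z using ram_inv[OF \<open>a \<in> ram\<close>] by blast
    then have "card ?Z = 0" by (simp only: card.empty)
    then show ?thesis using False card by (simp only: if_False)
  qed
qed

lemma push_unitary: "x \<in> unitary G \<Longrightarrow> push x \<in> unitary A"
  using push_norm[of x] by (simp add: unitary_def galg_push push_point hom_one)

lemma card_unitary_eq_kernel:
  "card (unitary G :: ('a \<Rightarrow> 'f) set) =
    card {y \<in> unitary A. obstruction y = 0} *
    CARD('f) ^ ((card (carrier A) + card {a \<in> carrier A. inv\<^bsub>A\<^esub> a = a}) div 2)"
  (is "_ = _ * ?q")
proof -
  have "card (unitary G :: ('a \<Rightarrow> 'f) set) = (\<Sum>y\<in>unitary A. card {x \<in> unitary G. push x = y})"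
    using sum.group[of "unitary G" "unitary A" push "\<lambda>_. 1::nat"] push_unitary
    by (simp add: finite_unitary finite_carrier A.finite_carrier image_subset_iff)
  also have "\<dots> = (\<Sum>y\<in>unitary A. if obstruction y = 0 then ?q else 0)"
    by (intro sum.cong) (simp_all add: card_fiber)
  also have "\<dots> = card {y \<in> unitary A. obstruction y = 0} * ?q"
    by (simp add: sum.If_cases finite_unitary A.finite_carrier Int_def)
  finally show ?thesis .
qed

text \<open>The values lie in a group of exponent two, so an element and its inverse have the same
  obstruction.\<close>

lemma obstruction_star:
  assumes "u \<in> unitary A"
  shows "obstruction (star A u) = obstruction u"
proof -
  have e: "obstruction (point \<one>\<^bsub>A\<^esub> 1) = 0"
    using obstruction_conv[OF A.one_unitary A.one_unitary]
    by (simp add: A.conv_point char2_fun_add_self[OF char])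
  have "obstruction (conv A u (star A u)) = obstruction u + obstruction (star A u)"
    by (rule obstruction_conv[OF assms A.star_unitary[OF assms]])
  then show ?thesis
    using assms e char2_fun_add_eq_iff[OF char, of "obstruction u" "obstruction (star A u)" 0]
    by (simp add: unitary_def)
qed

text \<open>The fibres of the obstruction are cosets: multiplication by a unitary unit
  \<open>u\<close> carries the kernel onto the fibre of \<open>u\<close>.\<close>

lemma card_unitary_quotient:
  "card (unitary A :: ('c \<Rightarrow> 'f) set) =
    card {y \<in> unitary A. obstruction y = 0} * card (obstruction ` unitary A)"
proof -
  let ?K = "{y \<in> unitary A. obstruction y = 0}"
  have fin: "finite (unitary A :: ('c \<Rightarrow> 'f) set)" by (simp add: finite_unitary A.finite_carrier)
  have fib: "card {y \<in> unitary A. obstruction y = v} = card ?K" if v: "v \<in> obstruction ` unitary A" for v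
  proof -
    obtain u where u: "u \<in> unitary A" "v = obstruction u" using v by blast
    have su: "star A u \<in> unitary A" using u A.star_unitary by blast
    have ug: "conv A u (star A u) = point \<one>\<^bsub>A\<^esub> 1" "conv A (star A u) u = point \<one>\<^bsub>A\<^esub> 1"
      using A.unitary_star_left[OF u(1)] u(1) by (auto simp: unitary_def)
    have "bij_betw (conv A u) ?K {y \<in> unitary A. obstruction y = v}"
    proof (rule bij_betw_byWitness[where f' = "conv A (star A u)"])
      show "\<forall>y\<in>?K. conv A (star A u) (conv A u y) = y"
        by (simp add: A.conv_assoc[symmetric] ug A.conv_one_left unitary_def)
      show "\<forall>y\<in>{y \<in> unitary A. obstruction y = v}. conv A u (conv A (star A u) y) = y"
        by (simp add: A.conv_assoc[symmetric] ug A.conv_one_left unitary_def)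
      show "conv A u ` ?K \<subseteq> {y \<in> unitary A. obstruction y = v}"
        using u by (auto simp: A.conv_unitary obstruction_conv)
      show "conv A (star A u) ` {y \<in> unitary A. obstruction y = v} \<subseteq> ?K"
        using u su by (auto simp: A.conv_unitary obstruction_conv obstruction_star char2_fun_add_self[OF char])
    qed
    then show ?thesis by (simp add: bij_betw_same_card)
  qed
  have "card (unitary A :: ('c \<Rightarrow> 'f) set) =
      (\<Sum>v\<in>obstruction ` unitary A. card {y \<in> unitary A. obstruction y = v})"
    using sum.group[of "unitary A" "obstruction ` unitary A" obstruction "\<lambda>_. 1::nat"] fin by simp
  also have "\<dots> = (\<Sum>v\<in>obstruction ` unitary A. card ?K)" by (intro sum.cong) (simp_all add: fib)
  finally show ?thesis by simp
qed

end

section \<open>Explicit unitary units and the obstructions they realise\<close>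

context central_extension
begin

text \<open>The witness is \<open>1 + b (1 + t) w\<close>. Its norm is 1 plus \<open>b\<close> times
  the sum of \<open>w\<close>, \<open>t \<otimes> w\<close> and their inverses, plus
  \<open>b\<^sup>2\<close> times the sum of \<open>t\<close> and its inverse. An element plus its
  inverse equals \<open>1 + c\<close> times the element exactly when its square is \<open>c\<close>,
  whence the case distinctions. The condition on \<open>w \<otimes> w\<close> makes the image over
  \<open>A\<close> unitary.\<close>

lemma obstruction_point:
  assumes t: "t \<in> square_roots G c" and w: "w \<in> carrier G"
    and ww: "w \<otimes> w \<in> {\<one>, c, t, t \<otimes> c}"
  shows "point (\<pi> t) (b\<^sup>2) + ((if w \<otimes> w = c then point (\<pi> w) b else 0) +
      (if (t \<otimes> w) \<otimes> (t \<otimes> w) = c then point (\<pi> (t \<otimes> w)) b else 0)) \<in> obstruction ` unitary A"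
proof -
  define v where "v = t \<otimes> w"
  have tG: "t \<in> carrier G" "t \<otimes> t = c" using square_rootsD[OF t] by auto
  have v: "v \<in> carrier G" using tG w by (simp add: v_def)
  define x where "x = point \<one> 1 + (point w b + point v b)"
  have x: "x \<in> galg G" using v w by (simp add: x_def galg_add galg_point)
  have wv: "w \<otimes> inv v = inv t" "v \<otimes> inv w = t"
    using tG w by (simp_all add: v_def inv_mult_group m_assoc[symmetric]) (simp add: m_assoc)
  have it: "inv t = t \<otimes> c"
  proof (rule inv_equality)
    show "t \<otimes> c \<otimes> t = \<one>" using tG c_closed c_comm by (metis m_assoc c_c)
  qed (use tG c_closed in auto)
  have nrm: "norm x = point \<one> 1 + ((point w b + point (inv w) b) + (point v b + point (inv v) b)
      + (point t (b\<^sup>2) + point (inv t) (b\<^sup>2)))"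
  proof -
    have sx: "star G x = point \<one> 1 + (point (inv w) b + point (inv v) b)"
      using w v by (simp add: x_def star_add star_point)
    have "norm x = point \<one> 1 + (point w b + point (inv w) b) + (point v b + point (inv v) b)
      + (point t (b\<^sup>2) + point (inv t) (b\<^sup>2)) + (point \<one> (b\<^sup>2) + point \<one> (b\<^sup>2))"
      using w v wv unfolding sx unfolding x_def
      by (simp add: conv_add_left conv_add_right conv_point power2_eq_square[symmetric] add_ac
          del: plus_fun_apply)
    then show ?thesis by (simp only: char2_fun_add_self[OF char] add_0_right add.assoc)
  qed
  have pu: "push x \<in> unitary A"
  proof -
    have tt: "point (\<pi> t) (b\<^sup>2) + point (\<pi> (inv t)) (b\<^sup>2) = 0"
    proof -
      have "\<pi> (inv t) = \<pi> t" using it tG c_closed hom_closed by (simp add: hom_mult hom_c)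
      then show ?thesis by (simp only: char2_fun_add_self[OF char])
    qed
    have inv_sq: "\<pi> (inv g) = inv\<^bsub>A\<^esub> \<pi> g" if "g \<in> carrier G" for g using that by (rule hom_inv)
    \<comment> \<open>In \<open>A\<close> inversion fixes both images if
      \<open>w \<otimes> w\<close> is 1 or \<open>c\<close>, and exchanges them if it is
      \<open>t\<close> or \<open>t \<otimes> c\<close>; in both cases the two images and their
      inverses cancel.\<close>
    have "(\<pi> (inv w) = \<pi> w \<and> \<pi> (inv v) = \<pi> v) \<or> (\<pi> (inv w) = \<pi> v \<and> \<pi> (inv v) = \<pi> w)"
    proof -
      have pt: "\<pi> t \<otimes>\<^bsub>A\<^esub> \<pi> t = \<one>\<^bsub>A\<^esub>" using tG hom_mult[of t t] hom_c by simp
      have pv: "\<pi> v = \<pi> t \<otimes>\<^bsub>A\<^esub> \<pi> w" using tG w by (simp add: v_def hom_mult)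
      have cl: "\<pi> t \<in> carrier A" "\<pi> w \<in> carrier A" using tG w hom_closed by auto
      have "\<pi> (w \<otimes> w) = \<one>\<^bsub>A\<^esub> \<or> \<pi> (w \<otimes> w) = \<pi> t"
      proof -
        have "\<pi> (t \<otimes> c) = \<pi> t" using tG(1) c_closed cl(1) by (simp add: hom_mult hom_c)
        moreover have "\<pi> (w \<otimes> w) \<in> \<pi> ` {\<one>, c, t, t \<otimes> c}" using ww by (rule imageI)
        ultimately show ?thesis by (simp add: hom_one hom_c)
      qed
      then consider "\<pi> w \<otimes>\<^bsub>A\<^esub> \<pi> w = \<one>\<^bsub>A\<^esub>" | "\<pi> w \<otimes>\<^bsub>A\<^esub> \<pi> w = \<pi> t"
        using w by (auto simp: hom_mult)
      then show ?thesis
      proof cases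
        case 1
        have "inv\<^bsub>A\<^esub> \<pi> w = \<pi> w" by (rule A.inv_equality) (use 1 cl in auto)
        moreover have "inv\<^bsub>A\<^esub> \<pi> t = \<pi> t" by (rule A.inv_equality) (use pt cl in auto)
        ultimately show ?thesis
          using cl w v by (simp add: inv_sq pv A.inv_mult A.m_comm)
      next
        case 2
        have "inv\<^bsub>A\<^esub> \<pi> w = \<pi> v"
          by (rule A.inv_equality) (use pt 2 cl in \<open>auto simp: pv A.m_assoc\<close>)
        then show ?thesis using cl w v by (metis A.inv_inv inv_sq)
      qed
    qed
    then have wv: "(point (\<pi> w) b + point (\<pi> (inv w)) b) + (point (\<pi> v) b + point (\<pi> (inv v)) b) = 0"
    proof (elim disjE conjE)
      assume *: "\<pi> (inv w) = \<pi> w" "\<pi> (inv v) = \<pi> v"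
      show ?thesis unfolding * char2_fun_add_self[OF char] by simp
    next
      assume *: "\<pi> (inv w) = \<pi> v" "\<pi> (inv v) = \<pi> w"
      show ?thesis unfolding * add.commute[of "point (\<pi> v) b"] char2_fun_add_self[OF char] ..
    qed
    have "push (norm x) = point \<one>\<^bsub>A\<^esub> 1 + ((point (\<pi> w) b + point (\<pi> (inv w)) b)
        + (point (\<pi> v) b + point (\<pi> (inv v)) b) + (point (\<pi> t) (b\<^sup>2) + point (\<pi> (inv t)) (b\<^sup>2)))"
      unfolding nrm using w v tG by (simp only: push_add push_point inv_closed one_closed hom_one)
    also have "\<dots> = point \<one>\<^bsub>A\<^esub> 1" unfolding wv tt by simp
    finally show ?thesis using push_norm[of x] by (simp add: unitary_def galg_push)
  qed
  have "obstruction (push x) = point (\<pi> t) (b\<^sup>2) + ((if w \<otimes> w = c then point (\<pi> w) b else 0) +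
      (if v \<otimes> v = c then point (\<pi> v) b else 0))"
  proof
    fix a
    \<comment> \<open>At a square root \<open>g\<close> of \<open>c\<close> only an element
      \<open>u\<close> with \<open>u \<otimes> u = c\<close> can matter, and then \<open>u\<close>
      and its inverse make up the whole fibre \<open>{u, u \<otimes> c}\<close>.\<close>
    have pair: "(point u d + point (inv u) d) g = (if u \<otimes> u = c then point (\<pi> u) d else 0) (\<pi> g)"
      if u: "u \<in> carrier G" and g: "g \<in> carrier G" "g \<otimes> g = c" for u g and d :: 'f
    proof (cases "u \<otimes> u = c")
      case True
      have iu: "inv u = u \<otimes> c"
      proof (rule inv_equality)
        show "u \<otimes> c \<otimes> u = \<one>" using True u c_closed c_comm by (metis m_assoc c_c)
      qed (use u c_closed in auto)
      have "u \<otimes> c \<noteq> u" using mult_c_neq[OF u] .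
      then show ?thesis using True hom_eq_iff[OF u g(1)] by (auto simp: iu point_def)
    next
      case False
      have "inv u \<otimes> inv u \<noteq> c"
      proof
        assume "inv u \<otimes> inv u = c"
        then have "inv (inv u \<otimes> inv u) = c" by (simp add: inv_c)
        then show False using False u by (simp add: inv_mult_group)
      qed
      then have "g \<noteq> u" "g \<noteq> inv u" using False g by auto
      then show ?thesis using False by (simp add: point_def)
    qed
    have ptc: "point (\<pi> u) d a' = 0" if "a' \<notin> ram" "u \<otimes> u = c" "u \<in> carrier G" for u a' and d :: 'f
      using that square_rootsI[of u c] by (auto simp: point_def ram_def)
    show "obstruction (push x) a = (point (\<pi> t) (b\<^sup>2) + ((if w \<otimes> w = c then point (\<pi> w) b else 0) +
      (if v \<otimes> v = c then point (\<pi> v) b else 0))) a"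
    proof (cases "a \<in> ram")
      case True
      then obtain g where g: "g \<in> carrier G" "g \<otimes> g = c" "a = \<pi> g" by (rule ramD)
      have "g \<noteq> \<one>" using g c_not_one by auto
      have "obstruction (push x) a = norm x g + point \<one> 1 g"
        using defect_eq_obstruction[OF x pu True] defect_apply[OF pu g(1)] g(3) by simp
      also have "\<dots> = (point w b + point (inv w) b) g + (point v b + point (inv v) b) g
          + (point t (b\<^sup>2) + point (inv t) (b\<^sup>2)) g"
        unfolding nrm using \<open>g \<noteq> \<one>\<close> by (simp add: point_def)
      also have "\<dots> = (if w \<otimes> w = c then point (\<pi> w) b else 0) a + (if v \<otimes> v = c then point (\<pi> v) b else 0) a
          + point (\<pi> t) (b\<^sup>2) a"
        using pair[OF w g(1,2)] pair[OF v g(1,2)] pair[OF tG(1) g(1,2)] tG(2) g(3) by simp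
      finally show ?thesis by (simp add: add_ac)
    next
      case False
      then show ?thesis using ptc[OF False] tG w v by (simp add: obstruction_def)
    qed
  qed
  then show ?thesis using pu unfolding v_def by (metis image_eqI)
qed

end

text \<open>\<open>W\<close> is closed under addition only, because the obstruction image is known
  only as an additive group and not as a subspace; hence every coefficient \<open>b\<close> has to
  be supplied.\<close>

lemma supported_subset_additive:
  fixes W :: "('a \<Rightarrow> 'f::field) set"
  assumes "finite T" "0 \<in> W" "\<And>x y. x \<in> W \<Longrightarrow> y \<in> W \<Longrightarrow> x + y \<in> W"
    and "\<And>a b. a \<in> T \<Longrightarrow> point a b \<in> W"
  shows "{v. \<forall>a. a \<notin> T \<longrightarrow> v a = 0} \<subseteq> W"
  using assms(1,4)
proof (induction T)
  case empty
  have "v = 0" if "\<forall>a. v a = 0" for v :: "'a \<Rightarrow> 'f" using that by (auto simp: fun_eq_iff)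
  then show ?case using assms(2) by auto
next
  case (insert t T)
  show ?case
  proof
    fix v :: "'a \<Rightarrow> 'f" assume v: "v \<in> {v. \<forall>a. a \<notin> insert t T \<longrightarrow> v a = 0}"
    have "v = point t (v t) + v(t := 0)" by (rule ext) (simp add: point_def)
    moreover have "v(t := 0) \<in> {v. \<forall>a. a \<notin> T \<longrightarrow> v a = 0}" using v by auto
    then have "v(t := 0) \<in> W" using insert by blast
    moreover have "point t (v t) \<in> W" using insert by blast
    ultimately show "v \<in> W" using assms(3) by metis
  qed
qed

lemma (in comm_group) subgroup_square_roots_one: "subgroup (square_roots G \<one>) G"
proof (rule subgroupI)
  show "square_roots G \<one> \<noteq> {}" by (auto simp: square_roots_def)
qed (auto simp: square_roots_def pow_mult_distrib m_comm nat_pow_inv)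

text \<open>\<open>K\<close> is a maximal subgroup containing \<open>H\<close> and avoiding
  \<open>g0\<close>. All squares lie in \<open>H\<close>, so adjoining any further element adds just
  one coset; by maximality it is the coset of \<open>g0\<close>.\<close>

lemma (in comm_group) exists_index_two_subgroup:
  assumes fin: "finite (carrier G)" and H: "subgroup H G" and sq: "\<And>g. g \<in> carrier G \<Longrightarrow> g \<otimes> g \<in> H"
    and g0: "g0 \<in> carrier G" "g0 \<notin> H"
  obtains K where "subgroup K G" "H \<subseteq> K" "g0 \<notin> K"
    "\<And>x y. x \<in> carrier G - K \<Longrightarrow> y \<in> carrier G - K \<Longrightarrow> x \<otimes> y \<in> K"
proof -
  define M where "M = {K. subgroup K G \<and> H \<subseteq> K \<and> g0 \<notin> K}"
  have "M \<subseteq> Pow (carrier G)" by (auto simp: M_def dest: subgroup.mem_carrier)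
  then have "finite M" using fin by (meson finite_Pow_iff finite_subset)
  moreover have "M \<noteq> {}" using H g0 by (auto simp: M_def)
  ultimately obtain K where K: "K \<in> M" and max: "\<And>L. L \<in> M \<Longrightarrow> K \<subseteq> L \<Longrightarrow> K = L"
    using finite_has_maximal[of M] by blast
  have sK: "subgroup K G" "H \<subseteq> K" "g0 \<notin> K" using K by (auto simp: M_def)
  interpret K: subgroup K G by (rule sK(1))
  have coset: "\<exists>k\<in>K. w = g0 \<otimes> k" if w: "w \<in> carrier G" "w \<notin> K" for w
  proof -
    let ?L = "K \<union> (\<lambda>k. w \<otimes> k) ` K"
    have ww: "w \<otimes> w \<in> K" using sq[OF w(1)] sK(2) by blast
    have iw: "w \<otimes> inv (w \<otimes> w) = inv w"
      using w(1) by (simp add: inv_mult_group m_assoc[symmetric])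
    have "subgroup ?L G"
    proof (rule subgroupI)
      show "?L \<subseteq> carrier G" using w K.mem_carrier by auto
      show "?L \<noteq> {}" using K.one_closed by blast
      show "inv a \<in> ?L" if a: "a \<in> ?L" for a
      proof (cases "a \<in> K")
        case False
        then obtain k where k: "k \<in> K" "a = w \<otimes> k" using a by blast
        have kc: "k \<in> carrier G" using k K.mem_carrier by blast
        have "inv a = inv w \<otimes> inv k" unfolding k(2) using w(1) kc by (rule inv_mult)
        also have "\<dots> = w \<otimes> inv (w \<otimes> w) \<otimes> inv k" by (simp only: iw)
        also have "\<dots> = w \<otimes> (inv (w \<otimes> w) \<otimes> inv k)" using w kc by (simp add: m_assoc)
        finally have "inv a = w \<otimes> (inv (w \<otimes> w) \<otimes> inv k)" .
        then show ?thesis using k ww by blast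
      qed blast
      show "a \<otimes> b \<in> ?L" if a: "a \<in> ?L" and b: "b \<in> ?L" for a b
      proof -
        consider "a \<in> K" "b \<in> K" | k where "a \<in> K" "k \<in> K" "b = w \<otimes> k"
          | k where "b \<in> K" "k \<in> K" "a = w \<otimes> k"
          | k l where "k \<in> K" "l \<in> K" "a = w \<otimes> k" "b = w \<otimes> l"
        proof -
          have "a \<in> K \<or> (\<exists>k\<in>K. a = w \<otimes> k)" "b \<in> K \<or> (\<exists>k\<in>K. b = w \<otimes> k)"
            using a b by auto
          then show thesis using that by metis
        qed
        then show ?thesis
        proof cases
          case 1
          then show ?thesis by blast
        next
          case 2
          then have "a \<otimes> b = w \<otimes> (a \<otimes> k)" using w K.mem_carrier by (simp add: m_ac)
          then show ?thesis using 2 by blast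
        next
          case 3
          then have "a \<otimes> b = w \<otimes> (k \<otimes> b)" using w K.mem_carrier by (simp add: m_ac)
          then show ?thesis using 3 by blast
        next
          case 4
          then have "a \<otimes> b = (w \<otimes> w) \<otimes> (k \<otimes> l)" using w K.mem_carrier by (simp add: m_ac)
          then have "a \<otimes> b \<in> K" using 4 ww by (simp only: K.m_closed)
          then show ?thesis by blast
        qed
      qed
    qed
    moreover have "w \<in> ?L" using imageI[OF K.one_closed, of "\<lambda>k. w \<otimes> k"] w(1) by simp
    ultimately have "g0 \<in> ?L" using max[of ?L] w(2) sK(2) by (auto simp: M_def)
    then obtain k where k: "k \<in> K" "g0 = w \<otimes> k" using sK(3) by blast
    then have "w = g0 \<otimes> inv k" using w K.mem_carrier by (simp add: m_assoc)
    then show ?thesis using k by blast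
  qed
  have "x \<otimes> y \<in> K" if xy: "x \<in> carrier G - K" "y \<in> carrier G - K" for x y
  proof -
    obtain k where "k \<in> K" "x = g0 \<otimes> k" using coset[of x] xy(1) by blast
    moreover obtain l where "l \<in> K" "y = g0 \<otimes> l" using coset[of y] xy(2) by blast
    ultimately have kl: "k \<in> K" "l \<in> K" "x = g0 \<otimes> k" "y = g0 \<otimes> l" by simp_all
    have "x \<otimes> y = (g0 \<otimes> g0) \<otimes> (k \<otimes> l)" using kl g0 K.mem_carrier by (simp add: m_ac)
    moreover have "g0 \<otimes> g0 \<in> K" using sq[OF g0(1)] sK(2) by blast
    ultimately show ?thesis using kl by (simp only: K.m_closed)
  qed
  then show thesis using that sK by blast
qed

section \<open>Counting in the extension, and conditions for a full image\<close>

context central_extension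
begin

lemma mult_square:
  assumes "x \<in> carrier G" "y \<in> carrier G" "x \<otimes> y = y \<otimes> x"
  shows "(x \<otimes> y) \<otimes> (x \<otimes> y) = (x \<otimes> x) \<otimes> (y \<otimes> y)"
proof -
  have "(x \<otimes> y) \<otimes> (x \<otimes> y) = x \<otimes> (y \<otimes> x) \<otimes> y" using assms(1,2) by (simp add: m_assoc)
  also have "\<dots> = (x \<otimes> x) \<otimes> (y \<otimes> y)" unfolding assms(3)[symmetric] using assms(1,2) by (simp add: m_assoc)
  finally show ?thesis .
qed

lemma card_preimage:
  assumes "S \<subseteq> carrier A"
  shows "card {g \<in> carrier G. \<pi> g \<in> S} = 2 * card S"
proof -
  have fS: "finite S" using assms A.finite_carrier finite_subset by blast
  have "card {g \<in> carrier G. \<pi> g \<in> S} = (\<Sum>a\<in>S. card {g \<in> {g \<in> carrier G. \<pi> g \<in> S}. \<pi> g = a})"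
    using sum.group[of "{g \<in> carrier G. \<pi> g \<in> S}" S \<pi> "\<lambda>_. 1::nat"] finite_carrier fS
    by (simp add: image_subset_iff)
  also have "\<dots> = (\<Sum>a\<in>S. 2)"
  proof (rule sum.cong[OF HOL.refl])
    fix a assume a: "a \<in> S"
    define g where "g = sec a"
    have g: "g \<in> carrier G" "\<pi> g = a" using sec a assms by (auto simp: g_def)
    have "{g \<in> {g \<in> carrier G. \<pi> g \<in> S}. \<pi> g = a} = {h \<in> carrier G. \<pi> h = \<pi> g}"
      using g a by auto
    then show "card {g \<in> {g \<in> carrier G. \<pi> g \<in> S}. \<pi> g = a} = 2"
      using fiber[OF g(1)] mult_c_neq[OF g(1)] by simp
  qed
  finally show ?thesis by simp
qed

lemma card_carrier: "card (carrier G) = 2 * card (carrier A)"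
proof -
  have "{g \<in> carrier G. \<pi> g \<in> carrier A} = carrier G" using hom_closed by blast
  then show ?thesis using card_preimage[of "carrier A"] by simp
qed

lemma ram_subset: "ram \<subseteq> {a \<in> carrier A. inv\<^bsub>A\<^esub> a = a}"
  using ram_inv by blast

lemma inv_self_iff: "a \<in> carrier A \<Longrightarrow> inv\<^bsub>A\<^esub> a = a \<longleftrightarrow> a \<otimes>\<^bsub>A\<^esub> a = \<one>\<^bsub>A\<^esub>"
  by (metis A.inv_equality A.r_inv)

lemma Omega1_quotient: "Omega1 A = {a \<in> carrier A. inv\<^bsub>A\<^esub> a = a}"
  using inv_self_iff by (auto simp: square_roots_def numeral_2_eq_2)

text \<open>The two lifts of an element have the same square, since \<open>c\<close> is central of
  order two.\<close>

lemma hom_in_ram_iff: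
  assumes g: "g \<in> carrier G"
  shows "\<pi> g \<in> ram \<longleftrightarrow> g \<otimes> g = c"
proof
  assume "\<pi> g \<in> ram"
  then obtain h where h: "h \<in> carrier G" "h \<otimes> h = c" "\<pi> g = \<pi> h" by (rule ramD)
  have "(h \<otimes> c) \<otimes> (h \<otimes> c) = (h \<otimes> h) \<otimes> (c \<otimes> c)"
    using mult_square[OF h(1) c_closed] c_comm[OF h(1)] by simp
  then show "g \<otimes> g = c" using h hom_eq_iff[OF h(1) g] c_closed by (auto simp: c_c)
next
  assume "g \<otimes> g = c"
  then show "\<pi> g \<in> ram" using g square_rootsI unfolding ram_def by blast
qed

lemma card_ram: "card (square_roots G c) = 2 * card ram"
proof -
  have "{g \<in> carrier G. \<pi> g \<in> ram} = square_roots G c"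
    using hom_in_ram_iff square_rootsD square_rootsI by blast
  then show ?thesis using card_preimage[of ram] ram_subset by auto
qed

text \<open>A lift of an element of \<open>Omega1 A\<close> squares into the kernel, hence to 1 or
  to \<open>c\<close>, and each element has two lifts.\<close>

lemma card_Omega1: "card (Omega1 G) + card (square_roots G c) = 2 * card (Omega1 A)"
proof -
  have "{g \<in> carrier G. \<pi> g \<in> Omega1 A} = Omega1 G \<union> square_roots G c"
  proof -
    have "\<pi> g \<in> Omega1 A \<longleftrightarrow> g \<otimes> g = \<one> \<or> g \<otimes> g = c" if g: "g \<in> carrier G" for g
    proof -
      have "\<pi> g \<in> Omega1 A \<longleftrightarrow> \<pi> (g \<otimes> g) = \<one>\<^bsub>A\<^esub>"
        using g hom_closed[OF g] by (simp add: square_roots_def numeral_2_eq_2 hom_mult)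
      then show ?thesis using kernelD[of "g \<otimes> g"] g hom_one hom_c by (metis m_closed)
    qed
    then show ?thesis using square_rootsD square_rootsI by blast
  qed
  moreover have "Omega1 G \<inter> square_roots G c = {}" using c_not_one by (auto simp: square_roots_def)
  moreover have "finite (Omega1 G)" "finite (square_roots G c)"
    using finite_carrier by (auto simp: square_roots_def)
  ultimately show ?thesis
    using card_preimage[of "Omega1 A"] card_Un_disjoint[of "Omega1 G" "square_roots G c"]
    by (auto simp: square_roots_def)
qed

lemma one_notin_ram: "\<one>\<^bsub>A\<^esub> \<notin> ram"
  using hom_in_ram_iff[OF one_closed] c_not_one by (auto simp: hom_one)

lemma finite_ram: "finite ram"
  using ram_subset A.finite_carrier by (auto intro: finite_subset)

abbreviation image :: "('c \<Rightarrow> 'f) set" where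
  "image \<equiv> obstruction ` unitary A"

text \<open>\<open>\<kappa>\<close> is the index of the image in the group of all functions on
  \<open>ram\<close>; one extension multiplies the leading constant \<open>\<theta>\<close> by it,
  and the exponent keeps its shape, including the final \<open>- 1\<close>.\<close>

lemma card_unitary_extension:
  assumes A: "card (unitary A :: ('c \<Rightarrow> 'f) set) =
      \<theta> * CARD('f) ^ ((card (carrier A) + card (Omega1 A)) div 2 - 1)"
    and W: "\<kappa> * card image = CARD('f) ^ card ram"
  shows "card (unitary G :: ('a \<Rightarrow> 'f) set) =
      \<kappa> * \<theta> * CARD('f) ^ ((card (carrier G) + card (Omega1 G)) div 2 - 1)"
proof -
  define q where "q = CARD('f)"
  define K where "K = card {y \<in> unitary A. obstruction y = (0 :: 'c \<Rightarrow> 'f)}"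
  define e where "e = (card (carrier A) + card (Omega1 A)) div 2"
  have ev: "even (card (carrier A) + card (Omega1 A))"
    unfolding Omega1_quotient
    by (rule card_symmetrization_fiber(2)[OF char A.finite_carrier, where s = "\<lambda>_. 0"]) auto
  \<comment> \<open>The identity lies outside \<open>ram\<close>; the strict inequality obtained
    from this keeps the truncated subtractions below exact.\<close>
  have 1: "ram \<subset> Omega1 A"
    using ram_subset one_notin_ram A.one_closed unfolding Omega1_quotient by auto
  have f: "finite (Omega1 A)" using A.finite_carrier by (auto simp: square_roots_def)
  have 2: "card ram < card (Omega1 A)" by (rule psubset_card_mono[OF f 1])
  have 3: "card (Omega1 A) \<le> card (carrier A)"
    by (rule card_mono[OF A.finite_carrier]) (auto simp: square_roots_def)
  have e2: "2 * e = card (carrier A) + card (Omega1 A)" using ev by (simp add: e_def)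
  \<comment> \<open>Rests on \<open>card (carrier G) = 2 * card (carrier A)\<close> and on
    \<open>Omega1 G\<close> being twice the complement of \<open>ram\<close> in
    \<open>Omega1 A\<close>.\<close>
  have ex: "(card (carrier G) + card (Omega1 G)) div 2 - 1 + card ram = (e - 1) + e"
  proof -
    have "card (Omega1 G) = 2 * card (Omega1 A) - 2 * card ram"
      using card_Omega1 card_ram by simp
    then have "card (carrier G) + card (Omega1 G) = 2 * (card (carrier A) + card (Omega1 A) - card ram)"
      using 2 card_carrier by simp
    then show ?thesis using e2 2 3 by simp
  qed
  have q0: "q > 0" by (simp add: q_def)
  have KW: "\<theta> * q ^ (e - 1) = K * card image"
    using card_unitary_quotient A by (simp add: K_def q_def e_def)
  have "card (unitary G :: ('a \<Rightarrow> 'f) set) * q ^ card ram = K * q ^ e * q ^ card ram"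
    using card_unitary_eq_kernel by (simp add: K_def q_def e_def Omega1_quotient)
  also have "\<dots> = \<kappa> * (K * card image) * q ^ e" using W by (simp add: q_def algebra_simps)
  also have "\<dots> = \<kappa> * \<theta> * q ^ ((e - 1) + e)" by (simp add: KW[symmetric] power_add algebra_simps)
  also have "\<dots> = \<kappa> * \<theta> * q ^ ((card (carrier G) + card (Omega1 G)) div 2 - 1) * q ^ card ram"
    by (simp only: ex[symmetric] power_add mult.assoc)
  finally show ?thesis using q0 by (simp add: q_def)
qed

lemma image_add:
  assumes "u \<in> image" "v \<in> image"
  shows "u + v \<in> image"
proof -
  obtain x y where "x \<in> unitary A" "y \<in> unitary A" "u = obstruction x" "v = obstruction y"
    using assms by blast
  then show ?thesis using obstruction_conv[of x y] A.conv_unitary[of x y] by (metis image_eqI)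
qed

lemma image_zero: "0 \<in> image"
proof -
  have "obstruction (point \<one>\<^bsub>A\<^esub> 1) + obstruction (point \<one>\<^bsub>A\<^esub> 1) \<in> image"
    using image_add A.one_unitary by blast
  then show ?thesis unfolding char2_fun_add_self[OF char] .
qed

lemma image_supported: "image \<subseteq> {v. \<forall>a. a \<notin> ram \<longrightarrow> v a = 0}"
  by (auto simp: obstruction_def)

text \<open>Coefficients that are squares suffice, every field element being a square; additivity
  then gives all functions on \<open>ram\<close>.\<close>

lemma card_image_full:
  assumes "\<And>t b. t \<in> square_roots G c \<Longrightarrow> point (\<pi> t) (b\<^sup>2) \<in> image"
  shows "card image = CARD('f) ^ card ram"
proof -
  have "point a b \<in> image" if "a \<in> ram" for a and b :: 'f
    using assms that char2_square_surj[OF char, of b] unfolding ram_def by blast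
  then have "{v. \<forall>a. a \<notin> ram \<longrightarrow> v a = 0} \<subseteq> image"
    by (intro supported_subset_additive finite_ram image_zero image_add)
  then have "image = {v. \<forall>a. a \<notin> ram \<longrightarrow> v a = 0}" using image_supported by blast
  then show ?thesis using card_supported_functions[OF finite_ram] by simp
qed

text \<open>Take the involution \<open>h\<close> as \<open>w\<close> in
  \<open>obstruction_point\<close>. Since \<open>t \<otimes> h = h \<otimes> t \<otimes> c\<close>,
  also \<open>t \<otimes> h\<close> has square 1, so both extra terms disappear.\<close>

lemma card_image_noncommuting:
  assumes "\<And>t. t \<in> square_roots G c \<Longrightarrow> \<exists>h\<in>Omega1 G. t \<otimes> h \<noteq> h \<otimes> t"
  shows "card image = CARD('f) ^ card ram"
proof (rule card_image_full)
  fix t and b :: 'f assume t: "t \<in> square_roots G c"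
  then obtain h where h: "h \<in> Omega1 G" "t \<otimes> h \<noteq> h \<otimes> t" using assms by blast
  have tG: "t \<in> carrier G" "t \<otimes> t = c" and hG: "h \<in> carrier G" "h \<otimes> h = \<one>"
    using square_rootsD t h by blast+
  have "\<pi> (t \<otimes> h) = \<pi> (h \<otimes> t)" using tG hG hom_closed by (simp add: hom_mult A.m_comm)
  then have th: "t \<otimes> h = h \<otimes> t \<otimes> c" using hom_eq_iff[of "h \<otimes> t" "t \<otimes> h"] tG hG h(2) by auto
  have "(t \<otimes> h) \<otimes> (t \<otimes> h) = t \<otimes> h \<otimes> (h \<otimes> t \<otimes> c)" using th by simp
  also have "\<dots> = t \<otimes> (h \<otimes> h) \<otimes> t \<otimes> c" using tG(1) hG(1) c_closed by (simp add: m_assoc)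
  also have "\<dots> = \<one>" using tG hG by (simp add: c_c)
  finally have "(t \<otimes> h) \<otimes> (t \<otimes> h) = \<one>" .
  then show "point (\<pi> t) (b\<^sup>2) \<in> image"
    using obstruction_point[OF t hG(1), of b] hG(2) c_not_one by simp
qed

text \<open>Here \<open>w = t \<otimes> t0\<close>, which has square 1, while
  \<open>t \<otimes> w = t0 \<otimes> c\<close> is again a square root of \<open>c\<close> over the
  same point as \<open>t0\<close> and contributes the linear term.\<close>

lemma image_pair:
  assumes t: "t \<in> square_roots G c" and t0: "t0 \<in> square_roots G c" and comm: "t \<otimes> t0 = t0 \<otimes> t"
  shows "point (\<pi> t) (b\<^sup>2) + point (\<pi> t0) b \<in> image"
proof -
  have tG: "t \<in> carrier G" "t \<otimes> t = c" and t0G: "t0 \<in> carrier G" "t0 \<otimes> t0 = c"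
    using square_rootsD t t0 by blast+
  have uG: "t \<otimes> t0 \<in> carrier G" using tG t0G by simp
  have uu: "(t \<otimes> t0) \<otimes> (t \<otimes> t0) = \<one>" using mult_square[OF tG(1) t0G(1) comm] tG t0G by (simp add: c_c)
  have tu: "t \<otimes> (t \<otimes> t0) = t0 \<otimes> c"
    using tG t0G c_comm by (simp add: m_assoc[symmetric])
  have "(t0 \<otimes> c) \<otimes> (t0 \<otimes> c) = c"
    using mult_square[OF t0G(1) c_closed] c_comm[OF t0G(1)] t0G c_closed by (simp add: c_c)
  moreover have "\<pi> (t0 \<otimes> c) = \<pi> t0" using t0G c_closed hom_closed by (simp add: hom_mult hom_c)
  ultimately show ?thesis
    using obstruction_point[OF t uG, of b] uu c_not_one tu by simp
qed

text \<open>The element \<open>w\<close> isolates the point under \<open>t0\<close>, and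
  \<open>image_pair\<close> then transfers this to every other point of \<open>ram\<close>.\<close>

lemma card_image_square:
  assumes t0: "t0 \<in> square_roots G c" and comm: "\<And>t. t \<in> square_roots G c \<Longrightarrow> t \<otimes> t0 = t0 \<otimes> t"
    and w: "w \<in> carrier G" "w \<otimes> w \<in> {t0, t0 \<otimes> c}"
  shows "card image = CARD('f) ^ card ram"
proof (rule card_image_full)
  have t0G: "t0 \<in> carrier G" "t0 \<otimes> t0 = c" using square_rootsD[OF t0] by auto
  have w_eq: "t0 = w \<otimes> w \<or> t0 = w \<otimes> w \<otimes> c"
  proof -
    have "t0 \<otimes> c \<otimes> c = t0" using t0G(1) c_closed by (simp add: m_assoc c_c)
    then show ?thesis using w(2) by auto
  qed
  then have cw: "t0 \<otimes> w = w \<otimes> t0"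
    using w(1) c_closed c_comm[OF w(1)] by (auto simp: m_assoc)
  have "t0 \<noteq> \<one>" "t0 \<noteq> c" using t0G c_not_one c_c by auto
  then have n1: "w \<otimes> w \<noteq> \<one>" "w \<otimes> w \<noteq> c"
    using w_eq t0G c_closed c_c by auto
  have "(t0 \<otimes> w) \<otimes> (t0 \<otimes> w) = c \<otimes> (w \<otimes> w)"
    using mult_square[OF t0G(1) w(1) cw] t0G by simp
  then have n2: "(t0 \<otimes> w) \<otimes> (t0 \<otimes> w) \<noteq> c" using n1 w c_closed by simp
  \<comment> \<open>As \<open>w \<otimes> w\<close> is \<open>t0\<close> up to \<open>c\<close>,
    neither \<open>w\<close> nor \<open>t0 \<otimes> w\<close> squares to \<open>c\<close>, so no
    extra term is left.\<close>
  have p0: "point (\<pi> t0) (b\<^sup>2) \<in> image" for b :: 'f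
    using obstruction_point[OF t0 w(1), of b] n1 n2 w(2) by auto
  fix t and b :: 'f assume t: "t \<in> square_roots G c"
  obtain d where "d\<^sup>2 = b" using char2_square_surj[OF char] by blast
  then have "point (\<pi> t0) b \<in> image" using p0 by blast
  then have "point (\<pi> t) (b\<^sup>2) + point (\<pi> t0) b + point (\<pi> t0) b \<in> image"
    using image_add image_pair[OF t t0 comm[OF t]] by blast
  then show "point (\<pi> t) (b\<^sup>2) \<in> image" unfolding add.assoc char2_fun_add_self[OF char] by simp
qed

end

section \<open>Abelian groups of exponent four: an image of index two\<close>

context central_extension
begin

text \<open>
  Adding up \<open>x x\<^sup>*\<close> over one element of each pair \<open>{g, g\<^sup>-\<^sup>1}\<close> outside \<open>K\<close> gives the product of the sums
  of \<open>x\<close> over \<open>K\<close> and over its complement; these add up to 1, and only the terms over \<open>ram\<close> survive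
  modulo \<open>c\<close>.
\<close>

lemma sum_obstruction:
  assumes K: "subgroup K G" "Omega1 G \<subseteq> K" "square_roots G c \<inter> K = {}"
    and index: "\<And>x y. x \<in> carrier G - K \<Longrightarrow> y \<in> carrier G - K \<Longrightarrow> x \<otimes> y \<in> K"
    and y: "y \<in> unitary A"
  shows "\<exists>v. (\<Sum>a\<in>ram. obstruction y a) = v + v\<^sup>2"
proof -
  interpret K: subgroup K G by (rule K(1))
  have yg: "y \<in> galg A" using y by (simp add: unitary_def)
  define x where "x = lift y"
  have x: "x \<in> galg G" "push x = y" by (simp_all add: x_def galg_lift push_lift yg)
  define S where "S = carrier G - K"
  \<comment> \<open>The half of the coefficient of \<open>norm x\<close> at \<open>g\<close> that
    comes from \<open>h\<close> in \<open>K\<close>.\<close>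
  define M where "M = (\<lambda>g. if g \<in> S then \<Sum>h\<in>K. x h * x (inv g \<otimes> h) else 0)"
  have Kc: "h \<in> carrier G" if "h \<in> K" for h using that by (rule K.mem_carrier)
  have SG: "g \<in> carrier G" "g \<notin> K" if "g \<in> S" for g using that by (simp_all add: S_def)
  have Sinv: "inv g \<in> S" if g: "g \<in> S" for g
    using SG[OF g] K.m_inv_closed[of "inv g"] by (auto simp: S_def)
  have SK: "g \<otimes> h \<in> S" if g: "g \<in> S" and h: "h \<in> K" for g h
  proof -
    have "g = (g \<otimes> h) \<otimes> inv h" using SG[OF g] Kc[OF h] by (simp add: m_assoc)
    then have "g \<otimes> h \<notin> K" using K.m_closed[of "g \<otimes> h" "inv h"] SG(2)[OF g] h by auto
    then show ?thesis using SG[OF g] Kc[OF h] by (simp add: S_def)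
  qed
  have SS: "g \<otimes> h \<in> K" if "g \<in> S" "h \<in> S" for g h using index that by (simp add: S_def)
  have finK: "finite K" and finS: "finite S"
    using finite_carrier K.subset by (auto simp: S_def intro: finite_subset)
  have cK: "c \<in> K" using K(2) c_closed c_c square_rootsI by blast
  have split: "(\<Sum>g\<in>carrier G. f g) = (\<Sum>g\<in>K. f g) + (\<Sum>g\<in>S. f g)" for f :: "'a \<Rightarrow> 'f"
    unfolding S_def using sum.subset_diff[OF K.subset finite_carrier, of f] by (simp add: add.commute)

  have norm_M: "norm x g = M g + M (inv g)" if g: "g \<in> S" for g
  proof -
    have gG: "g \<in> carrier G" using SG g by simp
    have "norm x g = (\<Sum>h\<in>carrier G. x h * x (inv g \<otimes> h))"
      using gG unfolding conv_def by (auto simp: star_def inv_mult_group intro!: sum.cong)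
    also have "\<dots> = (\<Sum>h\<in>K. x h * x (inv g \<otimes> h)) + (\<Sum>h\<in>S. x h * x (inv g \<otimes> h))"
      by (rule split)
    also have "(\<Sum>h\<in>K. x h * x (inv g \<otimes> h)) = M g" using g by (simp add: M_def)
    \<comment> \<open>Translation by \<open>g\<close> carries \<open>K\<close> onto its complement
      and turns the other half into the value of \<open>M\<close> at \<open>inv g\<close>.\<close>
    also have "(\<Sum>h\<in>S. x h * x (inv g \<otimes> h)) = (\<Sum>h\<in>K. x (g \<otimes> h) * x (inv g \<otimes> (g \<otimes> h)))"
    proof (rule sum.reindex_bij_betw[symmetric], rule bij_betw_byWitness[where f' = "\<lambda>h. inv g \<otimes> h"])
      show "(\<lambda>h. g \<otimes> h) ` K \<subseteq> S" using SK g by blast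
      show "(\<lambda>h. inv g \<otimes> h) ` S \<subseteq> K" using SS Sinv g by blast
    qed (use gG Kc SG in \<open>simp_all add: m_assoc[symmetric]\<close>)
    also have "\<dots> = M (inv g)"
      using gG Sinv[OF g] Kc unfolding M_def
      by (auto simp: m_assoc[symmetric] mult.commute intro!: sum.cong)
    finally show ?thesis .
  qed

  have sum_M: "(\<Sum>g\<in>carrier G. M g) = (\<Sum>h\<in>K. x h) * (\<Sum>h\<in>S. x h)"
  proof -
    have "(\<Sum>g\<in>carrier G. M g) = (\<Sum>g\<in>S. M g)"
      by (rule sum.mono_neutral_right[OF finite_carrier]) (auto simp: S_def M_def)
    also have "\<dots> = (\<Sum>g\<in>S. \<Sum>h\<in>K. x h * x (inv g \<otimes> h))"
      by (rule sum.cong) (simp_all add: M_def)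
    also have "\<dots> = (\<Sum>h\<in>K. \<Sum>g\<in>S. x h * x (inv g \<otimes> h))"
      by (rule sum.swap)
    also have "\<dots> = (\<Sum>h\<in>K. x h * (\<Sum>g\<in>S. x g))"
    proof (rule sum.cong[OF HOL.refl])
      fix h assume h: "h \<in> K"
      have "(\<Sum>g\<in>S. x (inv g \<otimes> h)) = (\<Sum>g\<in>S. x g)"
      proof (rule sum.reindex_bij_betw, rule bij_betw_byWitness[where f' = "\<lambda>k. h \<otimes> inv k"])
        show "(\<lambda>g. inv g \<otimes> h) ` S \<subseteq> S" using SK Sinv h by blast
        show "(\<lambda>k. h \<otimes> inv k) ` S \<subseteq> S"
        proof
          fix k' assume "k' \<in> (\<lambda>k. h \<otimes> inv k) ` S"
          then obtain k where k: "k \<in> S" "k' = h \<otimes> inv k" by blast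
          have "inv (k \<otimes> inv h) \<in> S" using k h by (intro Sinv SK) auto
          then show "k' \<in> S" using k h SG Kc by (simp add: inv_mult_group)
        qed
      qed (use h Kc SG in \<open>simp_all add: inv_mult_group m_assoc, simp_all add: m_assoc[symmetric]\<close>)
      then show "(\<Sum>g\<in>S. x h * x (inv g \<otimes> h)) = x h * (\<Sum>g\<in>S. x g)"
        by (simp add: sum_distrib_left[symmetric])
    qed
    finally show ?thesis by (simp add: sum_distrib_right)
  qed

  have inv_gc: "inv (g \<otimes> c) = inv g \<otimes> c" if "g \<in> carrier G" for g
    using that c_closed c_comm[of "inv g"] by (simp add: inv_mult_group inv_c)
  have gcS: "g \<otimes> c \<in> S \<longleftrightarrow> g \<in> S" if g: "g \<in> carrier G" for g
  proof
    assume "g \<otimes> c \<in> S"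
    then have "g \<otimes> c \<otimes> c \<in> S" using SK cK by blast
    then show "g \<in> S" using g c_closed by (simp add: m_assoc c_c)
  qed (use SK cK in blast)
  \<comment> \<open>On \<open>S\<close> the norm is constant along fibres, so its fibre sum
    vanishes; this sum is that of \<open>M\<close> at \<open>a\<close> plus that at the inverse of
    \<open>a\<close>. Symmetry then reduces the total to self-inverse elements.\<close>
  have M_sym: "push M (inv\<^bsub>A\<^esub> a) = push M a" if a: "a \<in> carrier A" for a
  proof -
    define g where "g = sec a"
    have g: "g \<in> carrier G" "\<pi> g = a" using sec[OF a] by (auto simp: g_def)
    have p: "push M a = M g + M (g \<otimes> c)" "push M (inv\<^bsub>A\<^esub> a) = M (inv g) + M (inv g \<otimes> c)"
      using push_apply[OF g(1), of M] push_apply[of "inv g" M] g by (simp_all add: hom_inv)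
    show ?thesis
    proof (cases "g \<in> S")
      case True
      have n1: "g \<noteq> \<one>" "g \<otimes> c \<noteq> \<one>" using True gcS[OF g(1)] SG(2) K.one_closed by metis+
      have "norm x g + norm x (g \<otimes> c) = defect x (\<pi> g) + defect x (\<pi> (g \<otimes> c))"
        using defect_apply[of x g] defect_apply[of x "g \<otimes> c"] x y g c_closed n1 by (simp add: point_def)
      moreover have "\<pi> (g \<otimes> c) = \<pi> g" using hom_eq_iff[OF g(1)] g c_closed by blast
      ultimately have "norm x g + norm x (g \<otimes> c) = 0" by (simp add: char2_two[OF char])
      moreover have "norm x g + norm x (g \<otimes> c) = push M a + push M (inv\<^bsub>A\<^esub> a)"
        unfolding p using norm_M[OF True] norm_M[of "g \<otimes> c"] gcS[OF g(1)] True inv_gc[OF g(1)]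
        by (simp add: add_ac)
      ultimately show ?thesis
        using char2_add_eq_iff[OF char, of "push M a" "push M (inv\<^bsub>A\<^esub> a)" 0] by simp
    next
      case False
      have "inv g \<notin> S" using False Sinv[of "inv g"] g by auto
      then show ?thesis unfolding p using False gcS[of g] gcS[of "inv g"] g by (simp add: M_def)
    qed
  qed
  have "(\<Sum>g\<in>carrier G. M g) = (\<Sum>a\<in>carrier A. push M a)" by (rule sum_push[symmetric])
  also have "\<dots> = (\<Sum>a\<in>{a \<in> carrier A. inv\<^bsub>A\<^esub> a = a}. push M a)"
    by (rule char2_sum_involution[OF char A.finite_carrier]) (auto simp: M_sym)
  also have "\<dots> = (\<Sum>a\<in>ram. push M a)"
  proof (rule sum.mono_neutral_right[OF _ ram_subset])
    show "\<forall>a\<in>{a \<in> carrier A. inv\<^bsub>A\<^esub> a = a} - ram. push M a = 0"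
    proof
      fix a assume a: "a \<in> {a \<in> carrier A. inv\<^bsub>A\<^esub> a = a} - ram"
      define g where "g = sec a"
      have g: "g \<in> carrier G" "\<pi> g = a" using sec[of a] a by (auto simp: g_def)
      have "\<pi> (g \<otimes> g) = \<one>\<^bsub>A\<^esub>" using g a inv_self_iff[of a] by (simp add: hom_mult)
      then have "g \<otimes> g = \<one>" using kernelD[of "g \<otimes> g"] hom_in_ram_iff[OF g(1)] a g by auto
      then have "g \<notin> S" using g K(2) square_rootsI by (auto simp: S_def)
      then show "push M a = 0" using push_apply[OF g(1), of M] gcS[OF g(1)] g(2) by (simp add: M_def)
    qed
  qed (use A.finite_carrier in simp)
  also have "\<dots> = (\<Sum>a\<in>ram. obstruction y a)"
  proof (rule sum.cong[OF HOL.refl])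
    fix a assume a: "a \<in> ram"
    then obtain g where g: "g \<in> carrier G" "g \<otimes> g = c" "a = \<pi> g" by (rule ramD)
    have gS: "g \<in> S" using g K(3) square_rootsI by (auto simp: S_def)
    have "inv g = g \<otimes> c"
      using g(1) by (intro inv_equality) (auto simp: c_comm[symmetric] c_closed m_assoc g(2) c_c)
    then have "push M a = norm x g" using norm_M[OF gS] push_apply[OF g(1), of M] g(3) by simp
    moreover have "g \<noteq> \<one>" using gS SG(2) K.one_closed by metis
    ultimately show "push M a = obstruction y a"
      using defect_apply[of x g] x y g defect_eq_obstruction[of x a] a by (simp add: point_def)
  qed
  finally have "(\<Sum>a\<in>ram. obstruction y a) = (\<Sum>h\<in>K. x h) * (\<Sum>h\<in>S. x h)" using sum_M by simp
  \<comment> \<open>The two partial augmentations are some \<open>u\<close> and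
    \<open>u + 1\<close>, and their product is \<open>u + u\<^sup>2\<close>.\<close>
  moreover have "(\<Sum>h\<in>K. x h) + (\<Sum>h\<in>S. x h) = 1"
    using A.sum_unitary[OF char y] sum_push[of x] x(2) split[of x] by simp
  then have "(\<Sum>h\<in>S. x h) = (\<Sum>h\<in>K. x h) + 1"
    using char2_add_eq_iff[OF char] by blast
  ultimately show ?thesis by (auto simp: power2_eq_square algebra_simps)
qed

text \<open>The image consists exactly of the functions on \<open>ram\<close> whose values add up to
  an element \<open>b + b\<^sup>2\<close>: \<open>sum_obstruction\<close> gives one inclusion, the
  values from \<open>image_pair\<close> the other.\<close>

lemma card_image_half:
  assumes comm: "\<And>x y. x \<in> carrier G \<Longrightarrow> y \<in> carrier G \<Longrightarrow> x \<otimes> y = y \<otimes> x"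
    and four: "\<And>g. g \<in> carrier G \<Longrightarrow> (g \<otimes> g) \<otimes> (g \<otimes> g) = \<one>"
    and g0: "g0 \<in> carrier G" "g0 \<otimes> g0 = c"
  shows "2 * card image = CARD('f) ^ card ram"
proof -
  interpret comm_group G by unfold_locales (rule comm)
  define P where "P = range (\<lambda>b::'f. b + b\<^sup>2)"
  define u where "u = \<pi> g0"
  define s where "s = (\<lambda>v::'c \<Rightarrow> 'f. \<Sum>a\<in>ram. v a)"
  define V where "V = {v. \<forall>a. a \<notin> ram \<longrightarrow> v a = (0::'f)}"
  have g0': "g0 \<in> square_roots G c" by (rule square_rootsI[OF g0])
  then have u: "u \<in> ram" by (simp add: u_def ram_def)
  have s_add: "s (v + w) = s v + s w" for v w by (simp add: s_def sum.distrib)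
  have s_point: "s (point a b) = b" if "a \<in> ram" for a b
    using that finite_ram by (simp add: s_def point_def)
  have pair: "point u (b + b\<^sup>2) \<in> image" for b
  proof -
    have "point u (b\<^sup>2) + point u b \<in> image" using image_pair[OF g0' g0' HOL.refl] by (simp add: u_def)
    moreover have "point u (b\<^sup>2) + point u b = point u (b + b\<^sup>2)"
      by (rule ext) (simp add: point_def)
    ultimately show ?thesis by simp
  qed
  have sub: "image \<subseteq> {v \<in> V. s v \<in> P}"
  proof -
    have "g0 \<notin> Omega1 G" using g0 c_not_one square_rootsD by auto
    then obtain K where K: "subgroup K G" "Omega1 G \<subseteq> K" "g0 \<notin> K"
      "\<And>x y. x \<in> carrier G - K \<Longrightarrow> y \<in> carrier G - K \<Longrightarrow> x \<otimes> y \<in> K"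
      using exists_index_two_subgroup[OF finite_carrier subgroup_square_roots_one _ g0(1)]
        four square_rootsI by (metis m_closed)
    interpret K: subgroup K G by (rule K(1))
    \<comment> \<open>Two square roots of \<open>c\<close> differ by an element of square 1, which
      lies in \<open>K\<close>; a root inside \<open>K\<close> would force \<open>g0\<close> into
      \<open>K\<close>.\<close>
    have "square_roots G c \<inter> K = {}"
    proof -
      have "g \<notin> K" if g: "g \<in> carrier G" "g \<otimes> g = c" for g
      proof
        assume gK: "g \<in> K"
        have "(g \<otimes> g0) \<otimes> (g \<otimes> g0) = \<one>" using mult_square[OF g(1) g0(1) comm[OF g(1) g0(1)]] g g0 c_c by simp
        then have "g \<otimes> g0 \<in> K" using K(2) g g0 square_rootsI by blast
        then have "inv g \<otimes> (g \<otimes> g0) \<in> K" using gK by blast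
        then show False using K(3) g g0 by (simp add: m_assoc[symmetric])
      qed
      then show ?thesis using square_rootsD by blast
    qed
    then have "s (obstruction y) \<in> P" if "y \<in> unitary A" for y
      using sum_obstruction[OF K(1,2) _ K(4) that] unfolding s_def P_def by blast
    then show ?thesis using image_supported unfolding V_def by blast
  qed
  \<comment> \<open>Modulo the image every function can be concentrated at the single point
    \<open>u\<close>, and its sum \<open>s v\<close> is the only thing that remains.\<close>
  have f: "v + point u (s v) \<in> image" if v: "v \<in> V" for v
  proof -
    let ?W = "{v. v + point u (s v) \<in> image}"
    have "V \<subseteq> ?W"
      unfolding V_def
    proof (rule supported_subset_additive[OF finite_ram])
      have "s 0 = 0" by (simp add: s_def)
      then show "0 \<in> ?W" using image_zero by (simp add: point_zero)
      show "v + w \<in> ?W" if "v \<in> ?W" "w \<in> ?W" for v w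
      proof -
        have "point u (s (v + w)) = point u (s v) + point u (s w)"
          by (rule ext) (simp add: s_add point_def)
        then have "v + w + point u (s (v + w)) = (v + point u (s v)) + (w + point u (s w))"
          by (simp only: add_ac)
        then show ?thesis using image_add that by (metis mem_Collect_eq)
      qed
      show "point a b \<in> ?W" if a: "a \<in> ram" for a b
      proof -
        obtain t where t: "t \<in> square_roots G c" "a = \<pi> t" using a unfolding ram_def by blast
        obtain d where d: "d\<^sup>2 = b" using char2_square_surj[OF char] by blast
        have "point a (d\<^sup>2) + point u d \<in> image"
          unfolding t(2) u_def using image_pair[OF t(1) g0'] comm t g0 square_rootsD by blast
        then have "point a (d\<^sup>2) + point u d + point u (d + d\<^sup>2) \<in> image" using image_add pair by blast
        \<comment> \<open>\<open>image_pair\<close> leaves \<open>d\<close> at the point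
          \<open>u\<close> where \<open>d\<^sup>2\<close> is wanted; the difference
          \<open>d + d\<^sup>2\<close> is realised by pairing \<open>g0\<close> with itself.\<close>
        moreover have "point u d + point u (d + d\<^sup>2) = point u (d\<^sup>2)"
          using char2_add_self[OF char, of d]
          by (intro ext) (simp add: point_def add.assoc[symmetric] del: add.assoc)
        ultimately show ?thesis using d s_point[OF a] by (simp add: add.assoc)
      qed
    qed
    then show ?thesis using v by blast
  qed
  have "{v \<in> V. s v \<in> P} \<subseteq> image"
  proof
    fix v assume "v \<in> {v \<in> V. s v \<in> P}"
    then have v: "v \<in> V" "point u (s v) \<in> image" using pair by (auto simp: P_def)
    then have "v + point u (s v) + point u (s v) \<in> image" using f image_add by blast
    then show "v \<in> image" unfolding add.assoc char2_fun_add_self[OF char] by simp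
  qed
  then have W: "image = {v \<in> V. s v \<in> P}" using sub by blast
  \<comment> \<open>Adding \<open>k\<close> at the point \<open>u\<close> exchanges the admissible
    functions with the others, so they are half of all functions.\<close>
  obtain k where k: "\<And>x::'f. x \<in> P \<longleftrightarrow> x + k \<notin> P"
    using artin_schreier_index_two[OF char] unfolding P_def by blast
  have k': "x + k \<in> P \<longleftrightarrow> x \<notin> P" for x using k[of x] by blast
  have puV: "v + point u b \<in> V" if "v \<in> V" for v b using that u by (auto simp: V_def point_def)
  have pp: "v + point u k + point u k = v" for v :: "'c \<Rightarrow> 'f"
    unfolding add.assoc char2_fun_add_self[OF char] by simp
  have "bij_betw (\<lambda>v. v + point u k) {v \<in> V. s v \<in> P} {v \<in> V. s v \<notin> P}"
    by (rule bij_betw_byWitness[where f' = "\<lambda>v. v + point u k"])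
       (auto simp: pp puV s_add s_point[OF u] k')
  then have c1: "card {v \<in> V. s v \<in> P} = card {v \<in> V. s v \<notin> P}" by (rule bij_betw_same_card)
  have cV: "card V = CARD('f) ^ card ram" unfolding V_def by (rule card_supported_functions[OF finite_ram])
  then have "finite V" by (intro card_ge_0_finite) simp
  moreover have "V = {v \<in> V. s v \<in> P} \<union> {v \<in> V. s v \<notin> P}" by blast
  ultimately have "card V = card {v \<in> V. s v \<in> P} + card {v \<in> V. s v \<notin> P}"
    using card_Un_disjoint[of "{v \<in> V. s v \<in> P}" "{v \<in> V. s v \<notin> P}"] by auto
  then show ?thesis using c1 cV W by simp
qed

end

section \<open>Finite abelian 2-groups\<close>

text \<open>The squares of order at most two, identity included. For an abelian 2-group their number
  is the leading constant in the order of the unitary group.\<close>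

definition square_involutions :: "('g, 'r) monoid_scheme \<Rightarrow> 'g set" where
  "square_involutions G =
    {g \<otimes>\<^bsub>G\<^esub> g | g. g \<in> carrier G \<and> (g \<otimes>\<^bsub>G\<^esub> g) \<otimes>\<^bsub>G\<^esub> (g \<otimes>\<^bsub>G\<^esub> g) = \<one>\<^bsub>G\<^esub>}"

section \<open>Squares of order at most two under a quotient by an involution\<close>

context central_extension
begin

text \<open>Compare with the preimage \<open>X\<close> of the set for \<open>A\<close>, which has
  twice its size. If \<open>c\<close> is not a square, \<open>X\<close> splits into the set for
  \<open>G\<close> and its translate by \<open>c\<close>. If \<open>c\<close> is a fourth power,
  exactly half of \<open>X\<close> has square 1. If \<open>c\<close> is a square and the exponent
  divides four, all of \<open>X\<close> is the set for \<open>G\<close>. The factors 1, 1, 2 match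
  the index of the obstruction image in the same three cases.\<close>

lemma card_square_involutions:
  assumes comm: "\<And>x y. x \<in> carrier G \<Longrightarrow> y \<in> carrier G \<Longrightarrow> x \<otimes> y = y \<otimes> x"
  shows "(\<And>v. v \<in> carrier G \<Longrightarrow> v \<otimes> v \<noteq> c) \<Longrightarrow>
      card (square_involutions G) = card (square_involutions A)"
    and "\<lbrakk>v \<in> carrier G; (v \<otimes> v) \<otimes> (v \<otimes> v) = c\<rbrakk> \<Longrightarrow>
      card (square_involutions G) = card (square_involutions A)"
    and "\<lbrakk>v \<in> carrier G; v \<otimes> v = c; \<And>g. g \<in> carrier G \<Longrightarrow> (g \<otimes> g) \<otimes> (g \<otimes> g) = \<one>\<rbrakk> \<Longrightarrow>
      card (square_involutions G) = 2 * card (square_involutions A)"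
proof -
  interpret comm_group G by unfold_locales (rule comm)
  define X where "X = {g \<in> carrier G. \<pi> g \<in> square_involutions A}"
  have cardX: "card X = 2 * card (square_involutions A)"
    unfolding X_def by (rule card_preimage) (auto simp: square_involutions_def)
  have finX: "finite X" using finite_carrier by (simp add: X_def)
  have sub: "square_involutions G \<subseteq> carrier G" by (auto simp: square_involutions_def)
  have subX: "square_involutions G \<subseteq> X"
  proof
    fix s assume "s \<in> square_involutions G"
    then obtain g where g: "g \<in> carrier G" "s = g \<otimes> g" "(g \<otimes> g) \<otimes> (g \<otimes> g) = \<one>"
      unfolding square_involutions_def by blast
    have "(\<pi> g \<otimes>\<^bsub>A\<^esub> \<pi> g) \<otimes>\<^bsub>A\<^esub> (\<pi> g \<otimes>\<^bsub>A\<^esub> \<pi> g) = \<pi> ((g \<otimes> g) \<otimes> (g \<otimes> g))"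
      using g(1) by (simp add: hom_mult)
    also have "\<dots> = \<one>\<^bsub>A\<^esub>" using g(3) hom_one by simp
    finally have "\<pi> g \<otimes>\<^bsub>A\<^esub> \<pi> g \<in> square_involutions A"
      using hom_closed[OF g(1)] unfolding square_involutions_def by blast
    then show "s \<in> X" using g by (simp add: X_def hom_mult)
  qed
  have XD: "\<exists>h\<in>carrier G. (g = h \<otimes> h \<or> g = h \<otimes> h \<otimes> c) \<and> (h \<otimes> h) \<otimes> (h \<otimes> h) \<in> {\<one>, c}"
    if g: "g \<in> X" for g
  proof -
    have gG: "g \<in> carrier G" using g by (simp add: X_def)
    obtain a where a: "a \<in> carrier A" "\<pi> g = a \<otimes>\<^bsub>A\<^esub> a"
        "(a \<otimes>\<^bsub>A\<^esub> a) \<otimes>\<^bsub>A\<^esub> (a \<otimes>\<^bsub>A\<^esub> a) = \<one>\<^bsub>A\<^esub>"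
      using g unfolding X_def square_involutions_def by blast
    define h where "h = sec a"
    have h: "h \<in> carrier G" "\<pi> h = a" using sec[OF a(1)] by (simp_all add: h_def)
    have "\<pi> g = \<pi> (h \<otimes> h)" using h a by (simp add: hom_mult)
    then have "g = h \<otimes> h \<or> g = h \<otimes> h \<otimes> c" using hom_eq_iff[of "h \<otimes> h" g] h gG by simp
    moreover have "\<pi> ((h \<otimes> h) \<otimes> (h \<otimes> h)) = \<one>\<^bsub>A\<^esub>" using h a by (simp add: hom_mult)
    then have "(h \<otimes> h) \<otimes> (h \<otimes> h) \<in> {\<one>, c}" using kernelD h(1) by simp
    ultimately show ?thesis using h by blast
  qed
  have sqc: "(h \<otimes> v) \<otimes> (h \<otimes> v) = h \<otimes> h \<otimes> c" if "h \<in> carrier G" "v \<in> carrier G" "v \<otimes> v = c" for h v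
    using mult_square[of h v] that comm by simp
  show "card (square_involutions G) = card (square_involutions A)"
    if nsq: "\<And>v. v \<in> carrier G \<Longrightarrow> v \<otimes> v \<noteq> c"
  proof -
    let ?C = "(\<lambda>g. g \<otimes> c) ` square_involutions G"
    have "X = square_involutions G \<union> ?C"
    proof
      show "X \<subseteq> square_involutions G \<union> ?C"
      proof
        fix g assume "g \<in> X"
        from XD[OF this] obtain h where h: "h \<in> carrier G" "g = h \<otimes> h \<or> g = h \<otimes> h \<otimes> c"
          "(h \<otimes> h) \<otimes> (h \<otimes> h) \<in> {\<one>, c}" by blast
        then have "(h \<otimes> h) \<otimes> (h \<otimes> h) = \<one>" using nsq[of "h \<otimes> h"] by simp
        then have "h \<otimes> h \<in> square_involutions G" using h(1) unfolding square_involutions_def by blast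
        then show "g \<in> square_involutions G \<union> ?C" using h(2) by blast
      qed
      have "g \<otimes> c \<in> X" if "g \<in> X" for g
        using that c_closed hom_closed[of g] by (simp add: X_def hom_mult hom_c)
      then show "square_involutions G \<union> ?C \<subseteq> X" using subX by blast
    qed
    moreover have "square_involutions G \<inter> ?C = {}"
    proof -
      have False if g: "g \<in> square_involutions G" "g \<otimes> c \<in> square_involutions G" for g
      proof -
        obtain x y where xy: "x \<in> carrier G" "g = x \<otimes> x" "y \<in> carrier G" "g \<otimes> c = y \<otimes> y"
          using g unfolding square_involutions_def by blast
        have "(inv x \<otimes> y) \<otimes> (inv x \<otimes> y) = (inv x \<otimes> inv x) \<otimes> (y \<otimes> y)"
          using mult_square[of "inv x" y] xy comm by simp
        also have "\<dots> = inv g \<otimes> (g \<otimes> c)" using xy by (simp add: inv_mult)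
        also have "\<dots> = c" using g sub c_closed by (simp add: m_assoc[symmetric] subset_iff)
        finally show False using nsq[of "inv x \<otimes> y"] xy by simp
      qed
      then show ?thesis by blast
    qed
    moreover have "card ?C = card (square_involutions G)"
      by (rule card_image) (use sub c_closed in \<open>auto simp: inj_on_def subset_iff\<close>)
    moreover have "finite (square_involutions G)" using subX finX finite_subset by blast
    ultimately have "card X = 2 * card (square_involutions G)"
      using card_Un_disjoint[of "square_involutions G" ?C] by simp
    then show ?thesis using cardX by simp
  qed
  \<comment> \<open>When \<open>c = v \<otimes> v\<close>, a factor \<open>c\<close> is absorbed
    into a square: \<open>h \<otimes> h \<otimes> c\<close> is the square of
    \<open>h \<otimes> v\<close>.\<close>
  have sq_iff: "{g \<in> X. g \<otimes> g = \<one>} = square_involutions G" if v: "v \<in> carrier G" "v \<otimes> v = c" for v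
  proof
    show "square_involutions G \<subseteq> {g \<in> X. g \<otimes> g = \<one>}"
      using subX by (auto simp: square_involutions_def)
    show "{g \<in> X. g \<otimes> g = \<one>} \<subseteq> square_involutions G"
    proof
      fix g assume g: "g \<in> {g \<in> X. g \<otimes> g = \<one>}"
      then obtain h where h: "h \<in> carrier G" "g = h \<otimes> h \<or> g = h \<otimes> h \<otimes> c" using XD[of g] by blast
      then have "g = h \<otimes> h \<or> g = (h \<otimes> v) \<otimes> (h \<otimes> v)" using sqc[OF h(1) v] by simp
      then have "\<exists>k\<in>carrier G. g = k \<otimes> k" using h(1) v(1) by blast
      then show "g \<in> square_involutions G" using g unfolding square_involutions_def by blast
    qed
  qed
  show "card (square_involutions G) = card (square_involutions A)"
    if v: "v \<in> carrier G" "(v \<otimes> v) \<otimes> (v \<otimes> v) = c"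
  proof -
    define w where "w = v \<otimes> v"
    have w: "w \<in> carrier G" "w \<otimes> w = c" using v by (simp_all add: w_def)
    have wX: "w \<otimes> g \<in> X" if g: "g \<in> X" for g
    proof -
      have gG: "g \<in> carrier G" using g by (simp add: X_def)
      obtain h where h: "h \<in> carrier G" "g = h \<otimes> h \<or> g = h \<otimes> h \<otimes> c"
        "(h \<otimes> h) \<otimes> (h \<otimes> h) \<in> {\<one>, c}" using XD[OF g] by blast
      define a where "a = \<pi> (v \<otimes> h)"
      have aA: "a \<in> carrier A" using v h hom_closed by (simp add: a_def)
      have "\<pi> g = \<pi> (h \<otimes> h)" using h hom_eq_iff[of "h \<otimes> h" g] gG by simp
      then have "\<pi> (w \<otimes> g) = \<pi> (w \<otimes> (h \<otimes> h))" using w gG h by (simp add: hom_mult)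
      also have "\<dots> = a \<otimes>\<^bsub>A\<^esub> a"
        using mult_square[OF v(1) h(1) comm[OF v(1) h(1)]] v h unfolding a_def w_def
        by (metis hom_mult m_closed)
      finally have 1: "\<pi> (w \<otimes> g) = a \<otimes>\<^bsub>A\<^esub> a" .
      have "(w \<otimes> (h \<otimes> h)) \<otimes> (w \<otimes> (h \<otimes> h)) = c \<otimes> ((h \<otimes> h) \<otimes> (h \<otimes> h))"
        using mult_square[of w "h \<otimes> h"] w h comm by simp
      then have "(w \<otimes> (h \<otimes> h)) \<otimes> (w \<otimes> (h \<otimes> h)) \<in> {\<one>, c}" using h(3) c_closed c_c by auto
      then have "\<pi> ((w \<otimes> (h \<otimes> h)) \<otimes> (w \<otimes> (h \<otimes> h))) = \<one>\<^bsub>A\<^esub>" using hom_one hom_c by auto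
      then have "(a \<otimes>\<^bsub>A\<^esub> a) \<otimes>\<^bsub>A\<^esub> (a \<otimes>\<^bsub>A\<^esub> a) = \<one>\<^bsub>A\<^esub>"
        using w h \<open>\<pi> (w \<otimes> (h \<otimes> h)) = a \<otimes>\<^bsub>A\<^esub> a\<close> by (simp add: hom_mult)
      then show ?thesis using 1 aA w gG unfolding X_def square_involutions_def by auto
    qed
    have ww: "w \<otimes> (w \<otimes> g) = c \<otimes> g" if "g \<in> carrier G" for g
      using w that by (simp add: m_assoc[symmetric])
    have cX: "c \<otimes> g \<in> X" if "g \<in> X" for g
      using that c_closed hom_closed[of g] by (simp add: X_def hom_mult hom_c)
    have XG: "g \<in> carrier G" if "g \<in> X" for g using that by (simp add: X_def)
    have wsq: "(w \<otimes> g) \<otimes> (w \<otimes> g) = c \<otimes> (g \<otimes> g)" if "g \<in> carrier G" for g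
      using mult_square[of w g] w that comm by simp
    have cc: "c \<otimes> (c \<otimes> g) = g" if "g \<in> carrier G" for g
      using c_closed that by (simp add: m_assoc[symmetric] c_c)
    \<comment> \<open>Multiplication by \<open>w\<close>, whose square is \<open>c\<close>,
      exchanges the elements of \<open>X\<close> of square 1 with those of square
      \<open>c\<close>.\<close>
    have "bij_betw (\<lambda>g. w \<otimes> g) {g \<in> X. g \<otimes> g = \<one>} {g \<in> X. g \<otimes> g = c}"
    proof (rule bij_betw_byWitness[where f' = "\<lambda>g. c \<otimes> (w \<otimes> g)"])
      show "\<forall>g\<in>{g \<in> X. g \<otimes> g = \<one>}. c \<otimes> (w \<otimes> (w \<otimes> g)) = g"
        using ww cc XG by simp
      show "\<forall>g\<in>{g \<in> X. g \<otimes> g = c}. w \<otimes> (c \<otimes> (w \<otimes> g)) = g"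
        using ww cc XG w c_closed m_lcomm[of w c] by simp
      show "(\<lambda>g. w \<otimes> g) ` {g \<in> X. g \<otimes> g = \<one>} \<subseteq> {g \<in> X. g \<otimes> g = c}"
        using wX wsq XG c_closed by auto
      show "(\<lambda>g. c \<otimes> (w \<otimes> g)) ` {g \<in> X. g \<otimes> g = c} \<subseteq> {g \<in> X. g \<otimes> g = \<one>}"
      proof (rule image_subsetI)
        fix g assume "g \<in> {g \<in> X. g \<otimes> g = c}"
        then have g: "g \<in> X" "g \<otimes> g = c" by simp_all
        have "(c \<otimes> (w \<otimes> g)) \<otimes> (c \<otimes> (w \<otimes> g)) = (w \<otimes> g) \<otimes> (w \<otimes> g)"
          using mult_square[of c "w \<otimes> g"] c_comm[of "w \<otimes> g"] c_closed w XG[OF g(1)] c_c by simp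
        also have "\<dots> = \<one>" using wsq[OF XG[OF g(1)]] g c_c by simp
        finally show "c \<otimes> (w \<otimes> g) \<in> {g \<in> X. g \<otimes> g = \<one>}"
          using cX wX g by blast
      qed
    qed
    then have "card {g \<in> X. g \<otimes> g = c} = card {g \<in> X. g \<otimes> g = \<one>}" by (simp add: bij_betw_same_card)
    moreover have "X = {g \<in> X. g \<otimes> g = \<one>} \<union> {g \<in> X. g \<otimes> g = c}"
    proof -
      have "g \<otimes> g = \<one> \<or> g \<otimes> g = c" if g: "g \<in> X" for g
      proof -
        obtain h where h: "h \<in> carrier G" "g = h \<otimes> h \<or> g = h \<otimes> h \<otimes> c"
          "(h \<otimes> h) \<otimes> (h \<otimes> h) \<in> {\<one>, c}" using XD[OF g] by blast
        have "(h \<otimes> h \<otimes> c) \<otimes> (h \<otimes> h \<otimes> c) = (h \<otimes> h) \<otimes> (h \<otimes> h)"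
          using mult_square[of "h \<otimes> h" c] c_comm[of "h \<otimes> h"] c_closed h(1) c_c by simp
        then show ?thesis using h by auto
      qed
      then show ?thesis by blast
    qed
    moreover have "{g \<in> X. g \<otimes> g = \<one>} \<inter> {g \<in> X. g \<otimes> g = c} = {}" using c_not_one by auto
    ultimately have "card X = 2 * card {g \<in> X. g \<otimes> g = \<one>}"
      using card_Un_disjoint[of "{g \<in> X. g \<otimes> g = \<one>}" "{g \<in> X. g \<otimes> g = c}"] finX by auto
    then show ?thesis using cardX sq_iff[OF w] by simp
  qed
  show "card (square_involutions G) = 2 * card (square_involutions A)"
    if v: "v \<in> carrier G" "v \<otimes> v = c"
      and four: "\<And>g. g \<in> carrier G \<Longrightarrow> (g \<otimes> g) \<otimes> (g \<otimes> g) = \<one>"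
  proof -
    have "{g \<in> X. g \<otimes> g = \<one>} = X"
    proof -
      have "g \<otimes> g = \<one>" if g: "g \<in> X" for g
      proof -
        obtain h where h: "h \<in> carrier G" "g = h \<otimes> h \<or> g = h \<otimes> h \<otimes> c" using XD[OF g] by blast
        have "(h \<otimes> h \<otimes> c) \<otimes> (h \<otimes> h \<otimes> c) = (h \<otimes> h) \<otimes> (h \<otimes> h)"
          using mult_square[of "h \<otimes> h" c] c_comm[of "h \<otimes> h"] c_closed h(1) c_c by simp
        then show ?thesis using h four[OF h(1)] by auto
      qed
      then show ?thesis by blast
    qed
    then show ?thesis using cardX sq_iff[OF v] by simp
  qed
qed

end

text \<open>Realised on coset representatives, so that the induction below stays within one type.\<close>

lemma (in comm_group) exists_quotient_by_involution:
  assumes fin: "finite (carrier G)" and c: "c \<in> carrier G" "c \<otimes> c = \<one>" "c \<noteq> \<one>"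
    and char: "CHAR('f::{field,finite}) = 2"
  obtains A :: "'a monoid" and \<pi> where "central_extension TYPE('f) G A \<pi> c"
proof -
  \<comment> \<open>The set \<open>{g, g \<otimes> c}\<close> is the same for both members of the
    coset, so the choice depends on the coset alone.\<close>
  define r where "r = (\<lambda>g. SOME x. x \<in> {g, g \<otimes> c})"
  define A :: "'a monoid" where
    "A = \<lparr>carrier = r ` carrier G, monoid.mult = (\<lambda>x y. r (x \<otimes> y)), one = r \<one>\<rparr>"
  have r: "r g \<in> {g, g \<otimes> c}" for g
    unfolding r_def by (rule someI_ex) blast
  have gcc: "g \<otimes> c \<otimes> c = g" if "g \<in> carrier G" for g using that c by (simp add: m_assoc)
  have r_c: "r (g \<otimes> c) = r g" if "g \<in> carrier G" for g
    unfolding r_def gcc[OF that] by (simp add: insert_commute)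
  have rG: "r g \<in> carrier G" if "g \<in> carrier G" for g using r[of g] that c by auto
  have r_left: "r (r x \<otimes> y) = r (x \<otimes> y)" if "x \<in> carrier G" "y \<in> carrier G" for x y
  proof -
    have "x \<otimes> c \<otimes> y = x \<otimes> y \<otimes> c" using that c by (simp add: m_ac)
    then show ?thesis using r[of x] r_c[of "x \<otimes> y"] that by auto
  qed
  have r_right: "r (y \<otimes> r x) = r (y \<otimes> x)" if "x \<in> carrier G" "y \<in> carrier G" for x y
    using r_left[OF that] that rG[OF that(1)] by (simp add: m_comm)
  have rr: "r (r x) = r x" if "x \<in> carrier G" for x
    using r_left[OF that one_closed] that rG[OF that] by simp
  have A: "comm_group A"
  proof (rule comm_groupI)
    show "\<exists>y\<in>carrier A. y \<otimes>\<^bsub>A\<^esub> x = \<one>\<^bsub>A\<^esub>" if x: "x \<in> carrier A" for x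
    proof -
      obtain g where g: "g \<in> carrier G" "x = r g" using x by (auto simp: A_def)
      have "r (r (inv g) \<otimes> r g) = r \<one>" using g by (simp add: r_left r_right rG)
      then show ?thesis using g unfolding A_def by (intro bexI[of _ "r (inv g)"]) auto
    qed
  qed (auto simp: A_def r_left r_right rr rG m_assoc intro: imageI, auto simp: m_comm rG)
  have "central_extension TYPE('f) G A r c"
  proof (intro central_extension.intro finite_group.intro central_extension_axioms.intro
      finite_group_axioms.intro)
    show "r \<in> hom G A" by (rule homI) (auto simp: A_def r_left r_right rG)
    show "r ` carrier G = carrier A" by (simp add: A_def)
    have "r g = r \<one> \<longleftrightarrow> g = \<one> \<or> g = c" if g: "g \<in> carrier G" for g
    proof
      assume eq: "r g = r \<one>"
      have "g \<in> {\<one>, c} \<or> g \<otimes> c \<in> {\<one>, c}" using r[of g] r[of \<one>] eq c by auto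
      then show "g = \<one> \<or> g = c"
      proof
        assume "g \<otimes> c \<in> {\<one>, c}"
        then have "g \<otimes> c \<otimes> c = \<one> \<otimes> c \<or> g \<otimes> c \<otimes> c = c \<otimes> c" by auto
        then show ?thesis using gcc[OF g] c by auto
      qed simp
    next
      assume "g = \<one> \<or> g = c"
      then show "r g = r \<one>" using r_c[OF one_closed] c by auto
    qed
    then show "{g \<in> carrier G. r g = \<one>\<^bsub>A\<^esub>} = {\<one>, c}" using c by (auto simp: A_def)
  qed (use A fin c char in \<open>simp_all add: is_group\<close>)
  then show thesis by (rule that)
qed

text \<open>The last nontrivial term in the sequence of iterated squares of
  \<open>g\<close>.\<close>

lemma (in group) exists_involution_power:
  assumes "g \<in> carrier G" "g \<noteq> \<one>" "g [^] (2 ^ i :: nat) = \<one>"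
  obtains j :: nat where "g [^] (2 ^ j :: nat) \<noteq> \<one>" "g [^] (2 ^ j :: nat) \<otimes> g [^] (2 ^ j :: nat) = \<one>"
proof -
  have "\<exists>j. g [^] (2 ^ j :: nat) \<noteq> \<one> \<and> g [^] (2 ^ j :: nat) \<otimes> g [^] (2 ^ j :: nat) = \<one>"
    using assms(3)
  proof (induction i)
    case 0
    then show ?case using assms by simp
  next
    case (Suc i)
    show ?case
    proof (cases "g [^] (2 ^ i :: nat) = \<one>")
      case True
      then show ?thesis by (rule Suc.IH)
    next
      case False
      have "g [^] (2 ^ i :: nat) \<otimes> g [^] (2 ^ i :: nat) = g [^] (2 ^ Suc i :: nat)"
        using assms(1) by (simp add: nat_pow_mult mult_2)
      then show ?thesis using False Suc.prems by auto
    qed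
  qed
  then show thesis using that by blast
qed

text \<open>The freedom in \<open>c\<close> drives the induction. If some fourth power is
  nontrivial, a suitable power of it is an involution that is itself a fourth power, and the
  obstruction is onto. Otherwise the exponent divides four and any involution will do: it is either
  no square, with empty \<open>ram\<close>, or a square, with image of index two.\<close>

theorem card_unitary_abelian:
  fixes G :: "'a monoid"
  assumes char: "CHAR('f::{field,finite}) = 2" and "comm_group G" "finite (carrier G)"
    and "\<And>g. g \<in> carrier G \<Longrightarrow> \<exists>i. g [^]\<^bsub>G\<^esub> (2 ^ i :: nat) = \<one>\<^bsub>G\<^esub>"
  shows "card (unitary G :: ('a \<Rightarrow> 'f) set) =
    card (square_involutions G) * CARD('f) ^ ((card (carrier G) + card (Omega1 G)) div 2 - 1)"
  using assms(2-)
proof (induction "card (carrier G)" arbitrary: G rule: less_induct)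
  case less
  interpret G: comm_group G by (rule less.prems(1))
  interpret G: finite_group G by unfold_locales (rule less.prems(2))
  note fin = less.prems(2) and two = less.prems(3)
  let ?U = "unitary G :: ('a \<Rightarrow> 'f) set"
  have step: "card ?U = card (square_involutions G) * CARD('f) ^ ((card (carrier G) + card (Omega1 G)) div 2 - 1)"
    if c: "c \<in> carrier G" "c \<otimes>\<^bsub>G\<^esub> c = \<one>\<^bsub>G\<^esub>" "c \<noteq> \<one>\<^bsub>G\<^esub>"
      and case3: "(\<forall>v\<in>carrier G. v \<otimes>\<^bsub>G\<^esub> v \<noteq> c) \<or>
        (\<exists>v\<in>carrier G. (v \<otimes>\<^bsub>G\<^esub> v) \<otimes>\<^bsub>G\<^esub> (v \<otimes>\<^bsub>G\<^esub> v) = c) \<or>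
        (\<forall>g\<in>carrier G. (g \<otimes>\<^bsub>G\<^esub> g) \<otimes>\<^bsub>G\<^esub> (g \<otimes>\<^bsub>G\<^esub> g) = \<one>\<^bsub>G\<^esub>)" for c
  proof -
    obtain A :: "'a monoid" and \<pi> where "central_extension TYPE('f) G A \<pi> c"
      using G.exists_quotient_by_involution[OF fin c char] .
    then interpret E: central_extension G A \<pi> c "TYPE('f)" .
    have lt: "card (carrier A) < card (carrier G)"
    proof -
      have "card (carrier A) > 0" using E.A.finite_carrier E.A.one_closed by (auto simp: card_gt_0_iff)
      then show ?thesis using E.card_carrier by simp
    qed
    have twoA: "\<exists>i. a [^]\<^bsub>A\<^esub> (2 ^ i :: nat) = \<one>\<^bsub>A\<^esub>" if a: "a \<in> carrier A" for a
    proof -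
      obtain g where g: "g \<in> carrier G" "a = \<pi> g" using E.sec[OF a] by metis
      obtain i where "g [^]\<^bsub>G\<^esub> (2 ^ i :: nat) = \<one>\<^bsub>G\<^esub>" using two[OF g(1)] by blast
      then have "\<pi> g [^]\<^bsub>A\<^esub> (2 ^ i :: nat) = \<one>\<^bsub>A\<^esub>"
        using group_hom.hom_nat_pow[OF E.group_hom g(1), of "2 ^ i"] E.hom_one by simp
      then show ?thesis using g by blast
    qed
    have IH: "card (unitary A :: ('a \<Rightarrow> 'f) set) =
        card (square_involutions A) * CARD('f) ^ ((card (carrier A) + card (Omega1 A)) div 2 - 1)"
      by (rule less.hyps[OF lt E.A.comm_group_axioms E.A.finite_carrier twoA])
    note ext = E.card_unitary_extension[OF IH]
    note sqi = E.card_square_involutions[OF G.m_comm]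
    consider "\<And>v. v \<in> carrier G \<Longrightarrow> v \<otimes>\<^bsub>G\<^esub> v \<noteq> c"
      | v where "v \<in> carrier G" "(v \<otimes>\<^bsub>G\<^esub> v) \<otimes>\<^bsub>G\<^esub> (v \<otimes>\<^bsub>G\<^esub> v) = c"
      | v where "v \<in> carrier G" "v \<otimes>\<^bsub>G\<^esub> v = c"
        "\<And>g. g \<in> carrier G \<Longrightarrow> (g \<otimes>\<^bsub>G\<^esub> g) \<otimes>\<^bsub>G\<^esub> (g \<otimes>\<^bsub>G\<^esub> g) = \<one>\<^bsub>G\<^esub>"
      using case3 by metis
    then show ?thesis
    proof cases
      case 1
      have "square_roots G c = {}" using 1 E.square_rootsD by blast
      then have "card E.image = CARD('f) ^ card E.ram" by (intro E.card_image_noncommuting) simp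
      then show ?thesis using ext[of 1] sqi(1)[OF _ _ 1] by simp
    next
      case 2
      have "card E.image = CARD('f) ^ card E.ram"
      proof (rule E.card_image_square)
        show "v \<otimes>\<^bsub>G\<^esub> v \<in> square_roots G c" using 2 by (intro E.square_rootsI) auto
        show "t \<otimes>\<^bsub>G\<^esub> (v \<otimes>\<^bsub>G\<^esub> v) = (v \<otimes>\<^bsub>G\<^esub> v) \<otimes>\<^bsub>G\<^esub> t" if "t \<in> square_roots G c" for t
          using that 2 E.square_rootsD[OF that] by (intro G.m_comm) auto
      qed (use 2 in auto)
      then show ?thesis using ext[of 1] sqi(2)[OF _ _ 2] by simp
    next
      case 3
      have "2 * card E.image = CARD('f) ^ card E.ram"
        by (rule E.card_image_half[OF G.m_comm 3(3) 3(1,2)])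
      then show ?thesis using ext[of 2] sqi(3)[OF _ _ 3] by simp
    qed
  qed
  consider v where "v \<in> carrier G" "v [^]\<^bsub>G\<^esub> (4::nat) \<noteq> \<one>\<^bsub>G\<^esub>"
    | g where "\<And>g. g \<in> carrier G \<Longrightarrow> g [^]\<^bsub>G\<^esub> (4::nat) = \<one>\<^bsub>G\<^esub>" "g \<in> carrier G" "g \<noteq> \<one>\<^bsub>G\<^esub>"
    | "carrier G = {\<one>\<^bsub>G\<^esub>}"
    using G.one_closed by blast
  then show ?case
  proof cases
    case 1
    obtain i where i: "v [^]\<^bsub>G\<^esub> (2 ^ i :: nat) = \<one>\<^bsub>G\<^esub>" using two[OF 1(1)] by blast
    define u where "u = v [^]\<^bsub>G\<^esub> (4::nat)"
    have u: "u \<in> carrier G" "u \<noteq> \<one>\<^bsub>G\<^esub>" using 1 by (simp_all add: u_def)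
    have "u [^]\<^bsub>G\<^esub> (2 ^ i :: nat) = (v [^]\<^bsub>G\<^esub> (2 ^ i :: nat)) [^]\<^bsub>G\<^esub> (4::nat)"
      using 1 by (simp add: u_def G.nat_pow_pow mult.commute)
    then have "u [^]\<^bsub>G\<^esub> (2 ^ i :: nat) = \<one>\<^bsub>G\<^esub>" using i by simp
    then obtain j :: nat where j: "u [^]\<^bsub>G\<^esub> (2 ^ j :: nat) \<noteq> \<one>\<^bsub>G\<^esub>"
      "u [^]\<^bsub>G\<^esub> (2 ^ j :: nat) \<otimes>\<^bsub>G\<^esub> u [^]\<^bsub>G\<^esub> (2 ^ j :: nat) = \<one>\<^bsub>G\<^esub>"
      using G.exists_involution_power[OF u] by blast
    \<comment> \<open>The involution found is a power of \<open>v [^] 4\<close>, hence the fourth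
      power of this element.\<close>
    define w where "w = v [^]\<^bsub>G\<^esub> (2 ^ j :: nat)"
    have "(w \<otimes>\<^bsub>G\<^esub> w) \<otimes>\<^bsub>G\<^esub> (w \<otimes>\<^bsub>G\<^esub> w) = u [^]\<^bsub>G\<^esub> (2 ^ j :: nat)"
    proof -
      have "2 ^ j + 2 ^ j + (2 ^ j + 2 ^ j) = 4 * (2 ^ j :: nat)" by simp
      then show ?thesis using 1 by (simp only: w_def u_def G.nat_pow_mult G.nat_pow_pow G.nat_pow_closed)
    qed
    moreover have "w \<in> carrier G" using 1 by (simp add: w_def)
    ultimately show ?thesis using u j by (intro step[of "u [^]\<^bsub>G\<^esub> (2 ^ j :: nat)"]) auto
  next
    case 2
    obtain i where i: "g [^]\<^bsub>G\<^esub> (2 ^ i :: nat) = \<one>\<^bsub>G\<^esub>" using two[OF 2(2)] by blast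
    obtain j :: nat where j: "g [^]\<^bsub>G\<^esub> (2 ^ j :: nat) \<noteq> \<one>\<^bsub>G\<^esub>"
      "g [^]\<^bsub>G\<^esub> (2 ^ j :: nat) \<otimes>\<^bsub>G\<^esub> g [^]\<^bsub>G\<^esub> (2 ^ j :: nat) = \<one>\<^bsub>G\<^esub>"
      using G.exists_involution_power[OF 2(2,3) i] by blast
    have "(h \<otimes>\<^bsub>G\<^esub> h) \<otimes>\<^bsub>G\<^esub> (h \<otimes>\<^bsub>G\<^esub> h) = \<one>\<^bsub>G\<^esub>" if h: "h \<in> carrier G" for h
      using 2(1)[OF h] h by (simp add: numeral_eq_Suc G.m_assoc)
    then show ?thesis using 2(2) j by (intro step[of "g [^]\<^bsub>G\<^esub> (2 ^ j :: nat)"]) auto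
  next
    case 3
    have "x = point \<one>\<^bsub>G\<^esub> 1" if x: "x \<in> unitary G" for x :: "'a \<Rightarrow> 'f"
    proof (rule galg_eqI)
      show "x \<in> galg G" using x by (simp add: unitary_def)
      show "point \<one>\<^bsub>G\<^esub> 1 \<in> galg G" by (rule galg_point) simp
      fix g assume "g \<in> carrier G"
      then show "x g = point \<one>\<^bsub>G\<^esub> 1 g" using G.sum_unitary[OF char x] 3 by (simp add: point_def)
    qed
    then have "?U = {point \<one>\<^bsub>G\<^esub> 1}" using G.one_unitary by blast
    moreover have "square_involutions G = {\<one>\<^bsub>G\<^esub>}" "Omega1 G = {\<one>\<^bsub>G\<^esub>}"
      using 3 by (auto simp: square_involutions_def square_roots_def)
    ultimately show ?thesis using 3 by simp
  qed
qed

section \<open>Presented groups\<close>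

lemma words_over_append: "u \<in> words_over X \<Longrightarrow> v \<in> words_over X \<Longrightarrow> u @ v \<in> words_over X"
  by (simp add: words_over_def)

lemma words_over_Nil: "[] \<in> words_over X"
  by (simp add: words_over_def)

lemma words_over_Cons: "(x, e) # u \<in> words_over X \<longleftrightarrow> x \<in> X \<and> u \<in> words_over X"
  by (auto simp: words_over_def)

lemma words_over_appendD: "u @ v \<in> words_over X \<longleftrightarrow> u \<in> words_over X \<and> v \<in> words_over X"
  by (auto simp: words_over_def)

lemma pres_cong_words: "(u, v) \<in> pres_cong X R \<Longrightarrow> u \<in> words_over X \<and> v \<in> words_over X"
  by (induction rule: pres_cong.induct) (auto simp: words_over_appendD words_over_Cons words_over_Nil)

lemma equiv_pres_cong: "equiv (words_over X) (pres_cong X R)"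
proof (rule equivI)
  show "pres_cong X R \<subseteq> words_over X \<times> words_over X" using pres_cong_words by fastforce
  show "refl_on (words_over X) (pres_cong X R)"
    by (rule refl_onI) (auto intro: pres_cong.refl)
  show "sym (pres_cong X R)" by (rule symI) (rule pres_cong.sym)
  show "trans (pres_cong X R)" by (rule transI) (rule pres_cong.trans)
qed

lemma pres_cong_context:
  assumes "(u, v) \<in> pres_cong X R" and p: "p \<in> words_over X" and q: "q \<in> words_over X"
  shows "(p @ u @ q, p @ v @ q) \<in> pres_cong X R"
  using assms(1)
proof (induction rule: pres_cong.induct)
  case (refl w)
  then show ?case using p q by (intro pres_cong.refl words_over_append)
next
  case (sym v w)
  then show ?case using pres_cong.sym by blast
next
  case (trans u v w)
  then show ?case by (blast intro: pres_cong.trans)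
next
  case (cancel us vs x e)
  then show ?case
    using pres_cong.cancel[of "p @ us" X "vs @ q" x e R] p q by (simp add: words_over_append)
next
  case (rel us vs l r)
  then show ?case
    using pres_cong.rel[of "p @ us" X "vs @ q" l r R] p q by (simp add: words_over_append)
qed

lemma pres_cong_append:
  assumes "(u, u') \<in> pres_cong X R" "(v, v') \<in> pres_cong X R"
  shows "(u @ v, u' @ v') \<in> pres_cong X R"
proof -
  have w: "u' \<in> words_over X" "v \<in> words_over X" using assms pres_cong_words by blast+
  have "(u @ v, u' @ v) \<in> pres_cong X R"
    using pres_cong_context[OF assms(1) words_over_Nil w(2)] by simp
  moreover have "(u' @ v, u' @ v') \<in> pres_cong X R"
    using pres_cong_context[OF assms(2) w(1) words_over_Nil] by simp
  ultimately show ?thesis by (rule pres_cong.trans)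
qed

definition word_class :: "'x set \<Rightarrow> ('x gword \<times> 'x gword) set \<Rightarrow> 'x gword \<Rightarrow> 'x gword set" where
  "word_class X R w = pres_cong X R `` {w}"

definition formal_inverse :: "'x gword \<Rightarrow> 'x gword" where
  "formal_inverse w = rev (map (\<lambda>(x, e). (x, \<not> e)) w)"

lemma words_over_formal_inverse: "w \<in> words_over X \<Longrightarrow> formal_inverse w \<in> words_over X"
  by (auto simp: formal_inverse_def words_over_def lists_eq_set)

lemma formal_inverse_cancel:
  "w \<in> words_over X \<Longrightarrow> (formal_inverse w @ w, []) \<in> pres_cong X R"
proof (induction w)
  case Nil
  then show ?case by (simp add: formal_inverse_def pres_cong.refl words_over_Nil)
next
  case (Cons l w)
  obtain x e where l: "l = (x, e)" by (cases l)
  have x: "x \<in> X" "w \<in> words_over X" using Cons.prems by (simp_all add: l words_over_Cons)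
  have eq: "formal_inverse (l # w) @ l # w = formal_inverse w @ [(x, \<not> e), (x, \<not> \<not> e)] @ w"
    by (simp add: formal_inverse_def l)
  have "(formal_inverse (l # w) @ l # w, formal_inverse w @ w) \<in> pres_cong X R"
    unfolding eq by (rule pres_cong.cancel[OF words_over_formal_inverse[OF x(2)] x(2,1)])
  then show ?case using Cons.IH[OF x(2)] by (rule pres_cong.trans)
qed

context
  fixes X :: "'x set" and R :: "('x gword \<times> 'x gword) set"
begin

abbreviation (input) "pres \<equiv> presented_group X R"
abbreviation (input) "cls \<equiv> word_class X R"

lemma presented_carrier: "carrier pres = cls ` words_over X"
  by (auto simp: presented_group_def quotient_def word_class_def)

lemma presented_one: "\<one>\<^bsub>pres\<^esub> = cls []"
  by (simp add: presented_group_def word_class_def)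

lemma word_class_eq_iff:
  assumes "u \<in> words_over X" "v \<in> words_over X"
  shows "cls u = cls v \<longleftrightarrow> (u, v) \<in> pres_cong X R"
  unfolding word_class_def using equiv_pres_cong assms by (rule eq_equiv_class_iff)

lemma presented_mult:
  assumes "u \<in> words_over X" "v \<in> words_over X"
  shows "cls u \<otimes>\<^bsub>pres\<^esub> cls v = cls (u @ v)"
proof -
  have "congruent2 (pres_cong X R) (pres_cong X R) (\<lambda>u v. cls (u @ v))"
  proof (rule congruent2I')
    fix u u' v v' assume *: "(u, u') \<in> pres_cong X R" "(v, v') \<in> pres_cong X R"
    then have "u @ v \<in> words_over X" "u' @ v' \<in> words_over X"
      using pres_cong_words words_over_append by metis+
    then show "cls (u @ v) = cls (u' @ v')"
      using pres_cong_append[OF *] word_class_eq_iff by blast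
  qed
  from UN_equiv_class2[OF equiv_pres_cong equiv_pres_cong this assms]
  show ?thesis by (simp add: presented_group_def word_class_def)
qed

lemma group_presented: "group pres"
proof (rule groupI)
  fix x y assume "x \<in> carrier pres" "y \<in> carrier pres"
  then show "x \<otimes>\<^bsub>pres\<^esub> y \<in> carrier pres"
    by (auto simp: presented_carrier presented_mult words_over_append)
next
  show "\<one>\<^bsub>pres\<^esub> \<in> carrier pres" by (auto simp: presented_carrier presented_one words_over_Nil)
next
  fix x y z assume "x \<in> carrier pres" "y \<in> carrier pres" "z \<in> carrier pres"
  then show "x \<otimes>\<^bsub>pres\<^esub> y \<otimes>\<^bsub>pres\<^esub> z = x \<otimes>\<^bsub>pres\<^esub> (y \<otimes>\<^bsub>pres\<^esub> z)"
    by (auto simp: presented_carrier presented_mult words_over_append)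
next
  fix x assume "x \<in> carrier pres"
  then show "\<one>\<^bsub>pres\<^esub> \<otimes>\<^bsub>pres\<^esub> x = x"
    by (auto simp: presented_carrier presented_one presented_mult words_over_Nil)
next
  fix x assume "x \<in> carrier pres"
  then obtain w where w: "w \<in> words_over X" "x = cls w" by (auto simp: presented_carrier)
  have "cls (formal_inverse w) \<otimes>\<^bsub>pres\<^esub> x = cls (formal_inverse w @ w)"
    using w by (simp add: presented_mult words_over_formal_inverse)
  also have "\<dots> = \<one>\<^bsub>pres\<^esub>"
    using w formal_inverse_cancel word_class_eq_iff words_over_Nil words_over_append
      words_over_formal_inverse unfolding presented_one by metis
  finally show "\<exists>y\<in>carrier pres. y \<otimes>\<^bsub>pres\<^esub> x = \<one>\<^bsub>pres\<^esub>"
    using w words_over_formal_inverse by (auto simp: presented_carrier)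
qed

definition letter :: "'x \<Rightarrow> 'x gword set" where
  "letter x = cls [(x, False)]"

lemma letter_closed: "x \<in> X \<Longrightarrow> letter x \<in> carrier pres"
  by (simp add: letter_def presented_carrier words_over_Cons words_over_Nil)

lemma presented_rel:
  assumes "(l, r) \<in> R" "l \<in> words_over X" "r \<in> words_over X"
  shows "cls l = cls r"
  using pres_cong.rel[OF words_over_Nil words_over_Nil assms] word_class_eq_iff[OF assms(2,3)] by simp

lemma class_wpow: "x \<in> X \<Longrightarrow> cls (wpow x i) = letter x [^]\<^bsub>pres\<^esub> i"
proof (induction i)
  case 0
  then show ?case by (simp add: wpow_def presented_one nat_pow_def)
next
  case (Suc i)
  interpret group pres by (rule group_presented)
  have w: "wpow x i \<in> words_over X" "[(x, False)] \<in> words_over X"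
    using Suc.prems by (auto simp: wpow_def words_over_def)
  have "wpow x (Suc i) = wpow x i @ [(x, False)]" by (simp add: wpow_def replicate_append_same)
  then show ?case using Suc presented_mult[OF w] by (simp add: letter_def)
qed

lemma class_winv:
  assumes "x \<in> X"
  shows "cls (winv x) = inv\<^bsub>pres\<^esub> letter x"
proof -
  interpret group pres by (rule group_presented)
  have w: "winv x \<in> words_over X" "[(x, False)] \<in> words_over X"
    using assms by (auto simp: winv_def words_over_def)
  have "(winv x @ [(x, False)], []) \<in> pres_cong X R"
    using pres_cong.cancel[OF words_over_Nil words_over_Nil assms, of True R] by (simp add: winv_def)
  then have "cls (winv x @ [(x, False)]) = cls []"
    using word_class_eq_iff words_over_append[OF w] words_over_Nil by blast
  then have "cls (winv x) \<otimes>\<^bsub>pres\<^esub> letter x = \<one>\<^bsub>pres\<^esub>"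
    by (simp add: letter_def presented_mult w presented_one)
  then show ?thesis
    using letter_closed[OF assms] w by (intro inv_equality[symmetric]) (auto simp: presented_carrier)
qed

lemma word_wpow: "x \<in> X \<Longrightarrow> wpow x i \<in> words_over X"
  by (auto simp: wpow_def words_over_def)

lemma word_winv: "x \<in> X \<Longrightarrow> winv x \<in> words_over X"
  by (auto simp: winv_def words_over_def)

lemma word_wconj: "x \<in> X \<Longrightarrow> y \<in> X \<Longrightarrow> wconj x y \<in> words_over X"
  by (simp add: wconj_def word_winv word_wpow words_over_append)

lemma word_wcomm: "x \<in> X \<Longrightarrow> y \<in> X \<Longrightarrow> wcomm x y \<in> words_over X"
  by (simp add: wcomm_def word_winv word_wpow words_over_append)

lemma class_wconj:
  assumes "x \<in> X" "y \<in> X"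
  shows "cls (wconj x y) = inv\<^bsub>pres\<^esub> letter y \<otimes>\<^bsub>pres\<^esub> (letter x \<otimes>\<^bsub>pres\<^esub> letter y)"
proof -
  have "cls (wpow v 1) = letter v" for v by (simp add: wpow_def letter_def)
  then show ?thesis
    unfolding wconj_def using assms
    by (simp only: presented_mult[symmetric] word_winv word_wpow words_over_append class_winv)
qed

lemma class_wcomm:
  assumes "x \<in> X" "y \<in> X"
  shows "cls (wcomm x y) =
    inv\<^bsub>pres\<^esub> letter x \<otimes>\<^bsub>pres\<^esub> (inv\<^bsub>pres\<^esub> letter y \<otimes>\<^bsub>pres\<^esub> (letter x \<otimes>\<^bsub>pres\<^esub> letter y))"
  unfolding wcomm_def wconj_def[symmetric] using assms
  by (simp only: presented_mult[symmetric] word_winv word_wconj class_winv class_wconj)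

lemma presented_induct:
  assumes "\<one>\<^bsub>pres\<^esub> \<in> S"
    and "\<And>x s. x \<in> X \<Longrightarrow> s \<in> S \<Longrightarrow> letter x \<otimes>\<^bsub>pres\<^esub> s \<in> S"
    and "\<And>x s. x \<in> X \<Longrightarrow> s \<in> S \<Longrightarrow> inv\<^bsub>pres\<^esub> letter x \<otimes>\<^bsub>pres\<^esub> s \<in> S"
  shows "carrier pres \<subseteq> S"
proof -
  have "cls w \<in> S" if "w \<in> words_over X" for w
    using that
  proof (induction w)
    case Nil
    then show ?case using assms(1) by (simp add: presented_one)
  next
    case (Cons l w)
    obtain x e where l: "l = (x, e)" by (cases l)
    have x: "x \<in> X" "w \<in> words_over X" using Cons.prems by (simp_all add: l words_over_Cons)
    have "cls (l # w) = cls [l] \<otimes>\<^bsub>pres\<^esub> cls w"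
      using presented_mult[of "[l]" w] x by (simp add: l words_over_Cons words_over_Nil)
    moreover have "cls [l] = (if e then inv\<^bsub>pres\<^esub> letter x else letter x)"
      using class_winv[OF x(1)] by (simp add: l letter_def winv_def)
    ultimately show ?case using assms(2,3)[OF x(1)] Cons.IH[OF x(2)] by simp
  qed
  then show ?thesis by (auto simp: presented_carrier)
qed

end

definition (in monoid) eval_word :: "('x \<Rightarrow> 'a) \<Rightarrow> 'x gword \<Rightarrow> 'a" where
  "eval_word f w = foldr (\<lambda>(x, e) g. (if e then inv (f x) else f x) \<otimes> g) w \<one>"

context group
begin

lemma eval_word_closed:
  assumes "\<And>x. x \<in> X \<Longrightarrow> f x \<in> carrier G" "w \<in> words_over X"
  shows "eval_word f w \<in> carrier G"
  using assms(2) by (induction w) (auto simp: eval_word_def words_over_Cons assms(1))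

lemma eval_word_append:
  assumes f: "\<And>x. x \<in> X \<Longrightarrow> f x \<in> carrier G" and "u \<in> words_over X" "v \<in> words_over X"
  shows "eval_word f (u @ v) = eval_word f u \<otimes> eval_word f v"
  using assms(2)
proof (induction u)
  case Nil
  then show ?case using eval_word_closed[OF f assms(3)] by (simp add: eval_word_def)
next
  case (Cons l u)
  obtain x e where l: "l = (x, e)" by (cases l)
  have x: "x \<in> X" "u \<in> words_over X" using Cons.prems by (simp_all add: l words_over_Cons)
  have "eval_word f ((x, e) # w) = (if e then inv (f x) else f x) \<otimes> eval_word f w" for w
    by (simp add: eval_word_def)
  then show ?case
    using Cons.IH[OF x(2)] f[OF x(1)] eval_word_closed[OF f x(2)] eval_word_closed[OF f assms(3)]
    by (simp add: l m_assoc)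
qed

lemma eval_wpow: "f x \<in> carrier G \<Longrightarrow> eval_word f (wpow x i) = f x [^] i"
proof (induction i)
  case (Suc i)
  then show ?case using nat_pow_Suc2[of "f x" i] by (simp add: eval_word_def wpow_def)
qed (simp add: eval_word_def wpow_def)

lemma eval_winv: "f x \<in> carrier G \<Longrightarrow> eval_word f (winv x) = inv (f x)"
  by (simp add: eval_word_def winv_def)

lemma eval_wconj:
  "f x \<in> carrier G \<Longrightarrow> f y \<in> carrier G \<Longrightarrow> eval_word f (wconj x y) = inv (f y) \<otimes> (f x \<otimes> f y)"
  by (simp add: eval_word_def wconj_def winv_def wpow_def)

lemma eval_wcomm:
  "f x \<in> carrier G \<Longrightarrow> f y \<in> carrier G \<Longrightarrow>
    eval_word f (wcomm x y) = inv (f x) \<otimes> (inv (f y) \<otimes> (f x \<otimes> f y))"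
  by (simp add: eval_word_def wcomm_def winv_def wpow_def)

lemma eval_word_cong:
  assumes f: "\<And>x. x \<in> X \<Longrightarrow> f x \<in> carrier G"
    and R: "\<And>l r. (l, r) \<in> R \<Longrightarrow> eval_word f l = eval_word f r"
    and "(u, v) \<in> pres_cong X R"
  shows "eval_word f u = eval_word f v"
  using assms(3)
proof (induction rule: pres_cong.induct)
  case (cancel us vs x e)
  have "eval_word f ([(x, e), (x, \<not> e)] @ vs) = eval_word f vs"
    using f[OF cancel(3)] eval_word_closed[OF f cancel(2)]
    by (cases e) (simp_all add: eval_word_def m_assoc[symmetric])
  moreover have "[(x, e), (x, \<not> e)] @ vs \<in> words_over X"
    using cancel by (simp add: words_over_Cons)
  ultimately show ?case
    by (simp only: eval_word_append[OF f cancel(1)] cancel(2))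
next
  case (rel us vs l r)
  then show ?case
    by (simp only: eval_word_append[OF f] words_over_append R[OF rel(3)])
qed auto

text \<open>Von Dyck: evaluation descends to the presented group.\<close>

lemma card_le_presented:
  assumes f: "\<And>x. x \<in> X \<Longrightarrow> f x \<in> carrier G"
    and R: "\<And>l r. (l, r) \<in> R \<Longrightarrow> eval_word f l = eval_word f r"
    and surj: "carrier G \<subseteq> eval_word f ` words_over X"
    and fin: "finite (carrier (presented_group X R))"
  shows "card (carrier G) \<le> card (carrier (presented_group X R))"
proof (rule surj_card_le[OF fin])
  \<comment> \<open>Evaluation is constant on classes, so an arbitrary representative may be used;
    for the inequality only surjectivity matters.\<close>
  let ?h = "\<lambda>C. eval_word f (SOME w. w \<in> C)"
  show "carrier G \<subseteq> ?h ` carrier (presented_group X R)"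
  proof
    fix g assume "g \<in> carrier G"
    then obtain w where w: "w \<in> words_over X" "g = eval_word f w" using surj by blast
    have "w \<in> word_class X R w"
      unfolding word_class_def by (simp add: pres_cong.refl w(1))
    then have "(SOME w'. w' \<in> word_class X R w) \<in> word_class X R w" by (rule someI)
    then have "(w, SOME w'. w' \<in> word_class X R w) \<in> pres_cong X R" by (simp add: word_class_def)
    then have "g = ?h (word_class X R w)" using eval_word_cong[OF f R] w(2) by blast
    then show "g \<in> ?h ` carrier (presented_group X R)"
      using w(1) by (auto simp: presented_carrier)
  qed
qed

end

section \<open>Groups generated by two elements with central commutator of order two\<close>

text \<open>One normal form for all factors. \<open>M2 (n + 1) 1\<close> has parameters
  \<open>n, 1, 0\<close>, \<open>M2_1_1 (m + 1)\<close> has \<open>m + 1, 0, 0\<close>,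
  \<open>D8\<close> has \<open>1, 1, 0\<close> and \<open>Q8\<close> has \<open>1, 1, 1\<close>;
  \<open>z\<close> generates the derived subgroup.\<close>

locale heisenberg_relations = group +
  fixes a b z :: 'a and w \<alpha> \<beta> :: nat
  assumes a_closed: "a \<in> carrier G" and b_closed: "b \<in> carrier G" and z_closed: "z \<in> carrier G"
    and z_z: "z \<otimes> z = \<one>" and z_a: "z \<otimes> a = a \<otimes> z" and z_b: "z \<otimes> b = b \<otimes> z"
    and b_a: "b \<otimes> a = a \<otimes> b \<otimes> z"
    and a_pow: "a [^] (2 ^ w :: nat) = z [^] \<alpha>" and b_b: "b \<otimes> b = z [^] \<beta>"
    and w_pos: "w \<ge> 1"
begin

definition el :: "nat \<Rightarrow> nat \<Rightarrow> nat \<Rightarrow> 'a" where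
  "el i j k = a [^] i \<otimes> (b [^] j \<otimes> z [^] k)"

lemmas gen_closed = a_closed b_closed z_closed

lemma el_closed: "el i j k \<in> carrier G"
  by (simp add: el_def gen_closed)

lemma z_pow_a: "z [^] k \<otimes> a [^] i = a [^] i \<otimes> z [^] (k::nat)" for i :: nat
  by (rule group_commutes_pow[OF group_commutes_pow[OF z_a z_closed a_closed, symmetric]
        a_closed nat_pow_closed[OF z_closed], symmetric])

lemma z_pow_b: "z [^] k \<otimes> b [^] i = b [^] i \<otimes> z [^] (k::nat)" for i :: nat
  by (rule group_commutes_pow[OF group_commutes_pow[OF z_b z_closed b_closed, symmetric]
        b_closed nat_pow_closed[OF z_closed], symmetric])

lemma b_a_pow: "b \<otimes> a [^] i = a [^] i \<otimes> (b \<otimes> z [^] (i::nat))"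
proof (induction i)
  case (Suc i)
  have "b \<otimes> a [^] Suc i = b \<otimes> a [^] i \<otimes> a" by (simp add: gen_closed m_assoc)
  also have "\<dots> = a [^] i \<otimes> b \<otimes> (z [^] i \<otimes> a)" by (simp add: Suc.IH gen_closed m_assoc)
  also have "z [^] i \<otimes> a = a \<otimes> z [^] i" using z_pow_a[of i 1] by (simp add: gen_closed)
  also have "a [^] i \<otimes> b \<otimes> (a \<otimes> z [^] i) = a [^] i \<otimes> (b \<otimes> a) \<otimes> z [^] i" by (simp add: gen_closed m_assoc)
  also have "\<dots> = a [^] i \<otimes> a \<otimes> (b \<otimes> (z \<otimes> z [^] i))" by (simp add: b_a gen_closed m_assoc)
  also have "z \<otimes> z [^] i = z [^] Suc i" by (simp only: nat_pow_Suc2 z_closed)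
  finally show ?case by simp
qed (simp add: gen_closed)

lemma b_pow_a_pow: "b [^] j \<otimes> a [^] i = a [^] i \<otimes> (b [^] j \<otimes> z [^] (j * i))" for i j :: nat
proof (induction j)
  case (Suc j)
  have "b [^] Suc j \<otimes> a [^] i = b [^] j \<otimes> (b \<otimes> a [^] i)" by (simp add: gen_closed m_assoc)
  also have "\<dots> = (b [^] j \<otimes> a [^] i) \<otimes> (b \<otimes> z [^] i)" by (simp add: b_a_pow gen_closed m_assoc)
  also have "\<dots> = a [^] i \<otimes> b [^] j \<otimes> (z [^] (j * i) \<otimes> b) \<otimes> z [^] i"
    by (simp add: Suc.IH gen_closed m_assoc)
  also have "z [^] (j * i) \<otimes> b = b \<otimes> z [^] (j * i)" using z_pow_b[of "j * i" 1] by (simp add: gen_closed)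
  also have "a [^] i \<otimes> b [^] j \<otimes> (b \<otimes> z [^] (j * i)) \<otimes> z [^] i =
      a [^] i \<otimes> (b [^] j \<otimes> b \<otimes> (z [^] (j * i) \<otimes> z [^] i))"
    by (simp add: gen_closed m_assoc)
  finally show ?case by (simp add: gen_closed nat_pow_mult add.commute)
qed (simp add: gen_closed)

text \<open>Moving \<open>b [^] j\<close> past \<open>a [^] i'\<close> costs one factor
  \<open>z\<close> for each of the \<open>j * i'\<close> transpositions.\<close>

lemma el_mult: "el i j k \<otimes> el i' j' k' = el (i + i') (j + j') (k + k' + j * i')"
proof -
  have zb: "z [^] k \<otimes> (b [^] j' \<otimes> x) = b [^] j' \<otimes> (z [^] k \<otimes> x)"
    if "x \<in> carrier G" for x and k j' :: nat
    using that by (simp add: m_assoc[symmetric] gen_closed z_pow_b)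
  have za: "z [^] k \<otimes> (a [^] i' \<otimes> x) = a [^] i' \<otimes> (z [^] k \<otimes> x)"
    if "x \<in> carrier G" for x and k i' :: nat
    using that by (simp add: m_assoc[symmetric] gen_closed z_pow_a)
  have ba: "b [^] j \<otimes> (a [^] i' \<otimes> x) = a [^] i' \<otimes> (b [^] j \<otimes> (z [^] (j * i') \<otimes> x))"
    if "x \<in> carrier G" for x and j i' :: nat
  proof -
    have "b [^] j \<otimes> (a [^] i' \<otimes> x) = (b [^] j \<otimes> a [^] i') \<otimes> x" using that by (simp add: m_assoc gen_closed)
    then show ?thesis using that by (simp add: b_pow_a_pow m_assoc gen_closed)
  qed
  have pw: "x [^] (m + n) \<otimes> y = x [^] m \<otimes> (x [^] n \<otimes> y)"
    if "x \<in> carrier G" "y \<in> carrier G" for x y and m n :: nat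
    using that by (simp add: nat_pow_mult[symmetric] m_assoc)
  show ?thesis
    by (simp add: el_def m_assoc gen_closed zb za ba pw nat_pow_mult[symmetric] z_pow_b z_pow_a)
       (simp add: gen_closed nat_pow_mult add_ac)
qed

lemma el_one: "el 0 0 0 = \<one>"
  by (simp add: el_def)

lemma el_a: "el i 0 0 = a [^] i" and el_b: "el 0 j 0 = b [^] j" and el_z: "el 0 0 k = z [^] k"
  by (simp_all add: el_def gen_closed)

lemma a_eq_el: "a = el 1 0 0" and b_eq_el: "b = el 0 1 0" and z_eq_el: "z = el 0 0 1"
  by (simp_all add: el_def gen_closed)

lemma z_pow_mod: "z [^] k = z [^] (k mod 2)" for k :: nat
proof -
  have "z [^] (2 * (k div 2)) = \<one>"
    using nat_pow_pow[OF z_closed, of 2 "k div 2"] z_z z_closed by (simp add: numeral_2_eq_2)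
  then show ?thesis
    using nat_pow_mult[OF z_closed, of "2 * (k div 2)" "k mod 2"] z_closed by simp
qed

text \<open>Overflow in the exponents of \<open>a\<close> and \<open>b\<close> is carried into that
  of \<open>z\<close> through the two power relations.\<close>

definition reduce :: "nat \<times> nat \<times> nat \<Rightarrow> nat \<times> nat \<times> nat" where
  "reduce = (\<lambda>(i, j, k). (i mod 2 ^ w, j mod 2, (k + \<alpha> * (i div 2 ^ w) + \<beta> * (j div 2)) mod 2))"

abbreviation elt :: "nat \<times> nat \<times> nat \<Rightarrow> 'a" where
  "elt \<equiv> \<lambda>(i, j, k). el i j k"

lemma el_reduce: "el i j k = elt (reduce (i, j, k))"
proof -
  have "a [^] i = a [^] (2 ^ w * (i div 2 ^ w) + i mod 2 ^ w)" by simp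
  also have "\<dots> = (a [^] (2 ^ w :: nat)) [^] (i div 2 ^ w) \<otimes> a [^] (i mod 2 ^ w)"
    unfolding nat_pow_pow[OF a_closed] by (simp only: nat_pow_mult a_closed)
  also have "\<dots> = el 0 0 (\<alpha> * (i div 2 ^ w)) \<otimes> el (i mod 2 ^ w) 0 0"
    by (simp add: a_pow nat_pow_pow el_a el_z z_closed)
  also have "\<dots> = el (i mod 2 ^ w) 0 (\<alpha> * (i div 2 ^ w))" by (simp add: el_mult)
  finally have 1: "a [^] i = el (i mod 2 ^ w) 0 (\<alpha> * (i div 2 ^ w))" .
  have "b [^] j = b [^] (2 * (j div 2) + j mod 2)" by simp
  also have "\<dots> = (b [^] (2::nat)) [^] (j div 2) \<otimes> b [^] (j mod 2)"
    unfolding nat_pow_pow[OF b_closed] by (simp only: nat_pow_mult b_closed)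
  also have "b [^] (2::nat) = z [^] \<beta>" using b_b b_closed by (simp add: numeral_2_eq_2)
  also have "(z [^] \<beta>) [^] (j div 2) \<otimes> b [^] (j mod 2) = el 0 0 (\<beta> * (j div 2)) \<otimes> el 0 (j mod 2) 0"
    by (simp add: nat_pow_pow el_b el_z z_closed)
  also have "\<dots> = el 0 (j mod 2) (\<beta> * (j div 2))" by (simp add: el_mult)
  finally have 2: "b [^] j = el 0 (j mod 2) (\<beta> * (j div 2))" .
  have "el i j k = a [^] i \<otimes> (b [^] j \<otimes> el 0 0 k)" by (simp add: el_def gen_closed)
  also have "\<dots> = el (i mod 2 ^ w) (j mod 2) (k + \<alpha> * (i div 2 ^ w) + \<beta> * (j div 2))"
    unfolding 1 2 el_mult by (simp add: add_ac)
  also have "\<dots> = elt (reduce (i, j, k))"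
    unfolding el_def reduce_def by (simp add: z_pow_mod[of "k + _ + _"])
  finally show ?thesis .
qed

abbreviation grid :: "(nat \<times> nat \<times> nat) set" where
  "grid \<equiv> {..<2 ^ w} \<times> {..<2} \<times> {..<2}"

lemma reduce_grid: "reduce t \<in> grid"
  by (auto simp: reduce_def split: prod.split)

lemma range_el: "{el i j k | i j k. True} = elt ` grid"
proof
  show "{el i j k | i j k. True} \<subseteq> elt ` grid" using el_reduce reduce_grid by blast
qed auto

lemma card_grid: "card grid = 2 ^ (w + 2)"
  by (simp add: card_cartesian_product)

lemma conj_ab: "inv b \<otimes> (a \<otimes> b) = a \<otimes> z"
proof -
  have "b \<otimes> (a \<otimes> z) = a \<otimes> b \<otimes> (z \<otimes> z)"
    using b_a gen_closed by (simp add: m_assoc[symmetric])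
  then have "a \<otimes> b = b \<otimes> (a \<otimes> z)" using gen_closed by (simp add: z_z)
  then show ?thesis using gen_closed by (simp add: m_assoc[symmetric])
qed

lemma commutator_ab: "inv a \<otimes> (inv b \<otimes> (a \<otimes> b)) = z"
  using gen_closed by (simp add: conj_ab m_assoc[symmetric])

lemma a_pow_order: "a [^] (2 * 2 ^ w :: nat) = \<one>"
proof -
  have "a [^] (2 * 2 ^ w :: nat) = el (2 * 2 ^ w) 0 0" by (simp add: el_a)
  also have "\<dots> = elt (reduce (2 * 2 ^ w, 0, 0))" by (rule el_reduce)
  also have "\<dots> = \<one>" by (simp add: reduce_def el_one)
  finally show ?thesis .
qed

lemma range_el_closed:
  assumes "x \<in> {a, b, z}" "s \<in> {el i j k | i j k. True}"
  shows "x \<otimes> s \<in> {el i j k | i j k. True}" "inv x \<otimes> s \<in> {el i j k | i j k. True}"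
proof -
  have mult: "u \<otimes> v \<in> {el i j k | i j k. True}"
    if uv: "u \<in> {el i j k | i j k. True}" "v \<in> {el i j k | i j k. True}" for u v
  proof -
    obtain i j k i' j' k' where "u = el i j k" "v = el i' j' k'" using uv by blast
    then have "u \<otimes> v = el (i + i') (j + j') (k + k' + j * i')" by (simp only: el_mult)
    then show ?thesis by blast
  qed
  have "x \<in> {el i j k | i j k. True}" using assms(1) a_eq_el b_eq_el z_eq_el by blast
  then show "x \<otimes> s \<in> {el i j k | i j k. True}" using assms(2) by (rule mult)
  \<comment> \<open>Exponents are natural numbers, so inverses are written as positive powers. The
    exponent uses \<open>2 * 2 ^ w\<close>, because \<open>a [^] 2 ^ w\<close> may be
    \<open>z\<close>.\<close>
  have "inv a = el (2 * 2 ^ w - 1) 0 0"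
  proof (rule inv_equality)
    have "el (2 * 2 ^ w - 1) 0 0 \<otimes> el 1 0 0 = el (2 * 2 ^ w - 1 + 1) 0 0"
      unfolding el_mult by simp
    then have "el (2 * 2 ^ w - 1) 0 0 \<otimes> a = el (2 * 2 ^ w - 1 + 1) 0 0"
      by (simp only: a_eq_el[symmetric])
    also have "2 * 2 ^ w - 1 + 1 = 2 * (2::nat) ^ w" by simp
    finally show "el (2 * 2 ^ w - 1) 0 0 \<otimes> a = \<one>" by (simp only: el_a a_pow_order)
  qed (simp_all add: gen_closed el_closed)
  moreover have "inv b = el 0 3 0"
  proof (rule inv_equality)
    have "el 0 3 0 \<otimes> el 0 1 0 = el 0 4 0" unfolding el_mult by simp
    then have "el 0 3 0 \<otimes> b = el 0 4 0" by (simp only: b_eq_el[symmetric])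
    also have "\<dots> = elt (reduce (0, 4, 0))" by (rule el_reduce)
    also have "\<dots> = \<one>" by (simp add: reduce_def el_one)
    finally show "el 0 3 0 \<otimes> b = \<one>" .
  qed (simp_all add: gen_closed el_closed)
  moreover have "inv z = el 0 0 1"
    using z_z z_closed by (simp only: z_eq_el[symmetric]) (rule inv_equality)
  ultimately have inv: "inv a = el (2 * 2 ^ w - 1) 0 0" "inv b = el 0 3 0" "inv z = el 0 0 1"
    by blast+
  then have "inv x \<in> {el i j k | i j k. True}" using assms(1) inv by blast
  then show "inv x \<otimes> s \<in> {el i j k | i j k. True}" using assms(2) by (rule mult)
qed

end

text \<open>Spanning together with the full order makes the reduced normal form unique: the
  relations have not collapsed.\<close>

locale heisenberg_group = heisenberg_relations +
  assumes spans: "carrier G = {el i j k | i j k. True}" and card_carrier: "card (carrier G) = 2 ^ (w + 2)"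
begin

lemma elt_inj: "inj_on elt grid"
  using card_carrier card_grid unfolding spans range_el by (intro eq_card_imp_inj_on) auto

lemma el_eq_iff: "el i j k = el i' j' k' \<longleftrightarrow> reduce (i, j, k) = reduce (i', j', k')"
  unfolding el_reduce[of i j k] el_reduce[of i' j' k']
  using elt_inj reduce_grid by (metis inj_onD)

lemma finite_carrier: "finite (carrier G)"
  using card_carrier by (intro card_ge_0_finite) simp

end

subsection \<open>A model on triples\<close>

locale heisenberg_model =
  fixes w \<alpha> \<beta> :: nat
  assumes w_pos: "w \<ge> 1"
begin

text \<open>The product before reduction, associative on all triples. Since reducing a factor
  beforehand does not affect the reduced result, the model inherits associativity.\<close>

fun hmul :: "nat \<times> nat \<times> nat \<Rightarrow> nat \<times> nat \<times> nat \<Rightarrow> nat \<times> nat \<times> nat" where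
  "hmul (i, j, k) (i', j', k') = (i + i', j + j', k + k' + j * i')"

fun red :: "nat \<times> nat \<times> nat \<Rightarrow> nat \<times> nat \<times> nat" where
  "red (i, j, k) = (i mod 2 ^ w, j mod 2, (k + \<alpha> * (i div 2 ^ w) + \<beta> * (j div 2)) mod 2)"

definition model :: "(nat \<times> nat \<times> nat) monoid" where
  "model = \<lparr>carrier = {..<2 ^ w} \<times> {..<2} \<times> {..<2}, monoid.mult = (\<lambda>x y. red (hmul x y)), one = (0, 0, 0)\<rparr>"

lemma div_mod_add: "(i::nat) div n + (i mod n + j) div n = (i + j) div n" if "n > 0"
proof -
  have "(n * (i div n) + (i mod n + j)) div n = i div n + (i mod n + j) div n"
    by (rule div_mult_self4) (use that in simp)
  then show ?thesis by (simp only: add.assoc[symmetric] mult_div_mod_eq)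
qed

lemma red_left: "red (hmul (red x) y) = red (hmul x y)"
proof (cases x; cases y)
  fix i j k i' j' k' assume xy: "x = (i, j, k)" "y = (i', j', k')"
  let ?N = "2 ^ w :: nat"
  have d: "(i + i') div ?N = i div ?N + (i mod ?N + i') div ?N"
    "(j + j') div 2 = j div 2 + (j mod 2 + j') div 2"
    by (simp_all only: div_mod_add zero_less_power zero_less_numeral)
  let ?K = "k + \<alpha> * (i div ?N) + \<beta> * (j div 2)"
  have "(?K mod 2 + k' + (j mod 2) * i' + \<alpha> * ((i mod ?N + i') div ?N) + \<beta> * ((j mod 2 + j') div 2)) mod 2
      = (?K + k' + j * i' + \<alpha> * ((i mod ?N + i') div ?N) + \<beta> * ((j mod 2 + j') div 2)) mod 2"
    by (intro mod_add_cong mod_mult_cong) simp_all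
  also have "\<dots> = (k + k' + j * i' + \<alpha> * ((i + i') div ?N) + \<beta> * ((j + j') div 2)) mod 2"
    unfolding d by (simp add: algebra_simps)
  finally show ?thesis by (simp add: xy mod_add_left_eq)
qed

lemma red_right: "red (hmul x (red y)) = red (hmul x y)"
proof (cases x; cases y)
  fix i j k i' j' k' assume xy: "x = (i, j, k)" "y = (i', j', k')"
  let ?N = "2 ^ w :: nat"
  have d: "(i + i') div ?N = i' div ?N + (i + i' mod ?N) div ?N"
    "(j + j') div 2 = j' div 2 + (j + j' mod 2) div 2"
    using div_mod_add[of ?N i' i] div_mod_add[of 2 j' j] by (simp_all add: add.commute)
  \<comment> \<open>The cross term \<open>j * i'\<close> depends on \<open>i'\<close> modulo 2,
    which survives reduction modulo \<open>2 ^ w\<close> because \<open>w\<close> is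
    positive.\<close>
  have "even ?N" using w_pos by simp
  then have "(i' mod ?N) mod 2 = i' mod 2" by (rule mod_mod_cancel)
  let ?K = "k' + \<alpha> * (i' div ?N) + \<beta> * (j' div 2)"
  have "(k + ?K mod 2 + j * (i' mod ?N) + \<alpha> * ((i + i' mod ?N) div ?N) + \<beta> * ((j + j' mod 2) div 2)) mod 2
      = (k + ?K + j * i' + \<alpha> * ((i + i' mod ?N) div ?N) + \<beta> * ((j + j' mod 2) div 2)) mod 2"
    using \<open>(i' mod ?N) mod 2 = i' mod 2\<close> by (intro mod_add_cong mod_mult_cong) simp_all
  also have "\<dots> = (k + k' + j * i' + \<alpha> * ((i + i') div ?N) + \<beta> * ((j + j') div 2)) mod 2"
    unfolding d by (simp add: algebra_simps)
  finally show ?thesis by (simp add: xy mod_add_right_eq)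
qed

lemma hmul_assoc: "hmul (hmul x y) t = hmul x (hmul y t)"
  by (cases x; cases y; cases t) (simp add: algebra_simps)

lemma red_id: "x \<in> carrier model \<Longrightarrow> red x = x"
  by (cases x) (auto simp: model_def)

lemma red_closed: "red x \<in> carrier model"
  by (cases x) (auto simp: model_def)

lemma model_mult: "x \<otimes>\<^bsub>model\<^esub> y = red (hmul x y)" and model_one: "\<one>\<^bsub>model\<^esub> = (0, 0, 0)"
  by (simp_all add: model_def)

lemma group_model: "group model"
proof (rule groupI)
  fix x assume x: "x \<in> carrier model"
  obtain i j k where xe: "x = (i, j, k)" by (cases x)
  have ij: "i \<le> 2 ^ w" "j \<le> 2" using x by (auto simp: xe model_def)
  \<comment> \<open>The last coordinate repeats \<open>k\<close>, the cross term and both carries,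
    so that each of them occurs twice in the product and vanishes modulo 2.\<close>
  have "red (hmul (red (2 ^ w - i, 2 - j, k + (2 - j) * i + \<alpha> + \<beta>)) x) = (0, 0, 0)"
    using ij unfolding red_left xe by (simp add: mod_eq_0_iff_dvd) argo
  then show "\<exists>y\<in>carrier model. y \<otimes>\<^bsub>model\<^esub> x = \<one>\<^bsub>model\<^esub>"
    unfolding model_mult model_one using red_closed by blast
next
  fix x y t assume "x \<in> carrier model" "y \<in> carrier model" "t \<in> carrier model"
  show "x \<otimes>\<^bsub>model\<^esub> y \<otimes>\<^bsub>model\<^esub> t = x \<otimes>\<^bsub>model\<^esub> (y \<otimes>\<^bsub>model\<^esub> t)"
    by (simp add: model_mult red_left red_right hmul_assoc)
next
  fix x assume "x \<in> carrier model"
  then show "\<one>\<^bsub>model\<^esub> \<otimes>\<^bsub>model\<^esub> x = x"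
  proof -
    have "hmul (0, 0, 0) x = x" by (cases x) simp
    then show ?thesis using red_id[OF \<open>x \<in> carrier model\<close>] by (simp only: model_mult model_one)
  qed
qed (auto simp: model_mult red_closed, simp add: model_def)

lemma model_pow:
  "(1, 0, 0) [^]\<^bsub>model\<^esub> n = red (n, 0, 0)" "(0, 1, 0) [^]\<^bsub>model\<^esub> n = red (0, n, 0)"
  "(0, 0, 1) [^]\<^bsub>model\<^esub> n = red (0, 0, n)" for n :: nat
proof -
  interpret group model by (rule group_model)
  show "(1, 0, 0) [^]\<^bsub>model\<^esub> n = red (n, 0, 0)"
    by (induction n) (simp_all add: model_mult model_one red_left del: red.simps, simp)
  show "(0, 1, 0) [^]\<^bsub>model\<^esub> n = red (0, n, 0)"
    by (induction n) (simp_all add: model_mult model_one red_left del: red.simps, simp)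
  show "(0, 0, 1) [^]\<^bsub>model\<^esub> n = red (0, 0, n)"
    by (induction n) (simp_all add: model_mult model_one red_left del: red.simps, simp)
qed

sublocale M: heisenberg_relations model "(1, 0, 0)" "(0, 1, 0)" "(0, 0, 1)" w \<alpha> \<beta>
proof (intro heisenberg_relations.intro group_model heisenberg_relations_axioms.intro)
  have "1 < (2::nat) ^ w" using w_pos by (intro one_less_power) auto
  then show "(1, 0, 0) \<in> carrier model" by (simp add: model_def)
  show "(0, 1, 0) \<otimes>\<^bsub>model\<^esub> (1, 0, 0) =
      (1, 0, 0) \<otimes>\<^bsub>model\<^esub> (0, 1, 0) \<otimes>\<^bsub>model\<^esub> (0, 0, 1)"
    unfolding model_mult red_left by simp
  show "(1, 0, 0) [^]\<^bsub>model\<^esub> (2 ^ w :: nat) = (0, 0, 1) [^]\<^bsub>model\<^esub> \<alpha>"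
    unfolding model_pow by simp
  show "(0, 1, 0) \<otimes>\<^bsub>model\<^esub> (0, 1, 0) = (0, 0, 1) [^]\<^bsub>model\<^esub> \<beta>"
    unfolding model_pow model_mult by simp
qed (use w_pos in \<open>simp_all add: model_mult model_one\<close>, simp_all add: model_def)

lemma model_el: "M.el i j k = red (i, j, k)"
  unfolding M.el_def model_pow model_mult red_left red_right by simp

end

context heisenberg_relations
begin

lemma a_pow_eq: "a [^] (1 + 2 ^ w :: nat) = a \<otimes> z [^] \<alpha>"
proof -
  have "a [^] (1 + 2 ^ w :: nat) = a [^] (1::nat) \<otimes> a [^] (2 ^ w :: nat)"
    by (rule nat_pow_mult[OF a_closed, symmetric])
  then show ?thesis by (simp add: a_pow a_closed)
qed

lemma inv_a:
  assumes "w = 1" "\<alpha> = 1"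
  shows "inv a = a \<otimes> z"
proof (rule inv_equality)
  have "a \<otimes> a = z" using a_pow assms gen_closed by (simp add: numeral_2_eq_2)
  then show "a \<otimes> z \<otimes> a = \<one>" using z_a z_z gen_closed by (simp add: m_assoc) (simp add: m_assoc[symmetric])
qed (simp_all add: gen_closed)

end

lemma (in group) conj_pow:
  fixes n :: nat
  assumes "x \<in> carrier G" "y \<in> carrier G"
  shows "(inv y \<otimes> (x \<otimes> y)) [^] n = inv y \<otimes> (x [^] n \<otimes> y)"
proof (induction n)
  case (Suc n)
  have "(inv y \<otimes> (x \<otimes> y)) [^] Suc n = inv y \<otimes> (x [^] n \<otimes> (y \<otimes> inv y) \<otimes> (x \<otimes> y))"
    using assms Suc by (simp only: nat_pow_Suc m_assoc m_closed inv_closed nat_pow_closed)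
  then show ?case using assms by (simp add: m_assoc)
qed (use assms in simp)

text \<open>The hypotheses say only how \<open>b\<close> conjugates \<open>a\<close>; that
  \<open>z\<close>, a power of \<open>a\<close>, also commutes with \<open>b\<close> is derived by
  raising this relation to the power \<open>2 ^ w\<close>.\<close>

lemma (in group) heisenberg_relations_of_conj:
  assumes "a \<in> carrier G" "b \<in> carrier G" "w \<ge> 1"
    and ord: "a [^] (2 * 2 ^ w :: nat) = \<one>" and conj: "inv b \<otimes> (a \<otimes> b) = a [^] (1 + 2 ^ w :: nat)"
    and b: "b \<otimes> b = (a [^] (2 ^ w :: nat)) [^] \<beta>"
  shows "heisenberg_relations G a b (a [^] (2 ^ w :: nat)) w 1 \<beta>"
proof -
  define z where "z = a [^] (2 ^ w :: nat)"
  have cl: "a \<in> carrier G" "b \<in> carrier G" "z \<in> carrier G" using assms by (simp_all add: z_def)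
  have zz: "z \<otimes> z = \<one>" using ord assms(1) by (simp add: z_def nat_pow_mult mult_2)
  have za: "z \<otimes> a = a \<otimes> z" using group_commutes_pow[of a a] assms(1) by (simp add: z_def)
  have conj_z: "inv b \<otimes> (a \<otimes> b) = a \<otimes> z"
    using conj nat_pow_mult[OF assms(1), of 1 "2 ^ w"] assms(1) by (simp add: z_def)
  obtain v where v: "w = Suc v" using \<open>w \<ge> 1\<close> by (cases w) auto
  have "inv b \<otimes> (z \<otimes> b) = (a [^] (1 + 2 ^ w :: nat)) [^] (2 ^ w :: nat)"
    unfolding z_def conj_pow[OF assms(1,2), symmetric] conj ..
  also have "\<dots> = a [^] (2 ^ w + 2 * 2 ^ w * 2 ^ v :: nat)"
    \<comment> \<open>The exponent is \<open>(1 + 2 ^ w) * 2 ^ w\<close>; its excess over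
      \<open>2 ^ w\<close> is \<open>2 ^ v\<close> times \<open>2 * 2 ^ w\<close>, a power at which
      \<open>a\<close> is trivial.\<close>
    unfolding nat_pow_pow[OF assms(1)] by (simp add: v algebra_simps)
  also have "\<dots> = z \<otimes> (a [^] (2 * 2 ^ w :: nat)) [^] (2 ^ v :: nat)"
    unfolding nat_pow_pow[OF assms(1)] z_def by (rule nat_pow_mult[OF assms(1), symmetric])
  also have "\<dots> = z" using cl by (simp add: ord)
  finally have "b \<otimes> (inv b \<otimes> (z \<otimes> b)) = b \<otimes> z" by simp
  then have zb: "z \<otimes> b = b \<otimes> z" using cl by (simp add: m_assoc[symmetric])
  have "b \<otimes> (inv b \<otimes> (a \<otimes> b)) = b \<otimes> (a \<otimes> z)" by (simp only: conj_z)
  then have ab: "a \<otimes> b = b \<otimes> a \<otimes> z" using cl by (simp add: m_assoc[symmetric])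
  have "b \<otimes> a = b \<otimes> a \<otimes> (z \<otimes> z)" using cl by (simp add: zz)
  also have "\<dots> = a \<otimes> b \<otimes> z" unfolding ab using cl by (simp add: m_assoc)
  finally have ba: "b \<otimes> a = a \<otimes> b \<otimes> z" .
  have "heisenberg_relations G a b z w 1 \<beta>"
    by unfold_locales (use cl zz za zb ba b assms(3) in \<open>simp_all add: z_def\<close>)
  then show ?thesis by (simp add: z_def)
qed

section \<open>The presented factors compared with the model\<close>

definition model_gen :: "gen \<Rightarrow> nat \<times> nat \<times> nat" where
  "model_gen x = (case x of Ga \<Rightarrow> (1, 0, 0) | Gb \<Rightarrow> (0, 1, 0) | Gd \<Rightarrow> (0, 0, 1))"

lemma (in monoid) nat_pow_one1: "x \<in> carrier G \<Longrightarrow> x [^] (1::nat) = x"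
  by simp

context heisenberg_model
begin

lemma model_gen_closed: "model_gen x \<in> carrier model"
  using M.gen_closed by (cases x) (simp_all only: model_gen_def gen.case)

lemma eval_gens:
  "M.eval_word model_gen (wpow Ga i) = (1, 0, 0) [^]\<^bsub>model\<^esub> i"
  "M.eval_word model_gen (wpow Gb i) = (0, 1, 0) [^]\<^bsub>model\<^esub> i"
  "M.eval_word model_gen (wpow Gd i) = (0, 0, 1) [^]\<^bsub>model\<^esub> i"
  "M.eval_word model_gen (winv Ga) = inv\<^bsub>model\<^esub> (1, 0, 0)"
  "M.eval_word model_gen (wconj Ga Gb) = (1, 0, 0) \<otimes>\<^bsub>model\<^esub> (0, 0, 1)"
  "M.eval_word model_gen (wcomm Ga Gb) = (0, 0, 1)"
  "M.eval_word model_gen (wcomm Gd Ga) = \<one>\<^bsub>model\<^esub>"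
  "M.eval_word model_gen (wcomm Gd Gb) = \<one>\<^bsub>model\<^esub>"
  "M.eval_word model_gen [] = \<one>\<^bsub>model\<^esub>"
proof -
  have g: "model_gen Ga = (1, 0, 0)" "model_gen Gb = (0, 1, 0)" "model_gen Gd = (0, 0, 1)"
    by (simp_all only: model_gen_def gen.case)
  note cl = model_gen_closed M.gen_closed
  show "M.eval_word model_gen (wpow Ga i) = (1, 0, 0) [^]\<^bsub>model\<^esub> i"
    "M.eval_word model_gen (wpow Gb i) = (0, 1, 0) [^]\<^bsub>model\<^esub> i"
    "M.eval_word model_gen (wpow Gd i) = (0, 0, 1) [^]\<^bsub>model\<^esub> i"
    "M.eval_word model_gen (winv Ga) = inv\<^bsub>model\<^esub> (1, 0, 0)"
    by (simp_all only: M.eval_wpow M.eval_winv cl g)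
  show "M.eval_word model_gen (wconj Ga Gb) = (1, 0, 0) \<otimes>\<^bsub>model\<^esub> (0, 0, 1)"
    by (simp only: M.eval_wconj cl g M.conj_ab)
  show "M.eval_word model_gen (wcomm Ga Gb) = (0, 0, 1)"
    unfolding M.eval_wcomm[of model_gen Ga Gb, OF cl(1,1)] g by (rule M.commutator_ab)
  have 1: "inv\<^bsub>model\<^esub> (0, 0, 1) \<otimes>\<^bsub>model\<^esub> (inv\<^bsub>model\<^esub> x \<otimes>\<^bsub>model\<^esub> ((0, 0, 1) \<otimes>\<^bsub>model\<^esub> x)) = \<one>\<^bsub>model\<^esub>"
    if x: "x \<in> carrier model" "(0, 0, 1) \<otimes>\<^bsub>model\<^esub> x = x \<otimes>\<^bsub>model\<^esub> (0, 0, 1)" for x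
    unfolding x(2) using x(1) M.z_closed by (simp add: M.m_assoc[symmetric])
  show "M.eval_word model_gen (wcomm Gd Ga) = \<one>\<^bsub>model\<^esub>"
    unfolding M.eval_wcomm[of model_gen Gd Ga, OF cl(1,1)] g by (rule 1[OF M.a_closed M.z_a])
  show "M.eval_word model_gen (wcomm Gd Gb) = \<one>\<^bsub>model\<^esub>"
    unfolding M.eval_wcomm[of model_gen Gd Gb, OF cl(1,1)] g by (rule 1[OF M.b_closed M.z_b])
  show "M.eval_word model_gen [] = \<one>\<^bsub>model\<^esub>" by (simp add: M.eval_word_def)
qed

lemma eval_surj:
  assumes X: "{Ga, Gb} \<subseteq> X"
  shows "carrier model \<subseteq> M.eval_word model_gen ` words_over X"
proof
  fix t assume t: "t \<in> carrier model"
  obtain i j k where ijk: "t = (i, j, k)" by (cases t)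
  have k: "k = 0 \<or> k = 1" using t by (auto simp: ijk model_def)
  \<comment> \<open>The central element is written as a commutator, because \<open>Gd\<close> need
    not be among the generators.\<close>
  let ?c = "if k = 0 then [] else wcomm Ga Gb"
  let ?w = "wpow Ga i @ (wpow Gb j @ ?c)"
  have w: "wpow Ga i \<in> words_over X" "wpow Gb j \<in> words_over X" "?c \<in> words_over X"
    using X by (auto intro: word_wpow word_wcomm simp: words_over_Nil)
  have "M.eval_word model_gen ?c = (0, 0, 1) [^]\<^bsub>model\<^esub> k"
    using k
  proof
    assume "k = 0"
    then show ?thesis by (simp only: eval_gens if_True M.nat_pow_0 simp_thms)
  next
    assume "k = 1"
    then show ?thesis using M.nat_pow_one1[OF M.z_closed] by (simp only: eval_gens if_False one_neq_zero)
  qed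
  then have "M.eval_word model_gen ?w = M.el i j k"
    unfolding M.eval_word_append[OF model_gen_closed w(1) words_over_append[OF w(2,3)]]
      M.eval_word_append[OF model_gen_closed w(2,3)] M.el_def eval_gens by (simp only:)
  also have "\<dots> = t" unfolding model_el using red_id[OF t] by (simp only: ijk)
  finally show "t \<in> M.eval_word model_gen ` words_over X"
    using words_over_append[OF w(1) words_over_append[OF w(2,3)]] by (rule image_eqI[OF HOL.sym])
qed

lemma card_model: "card (carrier model) = 2 ^ (w + 2)"
  by (simp add: model_def card_cartesian_product)

end

text \<open>The relations bound the order above by the number of reduced normal forms; evaluating
  words in the model bounds it below by the same number.\<close>

lemma heisenberg_presented:
  assumes X: "{Ga, Gb} \<subseteq> X"
    and rels: "heisenberg_relations (presented_group X R) (letter X R Ga) (letter X R Gb) z w \<alpha> \<beta>"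
    and Gd: "Gd \<in> X \<Longrightarrow> letter X R Gd = z"
    and R: "\<And>l r. (l, r) \<in> R \<Longrightarrow>
      monoid.eval_word (heisenberg_model.model w \<alpha> \<beta>) model_gen l =
      monoid.eval_word (heisenberg_model.model w \<alpha> \<beta>) model_gen r"
  shows "heisenberg_group (presented_group X R) (letter X R Ga) (letter X R Gb) z w \<alpha> \<beta>"
proof -
  let ?P = "presented_group X R"
  interpret H: heisenberg_relations ?P "letter X R Ga" "letter X R Gb" z w \<alpha> \<beta> by (rule rels)
  interpret L: heisenberg_model w \<alpha> \<beta> by unfold_locales (rule H.w_pos)
  let ?S = "{H.el i j k | i j k. True}"
  have letters: "letter X R x \<in> {letter X R Ga, letter X R Gb, z}" if "x \<in> X" for x
    using that Gd by (cases x) auto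
  have "carrier ?P \<subseteq> ?S"
  proof (rule presented_induct)
    show "\<one>\<^bsub>?P\<^esub> \<in> ?S" using H.el_one[symmetric] by blast
    show "letter X R x \<otimes>\<^bsub>?P\<^esub> s \<in> ?S" "inv\<^bsub>?P\<^esub> letter X R x \<otimes>\<^bsub>?P\<^esub> s \<in> ?S"
      if "x \<in> X" "s \<in> ?S" for x s
      using H.range_el_closed[OF letters[OF that(1)] that(2)] by blast+
  qed
  moreover have "?S \<subseteq> carrier ?P" using H.el_closed by blast
  ultimately have spans: "carrier ?P = ?S" by (rule equalityI)
  have fin: "finite (carrier ?P)" unfolding spans H.range_el by simp
  have "card (carrier ?P) \<le> card H.grid" unfolding spans H.range_el by (rule card_image_le) simp
  moreover have "card (carrier L.model) \<le> card (carrier ?P)"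
    by (rule L.M.card_le_presented[OF L.model_gen_closed R L.eval_surj[OF X] fin])
  ultimately have "card (carrier ?P) = 2 ^ (w + 2)" using H.card_grid L.card_model by simp
  then show ?thesis
    by (intro heisenberg_group.intro rels heisenberg_group_axioms.intro spans)
qed

lemma (in group) nat_pow_two: "x \<in> carrier G \<Longrightarrow> x [^] (2::nat) = x \<otimes> x"
  by (simp add: numeral_2_eq_2)

text \<open>Common source for \<open>M2\<close>, \<open>D8\<close> and \<open>Q8\<close>, where
  \<open>z\<close> is the power \<open>a [^] 2 ^ w\<close>. The alternative for \<open>t\<close>
  covers \<open>D8\<close> and \<open>Q8\<close>, presented with the inverse of \<open>a\<close>:
  for \<open>w = 1\<close> it equals \<open>a [^] 3\<close>.\<close>

lemma heisenberg_presented_conj: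
  fixes w \<beta> :: nat
  defines "X \<equiv> {Ga, Gb}"
  assumes w: "w \<ge> 1" and t: "t = wpow Ga (1 + 2 ^ w) \<or> w = 1 \<and> t = winv Ga"
    and R: "R = {(wpow Ga (2 * 2 ^ w), []), (wpow Gb 2, wpow Ga (2 ^ w * \<beta>)), (wconj Ga Gb, t)}"
  shows "\<exists>a b z. heisenberg_group (presented_group X R) a b z w 1 \<beta>"
proof -
  let ?P = "presented_group X R"
  interpret P: group ?P by (rule group_presented)
  interpret L: heisenberg_model w 1 \<beta> by unfold_locales (rule w)
  let ?a = "letter X R Ga" and ?b = "letter X R Gb"
  have X: "Ga \<in> X" "Gb \<in> X" by (simp_all add: X_def)
  have cl: "?a \<in> carrier ?P" "?b \<in> carrier ?P" using X by (simp_all add: letter_closed)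
  have tw: "t \<in> words_over X" using t X by (auto intro: word_wpow word_winv)
  have r1: "?a [^]\<^bsub>?P\<^esub> (2 * 2 ^ w :: nat) = \<one>\<^bsub>?P\<^esub>"
    using presented_rel[of "wpow Ga (2 * 2 ^ w)" "[]" R X] X word_wpow[OF X(1)]
    by (simp only: R insertI1 words_over_Nil class_wpow presented_one)
  have "(wpow Gb 2, wpow Ga (2 ^ w * \<beta>)) \<in> R" by (simp add: R)
  from presented_rel[OF this word_wpow[OF X(2)] word_wpow[OF X(1)]]
  have r2: "?b [^]\<^bsub>?P\<^esub> (2 :: nat) = ?a [^]\<^bsub>?P\<^esub> (2 ^ w * \<beta> :: nat)"
    by (simp only: class_wpow X)
  have "(wconj Ga Gb, t) \<in> R" by (simp add: R)
  from presented_rel[OF this word_wconj[OF X] tw]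
  have conj: "inv\<^bsub>?P\<^esub> ?b \<otimes>\<^bsub>?P\<^esub> (?a \<otimes>\<^bsub>?P\<^esub> ?b) = word_class X R t"
    by (simp only: class_wconj X)
  have r3: "word_class X R t = ?a [^]\<^bsub>?P\<^esub> (1 + 2 ^ w :: nat)"
    using t
  proof (elim disjE conjE)
    assume "w = 1" "t = winv Ga"
    then have "?a [^]\<^bsub>?P\<^esub> (4::nat) = \<one>\<^bsub>?P\<^esub>" using r1 by simp
    then have "?a [^]\<^bsub>?P\<^esub> (3::nat) \<otimes>\<^bsub>?P\<^esub> ?a = \<one>\<^bsub>?P\<^esub>"
      using P.nat_pow_Suc[of ?a 3] by simp
    then have "inv\<^bsub>?P\<^esub> ?a = ?a [^]\<^bsub>?P\<^esub> (3::nat)" using cl by (intro P.inv_equality) auto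
    moreover have "1 + 2 ^ w = (3::nat)" using \<open>w = 1\<close> by simp
    ultimately show ?thesis by (simp only: \<open>t = winv Ga\<close> class_winv X(1))
  qed (simp only: class_wpow X)
  have "heisenberg_relations ?P ?a ?b (?a [^]\<^bsub>?P\<^esub> (2 ^ w :: nat)) w 1 \<beta>"
    using r1 r2 conj r3 cl w
    by (intro P.heisenberg_relations_of_conj) (simp_all only: P.nat_pow_two P.nat_pow_pow)
  then have "heisenberg_group ?P ?a ?b (?a [^]\<^bsub>?P\<^esub> (2 ^ w :: nat)) w 1 \<beta>"
  proof (rule heisenberg_presented[rotated])
    fix l r assume "(l, r) \<in> R"
    then consider "l = wpow Ga (2 * 2 ^ w)" "r = []" | "l = wpow Gb 2" "r = wpow Ga (2 ^ w * \<beta>)"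
      | "l = wconj Ga Gb" "r = t"
      unfolding R by blast
    then show "L.M.eval_word model_gen l = L.M.eval_word model_gen r"
    proof cases
      case 1
      then show ?thesis by (simp only: L.eval_gens L.M.a_pow_order)
    next
      case 2
      have "(1, 0, 0) [^]\<^bsub>L.model\<^esub> (2 ^ w * \<beta>) = (0, 0, 1) [^]\<^bsub>L.model\<^esub> \<beta>"
        unfolding L.M.nat_pow_pow[OF L.M.a_closed, symmetric] L.M.a_pow
        by (simp only: L.M.nat_pow_one1 L.M.z_closed)
      then show ?thesis using 2 L.M.b_b by (simp only: L.eval_gens L.M.nat_pow_two[OF L.M.b_closed])
    next
      case 3
      have z1: "(0, 0, 1) [^]\<^bsub>L.model\<^esub> (1::nat) = (0, 0, 1)"
        by (rule L.M.nat_pow_one1[OF L.M.z_closed])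
      from t show ?thesis
      proof (elim disjE conjE)
        assume "t = wpow Ga (1 + 2 ^ w)"
        then show ?thesis using 3 by (simp only: L.eval_gens L.M.a_pow_eq z1)
      next
        assume w1: "w = 1" and tw: "t = winv Ga"
        show ?thesis unfolding 3 tw L.eval_gens L.M.inv_a[OF w1 HOL.refl] ..
      qed
    qed
  qed (use X in \<open>auto simp: X_def\<close>)
  then show ?thesis by blast
qed

lemma wpow_0: "wpow x 0 = []"
  by (simp add: wpow_def)

text \<open>Modulo the derived subgroup, generated by \<open>a [^] 2 ^ n\<close>, only
  \<open>2 ^ n\<close> powers of \<open>a\<close> remain; hence the parameter \<open>n\<close> and
  not \<open>n + 1\<close>.\<close>

lemma heisenberg_M2:
  assumes "n \<ge> 1"
  shows "\<exists>a b z. heisenberg_group (M2 (n + 1) 1) a b z n 1 0"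
proof -
  have "\<exists>a b z. heisenberg_group (presented_group {Ga, Gb}
      {(wpow Ga (2 * 2 ^ n), []), (wpow Gb 2, wpow Ga (2 ^ n * 0)), (wconj Ga Gb, wpow Ga (1 + 2 ^ n))})
      a b z n 1 0"
    using assms by (intro heisenberg_presented_conj) auto
  then show ?thesis by (simp add: M2_def wpow_0)
qed

lemma heisenberg_D8: "\<exists>a b z. heisenberg_group D8 a b z 1 1 0"
proof -
  have "\<exists>a b z. heisenberg_group (presented_group {Ga, Gb}
      {(wpow Ga (2 * 2 ^ 1), []), (wpow Gb 2, wpow Ga (2 ^ 1 * 0)), (wconj Ga Gb, winv Ga)}) a b z 1 1 0"
    by (intro heisenberg_presented_conj) auto
  then show ?thesis by (simp add: D8_def wpow_0)
qed

lemma heisenberg_Q8: "\<exists>a b z. heisenberg_group Q8 a b z 1 1 1"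
proof -
  have "\<exists>a b z. heisenberg_group (presented_group {Ga, Gb}
      {(wpow Ga (2 * 2 ^ 1), []), (wpow Gb 2, wpow Ga (2 ^ 1 * 1)), (wconj Ga Gb, winv Ga)}) a b z 1 1 1"
    by (intro heisenberg_presented_conj) auto
  then show ?thesis by (simp add: Q8_def)
qed

text \<open>The commutator is a generator of its own instead of a power of \<open>a\<close>; hence
  \<open>\<alpha>\<close> is 0 and the first parameter is \<open>m + 1\<close>.\<close>

lemma heisenberg_M2_1_1: "\<exists>a b z. heisenberg_group (M2_1_1 (m + 1)) a b z (m + 1) 0 0"
proof -
  define X where "X = {Ga, Gb, Gd}"
  define R where "R = {(wpow Ga (2 ^ (m + 1)), []), (wpow Gb 2, []), (wpow Gd 2, []),
     (wcomm Ga Gb, wpow Gd 1), (wcomm Gd Ga, []), (wcomm Gd Gb, [])}"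
  let ?P = "presented_group X R"
  interpret P: group ?P by (rule group_presented)
  interpret L: heisenberg_model "m + 1" 0 0 by unfold_locales simp
  let ?a = "letter X R Ga" and ?b = "letter X R Gb" and ?d = "letter X R Gd"
  have X: "Ga \<in> X" "Gb \<in> X" "Gd \<in> X" by (simp_all add: X_def)
  have cl: "?a \<in> carrier ?P" "?b \<in> carrier ?P" "?d \<in> carrier ?P" using X by (simp_all add: letter_closed)
  have rel: "word_class X R l = word_class X R r" if "(l, r) \<in> R" for l r
  proof (rule presented_rel[OF that])
    show "l \<in> words_over X" "r \<in> words_over X"
      using that X by (auto simp: R_def intro: word_wpow word_wcomm words_over_Nil)
  qed
  have r: "?a [^]\<^bsub>?P\<^esub> (2 ^ (m + 1) :: nat) = \<one>\<^bsub>?P\<^esub>" "?b [^]\<^bsub>?P\<^esub> (2 :: nat) = \<one>\<^bsub>?P\<^esub>"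
    "?d [^]\<^bsub>?P\<^esub> (2 :: nat) = \<one>\<^bsub>?P\<^esub>"
    "inv\<^bsub>?P\<^esub> ?a \<otimes>\<^bsub>?P\<^esub> (inv\<^bsub>?P\<^esub> ?b \<otimes>\<^bsub>?P\<^esub> (?a \<otimes>\<^bsub>?P\<^esub> ?b)) = ?d [^]\<^bsub>?P\<^esub> (1::nat)"
    "inv\<^bsub>?P\<^esub> ?d \<otimes>\<^bsub>?P\<^esub> (inv\<^bsub>?P\<^esub> ?a \<otimes>\<^bsub>?P\<^esub> (?d \<otimes>\<^bsub>?P\<^esub> ?a)) = \<one>\<^bsub>?P\<^esub>"
    "inv\<^bsub>?P\<^esub> ?d \<otimes>\<^bsub>?P\<^esub> (inv\<^bsub>?P\<^esub> ?b \<otimes>\<^bsub>?P\<^esub> (?d \<otimes>\<^bsub>?P\<^esub> ?b)) = \<one>\<^bsub>?P\<^esub>"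
    using rel[of "wpow Ga (2 ^ (m + 1))" "[]"] rel[of "wpow Gb 2" "[]"] rel[of "wpow Gd 2" "[]"]
      rel[of "wcomm Ga Gb" "wpow Gd 1"] rel[of "wcomm Gd Ga" "[]"] rel[of "wcomm Gd Gb" "[]"]
    by (simp_all only: class_wpow class_wcomm presented_one X R_def insert_iff simp_thms)
  have swap: "x \<otimes>\<^bsub>?P\<^esub> y = y \<otimes>\<^bsub>?P\<^esub> (x \<otimes>\<^bsub>?P\<^esub> v)"
    if "x \<in> carrier ?P" "y \<in> carrier ?P" "v \<in> carrier ?P"
      "inv\<^bsub>?P\<^esub> x \<otimes>\<^bsub>?P\<^esub> (inv\<^bsub>?P\<^esub> y \<otimes>\<^bsub>?P\<^esub> (x \<otimes>\<^bsub>?P\<^esub> y)) = v" for x y v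
    using that(1,2) unfolding that(4)[symmetric] by (simp add: P.m_assoc[symmetric])
  have da: "?d \<otimes>\<^bsub>?P\<^esub> ?a = ?a \<otimes>\<^bsub>?P\<^esub> ?d" and db: "?d \<otimes>\<^bsub>?P\<^esub> ?b = ?b \<otimes>\<^bsub>?P\<^esub> ?d"
    using swap[OF cl(3,1) P.one_closed r(5)] swap[OF cl(3,2) P.one_closed r(6)] cl by simp_all
  have ab: "?a \<otimes>\<^bsub>?P\<^esub> ?b = ?b \<otimes>\<^bsub>?P\<^esub> (?a \<otimes>\<^bsub>?P\<^esub> ?d)"
    using swap[OF cl(1,2) _ r(4)] cl by simp
  have dd: "?d \<otimes>\<^bsub>?P\<^esub> ?d = \<one>\<^bsub>?P\<^esub>" using r(3) P.nat_pow_two[OF cl(3)] by simp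
  have ba: "?b \<otimes>\<^bsub>?P\<^esub> ?a = ?a \<otimes>\<^bsub>?P\<^esub> ?b \<otimes>\<^bsub>?P\<^esub> ?d"
    unfolding ab using cl by (simp add: P.m_assoc dd)
  have "heisenberg_relations ?P ?a ?b ?d (m + 1) 0 0"
    by unfold_locales (use cl r(1,2) da db ba dd in \<open>simp_all add: P.nat_pow_two\<close>)
  then have "heisenberg_group ?P ?a ?b ?d (m + 1) 0 0"
  proof (rule heisenberg_presented[rotated])
    fix l r assume "(l, r) \<in> R"
    then show "L.M.eval_word model_gen l = L.M.eval_word model_gen r"
      unfolding R_def using L.M.a_pow L.M.b_b L.M.z_z L.M.nat_pow_one1[OF L.M.z_closed]
      by (elim insertE emptyE)
        (simp_all only: prod.inject L.eval_gens L.M.nat_pow_two L.M.gen_closed L.M.nat_pow_0)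
  qed (use X in auto)
  then show ?thesis unfolding M2_1_1_def X_def R_def by blast
qed

section \<open>Groups with derived subgroup of order two\<close>

text \<open>What the central product has to know about a factor: commutators take only the values 1
  and \<open>z\<close>, and both occur.\<close>

locale central_commutator = finite_group +
  fixes z :: 'a
  assumes z_closed: "z \<in> carrier G" and z_not_one: "z \<noteq> \<one>" and z_z: "z \<otimes> z = \<one>"
    and z_central: "x \<in> carrier G \<Longrightarrow> z \<otimes> x = x \<otimes> z"
    and commutator: "x \<in> carrier G \<Longrightarrow> y \<in> carrier G \<Longrightarrow> x \<otimes> y = y \<otimes> x \<or> x \<otimes> y = y \<otimes> x \<otimes> z"
    and noncommuting: "\<exists>x\<in>carrier G. \<exists>y\<in>carrier G. x \<otimes> y = y \<otimes> x \<otimes> z"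
begin

lemma inv_z: "inv z = z"
  by (rule inv_equality) (simp_all add: z_z z_closed)

text \<open>Basis for identifying the derived subgroup, in terms of which
  \<open>amalg_kernel\<close> is stated, with the explicit set \<open>{\<one>, z}\<close>.\<close>

lemma subgroup_z: "subgroup {\<one>, z} G"
  by (rule subgroupI) (auto simp: z_closed z_z inv_z)

lemma normal_z: "{\<one>, z} \<lhd> G"
  unfolding normal_inv_iff
proof (intro conjI subgroup_z ballI)
  fix x h assume x: "x \<in> carrier G" "h \<in> {\<one>, z}"
  have "x \<otimes> z \<otimes> inv x = z" using x z_closed by (simp add: z_central[symmetric] m_assoc)
  then show "x \<otimes> h \<otimes> inv x \<in> {\<one>, z}" using x by auto
qed

lemma derived_eq: "derived G (carrier G) = {\<one>, z}"
proof
  have "x \<otimes> y \<otimes> inv x \<otimes> inv y \<in> {\<one>, z}" if xy: "x \<in> carrier G" "y \<in> carrier G" for x y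
    using commutator[OF xy]
  proof
    assume "x \<otimes> y = y \<otimes> x"
    then show ?thesis using xy by (simp add: m_assoc)
  next
    assume *: "x \<otimes> y = y \<otimes> x \<otimes> z"
    have "x \<otimes> y \<otimes> inv x \<otimes> inv y = y \<otimes> (x \<otimes> (z \<otimes> inv x)) \<otimes> inv y"
      unfolding * using xy z_closed by (simp add: m_assoc)
    also have "z \<otimes> inv x = inv x \<otimes> z" using xy by (simp add: z_central)
    also have "y \<otimes> (x \<otimes> (inv x \<otimes> z)) \<otimes> inv y = y \<otimes> (z \<otimes> inv y)"
      using xy z_closed by (simp add: m_assoc[symmetric])
    also have "z \<otimes> inv y = inv y \<otimes> z" using xy by (simp add: z_central)
    also have "y \<otimes> (inv y \<otimes> z) = z" using xy z_closed by (simp add: m_assoc[symmetric])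
    finally show ?thesis by simp
  qed
  then have "derived_set G (carrier G) \<subseteq> {\<one>, z}" by blast
  then show "derived G (carrier G) \<subseteq> {\<one>, z}"
    unfolding derived_def by (rule generate_subgroup_incl[OF _ subgroup_z])
  obtain x y where xy: "x \<in> carrier G" "y \<in> carrier G" "x \<otimes> y = y \<otimes> x \<otimes> z"
    using noncommuting by blast
  have "x \<otimes> y \<otimes> inv x \<otimes> inv y = y \<otimes> x \<otimes> z \<otimes> inv (y \<otimes> x)"
    using xy(1,2) z_closed by (simp add: xy(3) inv_mult_group m_assoc)
  also have "\<dots> = z" using xy(1,2) z_closed by (simp add: z_central[symmetric] m_assoc[of z])
  finally have "z \<in> derived_set G (carrier G)" using xy by blast
  then have "z \<in> derived G (carrier G)" unfolding derived_def by (rule generate.incl)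
  then show "{\<one>, z} \<subseteq> derived G (carrier G)" unfolding derived_def by (auto intro: generate.one)
qed

definition quot :: "'a set monoid" where
  "quot = G Mod {\<one>, z}"

definition proj :: "'a \<Rightarrow> 'a set" where
  "proj x = {\<one>, z} #> x"

lemma group_quot: "group quot"
  unfolding quot_def by (rule normal.factorgroup_is_group[OF normal_z])

lemma proj_hom: "proj \<in> hom G quot"
  unfolding quot_def proj_def by (rule normal.r_coset_hom_Mod[OF normal_z])

lemma proj_surj: "proj ` carrier G = carrier quot"
  by (auto simp: quot_def proj_def FactGroup_def RCOSETS_def)

lemma proj_mult: "x \<in> carrier G \<Longrightarrow> y \<in> carrier G \<Longrightarrow> proj x \<otimes>\<^bsub>quot\<^esub> proj y = proj (x \<otimes> y)"
  using hom_mult[OF proj_hom] by simp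

lemma proj_one: "proj \<one> = \<one>\<^bsub>quot\<^esub>"
  using hom_one[OF proj_hom is_group group_quot] .

lemma proj_eq_iff:
  assumes "x \<in> carrier G" "y \<in> carrier G"
  shows "proj x = proj y \<longleftrightarrow> x = y \<or> x = y \<otimes> z"
proof -
  have c: "proj v = {v, v \<otimes> z}" if "v \<in> carrier G" for v
    using that z_closed by (auto simp: proj_def r_coset_def z_central)
  have "y \<otimes> z \<otimes> z = y" using assms z_closed by (simp add: m_assoc z_z)
  then show ?thesis using c[OF assms(1)] c[OF assms(2)] by (metis insert_commute insert_iff singletonD)
qed

lemma proj_one_iff: "x \<in> carrier G \<Longrightarrow> proj x = \<one>\<^bsub>quot\<^esub> \<longleftrightarrow> x \<in> {\<one>, z}"
  using proj_eq_iff[of x \<one>] z_closed by (simp add: proj_one)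

lemma comm_quot: "comm_group quot"
proof -
  interpret Q: group quot by (rule group_quot)
  show ?thesis
  proof (rule Q.group_comm_groupI)
    fix u v assume "u \<in> carrier quot" "v \<in> carrier quot"
    then obtain x y where xy: "x \<in> carrier G" "y \<in> carrier G" "u = proj x" "v = proj y"
      unfolding proj_surj[symmetric] by blast
    have "proj (x \<otimes> y) = proj (y \<otimes> x)"
      using commutator[OF xy(1,2)] proj_eq_iff[of "x \<otimes> y" "y \<otimes> x"] xy(1,2) by simp
    then show "u \<otimes>\<^bsub>quot\<^esub> v = v \<otimes>\<^bsub>quot\<^esub> u" using xy by (simp add: proj_mult)
  qed
qed

lemma square_involutions_quot:
  "square_involutions quot =
    {proj (x \<otimes> x) | x. x \<in> carrier G \<and> (x \<otimes> x) \<otimes> (x \<otimes> x) \<in> {\<one>, z}}"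
proof -
  have "square_involutions quot = (\<lambda>x. proj x \<otimes>\<^bsub>quot\<^esub> proj x) ` {x \<in> carrier G.
      (proj x \<otimes>\<^bsub>quot\<^esub> proj x) \<otimes>\<^bsub>quot\<^esub> (proj x \<otimes>\<^bsub>quot\<^esub> proj x) = \<one>\<^bsub>quot\<^esub>}"
    unfolding square_involutions_def proj_surj[symmetric] by blast
  also have "\<dots> = (\<lambda>x. proj (x \<otimes> x)) ` {x \<in> carrier G. (x \<otimes> x) \<otimes> (x \<otimes> x) \<in> {\<one>, z}}"
    by (intro image_cong) (simp_all add: proj_mult proj_one_iff del: insert_iff cong: conj_cong)
  finally show ?thesis by blast
qed

text \<open>The possible coordinates of a square root of 1 or \<open>c\<close> in a central
  product.\<close>

definition quadratic :: "'a set" where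
  "quadratic = {x \<in> carrier G. x \<otimes> x \<in> {\<one>, z}}"

text \<open>The number of square roots of 1 minus that of \<open>z\<close>. Unlike the two numbers
  themselves, this difference is multiplicative over central products up to a power of two.\<close>

definition sign_sum :: int where
  "sign_sum = (\<Sum>x\<in>quadratic. if x \<otimes> x = \<one> then 1 else - 1)"

end

section \<open>Commutators and squares in normal form\<close>

context heisenberg_group
begin

lemma el_mod: "el i j k = el i j (k mod 2)"
  unfolding el_def z_pow_mod[of k] by simp

lemma el_cong: "k mod 2 = k' mod 2 \<Longrightarrow> el i j k = el i j k'"
  using el_mod by metis

lemma el_z_mult: "el i j k \<otimes> z = el i j (k + 1)" "z \<otimes> el i j k = el i j (k + 1)"
  using el_mult[of i j k 0 0 1, folded z_eq_el] el_mult[of 0 0 1 i j k, folded z_eq_el] by simp_all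

lemma elE:
  assumes "x \<in> carrier G"
  obtains i j k where "x = el i j k"
  using assms unfolding spans by blast

text \<open>The carries are symmetric in the two factors, so only the alternating form of the
  exponent pairs modulo 2 decides.\<close>

lemma commute_iff: "el i j k \<otimes> el i' j' k' = el i' j' k' \<otimes> el i j k \<longleftrightarrow> (j * i') mod 2 = (j' * i) mod 2"
proof -
  let ?c = "\<alpha> * ((i + i') div 2 ^ w) + \<beta> * ((j + j') div 2)"
  have "el i j k \<otimes> el i' j' k' = el i' j' k' \<otimes> el i j k \<longleftrightarrow>
      (k + k' + j * i' + ?c) mod 2 = (k' + k + j' * i + ?c) mod 2"
    unfolding el_mult el_eq_iff by (simp add: reduce_def add.commute[of i] add.commute[of j] add.assoc)
  also have "\<dots> \<longleftrightarrow> (j * i') mod 2 = (j' * i) mod 2"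
  proof -
    have "(k + k' + x + y) mod 2 = (k' + k + x' + y) mod 2 \<longleftrightarrow> x mod 2 = x' mod 2" for x x' y :: nat
    proof -
      have p: "u mod 2 = v mod 2 \<longleftrightarrow> (even u \<longleftrightarrow> even v)" for u v :: nat by presburger
      show ?thesis unfolding p even_add by blast
    qed
    then show ?thesis .
  qed
  finally show ?thesis .
qed

lemma z_neq_one: "z \<noteq> \<one>"
proof -
  have "el 0 0 1 \<noteq> el 0 0 0" unfolding el_eq_iff by (simp add: reduce_def)
  then show ?thesis using z_eq_el el_one by metis
qed

sublocale C: central_commutator G z
proof
  show "finite (carrier G)" by (rule finite_carrier)
  show "z \<otimes> x = x \<otimes> z" if "x \<in> carrier G" for x
    using that by (elim elE) (simp only: el_z_mult)
  show "x \<otimes> y = y \<otimes> x \<or> x \<otimes> y = y \<otimes> x \<otimes> z" if xy: "x \<in> carrier G" "y \<in> carrier G" for x y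
  proof -
    obtain i j k i' j' k' where e: "x = el i j k" "y = el i' j' k'" using elE xy by metis
    have xy: "x \<otimes> y = el (i + i') (j + j') (k + k' + j * i')"
      "y \<otimes> x = el (i + i') (j + j') (k + k' + j' * i)" by (simp_all only: e el_mult add.commute)
    have "u mod 2 = v mod 2 \<or> u mod 2 = (v + 1) mod 2" for u v :: nat by presburger
    then show ?thesis unfolding xy el_z_mult using el_cong by blast
  qed
  show "\<exists>x\<in>carrier G. \<exists>y\<in>carrier G. x \<otimes> y = y \<otimes> x \<otimes> z" using gen_closed b_a by blast
qed (rule z_closed z_neq_one z_z)+

lemma el_in_center_iff: "el i j k \<in> {\<one>, z} \<longleftrightarrow> 2 ^ w dvd i \<and> even j"
proof -
  have "{\<one>, z} = {el 0 0 0, el 0 0 1}" by (simp only: el_one z_eq_el[symmetric])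
  moreover have "el i j k \<in> {el 0 0 0, el 0 0 1} \<longleftrightarrow> 2 ^ w dvd i \<and> even j"
    by (auto simp: el_eq_iff reduce_def mod_eq_0_iff_dvd)
  ultimately show ?thesis by simp
qed

lemma el_square: "el i j k \<otimes> el i j k = el (2 * i) (2 * j) (j * i)"
  unfolding el_mult mult_2[symmetric] by (rule el_cong) presburger

text \<open>The square is a power of \<open>z\<close> whose exponent collects the carry of
  \<open>a\<close>, the carry of \<open>b\<close> and a cross term; the cross term matters only for
  \<open>w = 1\<close>.\<close>

lemma el_square_eq_one_iff:
  "el (2 ^ (w - 1) * i) j k \<otimes> el (2 ^ (w - 1) * i) j k = \<one> \<longleftrightarrow> even (\<alpha> * i + \<beta> * j + 2 ^ (w - 1) * (i * j))"
proof -
  have e: "2 * (2 ^ (w - 1) * i) = 2 ^ w * i" using w_pos by (cases w) simp_all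
  have "el (2 ^ (w - 1) * i) j k \<otimes> el (2 ^ (w - 1) * i) j k = el 0 0 0 \<longleftrightarrow>
      even (j * (2 ^ (w - 1) * i) + \<alpha> * i + \<beta> * j)"
    unfolding el_square e el_eq_iff reduce_def by (simp add: mod_eq_0_iff_dvd)
  also have "j * (2 ^ (w - 1) * i) + \<alpha> * i + \<beta> * j = \<alpha> * i + \<beta> * j + 2 ^ (w - 1) * (i * j)"
    by (simp add: algebra_simps)
  finally show ?thesis by (simp only: el_one)
qed

lemma quadratic_eq: "C.quadratic = (\<lambda>(i, j, k). el (2 ^ (w - 1) * i) j k) ` ({..<2} \<times> {..<2} \<times> {..<2})"
  (is "_ = ?f ` ?B")
proof -
  have N: "2 * 2 ^ (w - 1) = (2::nat) ^ w" using w_pos by (cases w) simp_all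
  have q: "el i j k \<in> C.quadratic \<longleftrightarrow> 2 ^ (w - 1) dvd i" for i j k
  proof -
    have "el i j k \<in> C.quadratic \<longleftrightarrow> 2 ^ w dvd 2 * i"
      unfolding C.quadratic_def mem_Collect_eq el_square el_in_center_iff by (simp add: el_closed)
    then show ?thesis unfolding N[symmetric] by simp
  qed
  show ?thesis
  proof
    show "?f ` ?B \<subseteq> C.quadratic" using q by auto
    show "C.quadratic \<subseteq> ?f ` ?B"
    proof
      fix x assume x: "x \<in> C.quadratic"
      then have "x \<in> carrier G" by (simp add: C.quadratic_def)
      then have "x \<in> elt ` grid" unfolding spans range_el .
      then obtain i j k where ijk: "x = el i j k" "i < 2 ^ w" "j < 2" "k < 2" by auto
      then obtain i' where i': "i = 2 ^ (w - 1) * i'" using x q by (auto elim: dvdE)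
      then have "i' < 2" using ijk(2) unfolding N[symmetric] by simp
      then show "x \<in> ?f ` ?B" using ijk i' by (intro image_eqI[of _ _ "(i', j, k)"]) auto
    qed
  qed
qed

lemma quadratic_inj: "inj_on (\<lambda>(i, j, k). el (2 ^ (w - 1) * i) j k) ({..<2} \<times> {..<2} \<times> {..<2})"
proof -
  have N: "2 * 2 ^ (w - 1) = (2::nat) ^ w" using w_pos by (cases w) simp_all
  have lt: "2 ^ (w - Suc 0) * i < 2 ^ w" if "i < 2" for i :: nat using that unfolding N[symmetric] by simp
  show ?thesis
    by (rule inj_onI) (auto simp: el_eq_iff reduce_def lt)
qed

lemma card_quadratic: "card C.quadratic = 8"
  unfolding quadratic_eq card_image[OF quadratic_inj] by (simp add: card_cartesian_product)

text \<open>One summand for each parity pattern of \<open>(i, j)\<close>, doubled by the free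
  exponent of \<open>z\<close>. The values are 4 for \<open>D8\<close>, -4 for \<open>Q8\<close>, 8
  when \<open>\<alpha> = \<beta> = 0\<close> and \<open>w \<ge> 2\<close>, and 0 when
  \<open>\<alpha> = 1\<close>, \<open>\<beta> = 0\<close> and \<open>w \<ge> 2\<close>.\<close>

lemma sign_sum_eq:
  "C.sign_sum = 2 * (1 + (- 1) ^ \<alpha> + (- 1) ^ \<beta> + (- 1) ^ (\<alpha> + \<beta> + 2 ^ (w - 1)))"
proof -
  have m: "(if even n then 1 else - 1) = (- 1 :: int) ^ n" for n :: nat by simp
  have two: "{..<2} = {0, 1::nat}" by auto
  have "C.sign_sum = (\<Sum>(i, j, k)\<in>{..<2::nat} \<times> {..<2::nat} \<times> {..<2::nat}.
      (- 1) ^ (\<alpha> * i + \<beta> * j + 2 ^ (w - 1) * (i * j)))"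
    unfolding C.sign_sum_def quadratic_eq sum.reindex[OF quadratic_inj]
  proof (intro sum.cong HOL.refl)
    have pt: "(if el (2 ^ (w - 1) * i) j k \<otimes> el (2 ^ (w - 1) * i) j k = \<one> then 1 else - 1 :: int) =
        (- 1) ^ (\<alpha> * i + \<beta> * j + 2 ^ (w - 1) * (i * j))" for i j k
      unfolding el_square_eq_one_iff by (rule m)
    fix t :: "nat \<times> nat \<times> nat"
    show "((\<lambda>x. if x \<otimes> x = \<one> then 1 else - 1) \<circ> (\<lambda>(i, j, k). el (2 ^ (w - 1) * i) j k)) t =
        (case t of (i, j, k) \<Rightarrow> ((- 1) ^ (\<alpha> * i + \<beta> * j + 2 ^ (w - 1) * (i * j)) :: int))"
      by (cases t) (simp only: o_apply prod.case pt)
  qed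
  also have "\<dots> = 2 * (1 + (- 1) ^ \<alpha> + (- 1) ^ \<beta> + (- 1) ^ (\<alpha> + \<beta> + 2 ^ (w - 1)))"
    unfolding sum.cartesian_product[symmetric] two by simp
  finally show ?thesis .
qed

text \<open>The quotient is a product of cyclic groups of orders \<open>2 ^ w\<close> and 2. Squares
  come from the first factor, whose involution is a square exactly when
  \<open>w \<ge> 2\<close>.\<close>

lemma card_square_involutions_quot: "card (square_involutions C.quot) = (if w = 1 then 1 else 2)"
proof -
  have pr: "C.proj (el i j k) = C.proj (el i' j' k') \<longleftrightarrow> i mod 2 ^ w = i' mod 2 ^ w \<and> j mod 2 = j' mod 2"
    for i j k i' j' k'
  proof -
    have "C.proj (el i j k) = C.proj (el i' j' k') \<longleftrightarrow> el i j k = el i' j' k' \<or> el i j k = el i' j' (k' + 1)"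
      by (simp only: C.proj_eq_iff el_closed el_z_mult)
    also have "\<dots> \<longleftrightarrow> i mod 2 ^ w = i' mod 2 ^ w \<and> j mod 2 = j' mod 2"
    proof -
      have "x mod 2 = (k' + y + y') mod 2 \<or> x mod 2 = (k' + 1 + y + y') mod 2" for x y y' :: nat
        by presburger
      then show ?thesis unfolding el_eq_iff reduce_def prod.case prod.inject
        by (smt (verit, best) mod_mod_trivial)
    qed
    finally show ?thesis .
  qed
  have "square_involutions C.quot = {C.proj (el (2 * i) 0 0) | i. 2 ^ w dvd 4 * i}"
  proof -
    have cond: "(el i j k \<otimes> el i j k) \<otimes> (el i j k \<otimes> el i j k) \<in> {\<one>, z} \<longleftrightarrow> 2 ^ w dvd 4 * i" for i j k
      unfolding el_square el_in_center_iff by (simp add: mult.assoc[symmetric])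
    have pj: "C.proj (el i j k \<otimes> el i j k) = C.proj (el (2 * i) 0 0)" for i j k
      unfolding el_square pr by simp
    show ?thesis
    proof (intro equalityI subsetI)
      fix s assume "s \<in> square_involutions C.quot"
      then obtain x where x: "x \<in> carrier G" "s = C.proj (x \<otimes> x)" "(x \<otimes> x) \<otimes> (x \<otimes> x) \<in> {\<one>, z}"
        unfolding C.square_involutions_quot by blast
      obtain i j k where "x = el i j k" using elE[OF x(1)] .
      then show "s \<in> {C.proj (el (2 * i) 0 0) | i. 2 ^ w dvd 4 * i}" using x cond pj by blast
    next
      fix s assume "s \<in> {C.proj (el (2 * i) 0 0) | i. 2 ^ w dvd 4 * i}"
      then obtain i where "s = C.proj (el (2 * i) 0 0)" "2 ^ w dvd 4 * i" by blast
      then have "s = C.proj (el i 0 0 \<otimes> el i 0 0)" "2 ^ w dvd 4 * i" using pj[of i 0 0] by simp_all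
      then show "s \<in> square_involutions C.quot"
        unfolding C.square_involutions_quot using cond[of i 0 0] el_closed by blast
    qed
  qed
  also have "\<dots> = (if w = 1 then {C.proj (el 0 0 0)} else {C.proj (el 0 0 0), C.proj (el (2 ^ (w - 1)) 0 0)})"
  proof (cases "w = 1")
    case True
    have "C.proj (el (2 * i) 0 0) = C.proj (el 0 0 0)" for i unfolding pr using True by simp
    moreover have "2 ^ w dvd 4 * (0::nat)" by simp
    ultimately show ?thesis using True by auto
  next
    case False
    then have "w = Suc (Suc (w - 2))" using w_pos by simp
    then obtain v where v: "w = Suc (Suc v)" ..
    have "C.proj (el (2 * i) 0 0) \<in> {C.proj (el 0 0 0), C.proj (el (2 ^ (w - 1)) 0 0)}"
      if i: "2 ^ w dvd 4 * i" for i
    proof -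
      \<comment> \<open>Then \<open>2 * i\<close> is \<open>2 ^ (w - 1) * r\<close>, and modulo
        \<open>2 ^ w\<close> only the parity of \<open>r\<close> counts.\<close>
      obtain r where r: "i = 2 ^ v * r" using i by (auto simp: v elim: dvdE)
      have "(2 * i) mod 2 ^ w = 2 ^ (w - 1) * (r mod 2)"
        using mult_mod_right[of "2 * 2 ^ v" r 2] by (simp add: r v mult_ac)
      then show ?thesis unfolding pr insert_iff by (cases "even r") (simp_all add: pr v odd_iff_mod_2_eq_one)
    qed
    moreover have "C.proj (el 0 0 0) = C.proj (el (2 * 0) 0 0)" "2 ^ w dvd 4 * (0::nat)"
      "C.proj (el (2 ^ (w - 1)) 0 0) = C.proj (el (2 * 2 ^ v) 0 0)" "2 ^ w dvd 4 * (2::nat) ^ v"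
      by (simp_all add: v)
    ultimately have "{C.proj (el (2 * i) 0 0) | i. 2 ^ w dvd 4 * i} =
        {C.proj (el 0 0 0), C.proj (el (2 ^ (w - 1)) 0 0)}" by blast
    then show ?thesis using False by simp
  qed
  finally have eq: "square_involutions C.quot =
    (if w = 1 then {C.proj (el 0 0 0)} else {C.proj (el 0 0 0), C.proj (el (2 ^ (w - 1)) 0 0)})" .
  have "C.proj (el 0 0 0) \<noteq> C.proj (el (2 ^ (w - 1)) 0 0)" unfolding pr using w_pos by simp
  then show ?thesis unfolding eq by simp
qed

lemma quadratic_all: "w = 1 \<Longrightarrow> x \<in> carrier G \<Longrightarrow> x \<otimes> x \<in> {\<one>, z}"
  by (elim elE) (simp only: el_square el_in_center_iff, simp)

lemma exists_noncommuting:
  assumes "w = 1" "x \<in> carrier G" "x \<notin> {\<one>, z}"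
  obtains y where "y \<in> carrier G" "x \<otimes> y \<noteq> y \<otimes> x"
proof -
  obtain i j k where x: "x = el i j k" using elE[OF assms(2)] .
  then have "odd i \<or> odd j" using assms(1,3) el_in_center_iff[of i j k] by auto
  then have "x \<otimes> el 0 1 0 \<noteq> el 0 1 0 \<otimes> x \<or> x \<otimes> el 1 0 0 \<noteq> el 1 0 0 \<otimes> x"
    unfolding x commute_iff by presburger
  then show thesis using that el_closed by blast
qed

text \<open>In the dihedral case \<open>b\<close> and \<open>a \<otimes> b\<close> are involutions
  that generate the group modulo its centre, so a noncentral element fails to commute with one of
  them.\<close>

lemma exists_noncommuting_involution:
  assumes w: "w = 1" "\<alpha> = 1" "\<beta> = 0" and x: "x \<in> carrier G" "x \<notin> {\<one>, z}"
  obtains y where "y \<in> carrier G" "y \<otimes> y = \<one>" "x \<otimes> y \<noteq> y \<otimes> x"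
proof -
  obtain i j k where x': "x = el i j k" using elE[OF x(1)] .
  then have "odd i \<or> odd j" using w x(2) el_in_center_iff[of i j k] by auto
  then have "x \<otimes> el 0 1 0 \<noteq> el 0 1 0 \<otimes> x \<or> x \<otimes> el 1 1 0 \<noteq> el 1 1 0 \<otimes> x"
    unfolding x' commute_iff by presburger
  moreover have "el 0 1 0 \<otimes> el 0 1 0 = \<one>" "el 1 1 0 \<otimes> el 1 1 0 = \<one>"
    using el_square_eq_one_iff[of 0 1 0] el_square_eq_one_iff[of 1 1 0] w by simp_all
  ultimately show thesis using that el_closed by blast
qed

text \<open>In \<open>M2_1_1\<close> the element \<open>z\<close> is not a square, so this factor
  never changes a sign.\<close>

lemma quadratic_square_one:
  assumes "w \<ge> 2" "\<alpha> = 0" "\<beta> = 0" "x \<in> C.quadratic"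
  shows "x \<otimes> x = \<one>"
proof -
  obtain i j k where x: "x = el (2 ^ (w - 1) * i) j k" using assms(4) unfolding quadratic_eq by auto
  have "even (\<alpha> * i + \<beta> * j + 2 ^ (w - 1) * (i * j))" using assms(1-3) by simp
  then show ?thesis unfolding x el_square_eq_one_iff .
qed

lemma a_square: "w = 1 \<Longrightarrow> \<alpha> = 1 \<Longrightarrow> a \<otimes> a = z"
  using a_pow gen_closed nat_pow_two[of a] by simp

text \<open>The witness is \<open>a [^] 2 ^ (w - 2)\<close>: its square is an even power of
  \<open>a\<close>, hence central, and its fourth power is \<open>a [^] 2 ^ w = z\<close>.\<close>

lemma exists_central_square:
  assumes "w \<ge> 2" "\<alpha> = 1"
  obtains s where "s \<in> carrier G" "(s \<otimes> s) \<otimes> (s \<otimes> s) = z"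
    "\<And>x. x \<in> carrier G \<Longrightarrow> (s \<otimes> s) \<otimes> x = x \<otimes> (s \<otimes> s)"
proof -
  have "w = Suc (Suc (w - 2))" using assms(1) by simp
  then obtain v where v: "w = Suc (Suc v)" ..
  let ?s = "el (2 ^ v) 0 0"
  have ss: "?s \<otimes> ?s = el (2 * 2 ^ v) 0 0" unfolding el_square by simp
  have "(?s \<otimes> ?s) \<otimes> (?s \<otimes> ?s) = el (2 ^ w) 0 0" unfolding ss el_square by (simp add: v)
  also have "\<dots> = el 0 0 1" unfolding el_eq_iff reduce_def by (simp add: assms(2))
  finally have "(?s \<otimes> ?s) \<otimes> (?s \<otimes> ?s) = z" by (simp only: z_eq_el[symmetric])
  moreover have "(?s \<otimes> ?s) \<otimes> x = x \<otimes> (?s \<otimes> ?s)" if x: "x \<in> carrier G" for x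
  proof -
    obtain i j k where x: "x = el i j k" using elE[OF x] .
    show ?thesis unfolding ss x commute_iff by simp
  qed
  ultimately show thesis using that[of ?s] el_closed by blast
qed

end

section \<open>Central products\<close>

text \<open>Both the number of all tuples and the sum of their signs factor over the index set; half
  the sum and half the difference count the tuples of each sign.\<close>

lemma card_PiE_sign:
  fixes s :: "'i \<Rightarrow> 'a \<Rightarrow> int"
  assumes fin: "finite I" "\<And>i. i \<in> I \<Longrightarrow> finite (X i)"
    and s: "\<And>i x. i \<in> I \<Longrightarrow> x \<in> X i \<Longrightarrow> s i x = 1 \<or> s i x = - 1"
  shows "2 * int (card {p \<in> PiE I X. (\<Prod>i\<in>I. s i (p i)) = 1}) =
      (\<Prod>i\<in>I. int (card (X i))) + (\<Prod>i\<in>I. \<Sum>x\<in>X i. s i x)"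
    and "2 * int (card {p \<in> PiE I X. (\<Prod>i\<in>I. s i (p i)) = - 1}) =
      (\<Prod>i\<in>I. int (card (X i))) - (\<Prod>i\<in>I. \<Sum>x\<in>X i. s i x)"
proof -
  let ?s = "\<lambda>p. \<Prod>i\<in>I. s i (p i)"
  let ?E = "{p \<in> PiE I X. ?s p = 1}" and ?O = "{p \<in> PiE I X. ?s p = - 1}"
  have pm: "?s p = 1 \<or> ?s p = - 1" if p: "p \<in> PiE I X" for p
  proof -
    have "J \<subseteq> I \<Longrightarrow> (\<Prod>i\<in>J. s i (p i)) = 1 \<or> (\<Prod>i\<in>J. s i (p i)) = - 1" for J
    proof (induction J rule: infinite_finite_induct)
      case (insert i J)
      then have "s i (p i) = 1 \<or> s i (p i) = - 1" using s p by (auto simp: PiE_iff)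
      then show ?case using insert by auto
    qed simp_all
    then show ?thesis by blast
  qed
  have finP: "finite (PiE I X)" using fin by (simp add: finite_PiE)
  have un: "PiE I X = ?E \<union> ?O" using pm by blast
  have disj: "?E \<inter> ?O = {}" by auto
  have fE: "finite ?E" and fO: "finite ?O" using finP by simp_all
  have "int (card (PiE I X)) = int (card ?E) + int (card ?O)"
    using card_Un_disjoint[OF fE fO disj] un by simp
  then have 1: "(\<Prod>i\<in>I. int (card (X i))) = int (card ?E) + int (card ?O)"
    using card_PiE[OF fin(1), of X] by simp
  have "(\<Sum>p\<in>PiE I X. ?s p) = (\<Sum>p\<in>?E. ?s p) + (\<Sum>p\<in>?O. ?s p)"
    using sum.union_disjoint[OF fE fO disj, of ?s] un by simp
  also have "\<dots> = int (card ?E) - int (card ?O)" by simp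
  finally have 2: "(\<Prod>i\<in>I. \<Sum>x\<in>X i. s i x) = int (card ?E) - int (card ?O)"
    using prod_sum_PiE[OF fin(1), of X s] fin(2) by simp
  show "2 * int (card ?E) = (\<Prod>i\<in>I. int (card (X i))) + (\<Prod>i\<in>I. \<Sum>x\<in>X i. s i x)"
    "2 * int (card ?O) = (\<Prod>i\<in>I. int (card (X i))) - (\<Prod>i\<in>I. \<Sum>x\<in>X i. s i x)"
    using 1 2 by simp_all
qed

lemma square_involutions_product_group:
  assumes "\<And>i. i \<in> I \<Longrightarrow> group (Q i)"
  shows "square_involutions (product_group I Q) = (\<Pi>\<^sub>E i\<in>I. square_involutions (Q i))"
proof (intro equalityI subsetI)
  fix s assume "s \<in> square_involutions (product_group I Q)"
  then obtain g where g: "g \<in> (\<Pi>\<^sub>E i\<in>I. carrier (Q i))" "s = (\<lambda>i\<in>I. g i \<otimes>\<^bsub>Q i\<^esub> g i)"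
    "(\<lambda>i\<in>I. s i \<otimes>\<^bsub>Q i\<^esub> s i) = (\<lambda>i\<in>I. \<one>\<^bsub>Q i\<^esub>)"
    unfolding square_involutions_def by auto
  have "s i \<in> square_involutions (Q i)" if i: "i \<in> I" for i
  proof -
    have "s i = g i \<otimes>\<^bsub>Q i\<^esub> g i" using g(2) i by simp
    moreover have "s i \<otimes>\<^bsub>Q i\<^esub> s i = \<one>\<^bsub>Q i\<^esub>" using fun_cong[OF g(3), of i] i by simp
    moreover have "g i \<in> carrier (Q i)" using g(1) i by (auto simp: PiE_iff)
    ultimately show ?thesis unfolding square_involutions_def by auto
  qed
  then show "s \<in> (\<Pi>\<^sub>E i\<in>I. square_involutions (Q i))" using g(2) by (auto simp: PiE_iff)
next
  fix s assume s: "s \<in> (\<Pi>\<^sub>E i\<in>I. square_involutions (Q i))"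
  have "\<forall>i\<in>I. \<exists>g. g \<in> carrier (Q i) \<and> s i = g \<otimes>\<^bsub>Q i\<^esub> g \<and> s i \<otimes>\<^bsub>Q i\<^esub> s i = \<one>\<^bsub>Q i\<^esub>"
  proof
    fix i assume "i \<in> I"
    then have "s i \<in> square_involutions (Q i)" using s by (auto simp: PiE_iff)
    then show "\<exists>g. g \<in> carrier (Q i) \<and> s i = g \<otimes>\<^bsub>Q i\<^esub> g \<and> s i \<otimes>\<^bsub>Q i\<^esub> s i = \<one>\<^bsub>Q i\<^esub>"
      unfolding square_involutions_def by auto
  qed
  from bchoice[OF this] obtain g where
    g: "\<forall>i\<in>I. g i \<in> carrier (Q i) \<and> s i = g i \<otimes>\<^bsub>Q i\<^esub> g i \<and> s i \<otimes>\<^bsub>Q i\<^esub> s i = \<one>\<^bsub>Q i\<^esub>" ..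
  define f where "f = restrict g I"
  have f: "f \<in> carrier (product_group I Q)" using g by (auto simp: f_def PiE_iff)
  have ff: "f \<otimes>\<^bsub>product_group I Q\<^esub> f = s"
    by (rule PiE_ext[where k = I and s = "\<lambda>i. square_involutions (Q i)"])
       (use g s in \<open>auto simp: f_def PiE_iff extensional_def\<close>)
  moreover have "s \<otimes>\<^bsub>product_group I Q\<^esub> s = \<one>\<^bsub>product_group I Q\<^esub>"
    using g by (auto intro!: restrict_ext)
  ultimately show "s \<in> square_involutions (product_group I Q)"
    unfolding square_involutions_def using f by blast
qed

declare carrier_product_group [simp del] one_product_group [simp del]
  mult_product_group [simp del] inv_product_group [simp del]

locale central_product_factors =
  fixes Ks :: "'a monoid list" and zs :: "nat \<Rightarrow> 'a"
  assumes nonempty: "Ks \<noteq> []"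
    and factor: "i < length Ks \<Longrightarrow> central_commutator (Ks ! i) (zs i)"
begin

abbreviation I :: "nat set" where "I \<equiv> {..<length Ks}"
abbreviation P :: "(nat \<Rightarrow> 'a) monoid" where "P \<equiv> product_group I (\<lambda>i. Ks ! i)"

lemma factor_I: "i \<in> I \<Longrightarrow> central_commutator (Ks ! i) (zs i)"
  using factor by simp

lemma factor_group: "i \<in> I \<Longrightarrow> group (Ks ! i)"
  using factor_I unfolding central_commutator_def finite_group_def by blast

sublocale P: group P
  using factor_group by (rule product_group)

lemma finite_factor: "i \<in> I \<Longrightarrow> finite (carrier (Ks ! i))"
  using factor_I unfolding central_commutator_def finite_group_def finite_group_axioms_def by blast

sublocale P: finite_group P
proof
  show "finite (carrier P)"
    unfolding carrier_product_group by (rule finite_PiE) (simp_all add: finite_factor)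
qed

lemma P_apply: "i \<in> I \<Longrightarrow> (p \<otimes>\<^bsub>P\<^esub> q) i = p i \<otimes>\<^bsub>Ks ! i\<^esub> q i"
  by (simp add: mult_product_group)

lemma P_one: "i \<in> I \<Longrightarrow> \<one>\<^bsub>P\<^esub> i = \<one>\<^bsub>Ks ! i\<^esub>"
  by (simp add: one_product_group)

lemma P_closed: "p \<in> carrier P \<Longrightarrow> i \<in> I \<Longrightarrow> p i \<in> carrier (Ks ! i)"
  by (simp add: carrier_product_group PiE_iff)

lemma P_ext:
  assumes "p \<in> carrier P" "q \<in> carrier P" "\<And>i. i \<in> I \<Longrightarrow> p i = q i"
  shows "p = q"
  using assms unfolding carrier_product_group by (rule PiE_ext)

definition D :: "(nat \<Rightarrow> 'a) set" where
  "D = (\<Pi>\<^sub>E i\<in>I. {\<one>\<^bsub>Ks ! i\<^esub>, zs i})"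

text \<open>On \<open>D\<close>, the product of the derived subgroups, this is a character with
  kernel \<open>N\<close>; the elements of sign -1 become the common commutator
  \<open>c\<close>.\<close>

definition sign :: "(nat \<Rightarrow> 'a) \<Rightarrow> int" where
  "sign p = (\<Prod>i\<in>I. if p i = \<one>\<^bsub>Ks ! i\<^esub> then 1 else - 1)"

abbreviation N :: "(nat \<Rightarrow> 'a) set" where "N \<equiv> amalg_kernel Ks"

lemma D_P:
  assumes "p \<in> D"
  shows "p \<in> carrier P"
proof -
  have "{\<one>\<^bsub>Ks ! i\<^esub>, zs i} \<subseteq> carrier (Ks ! i)" if "i \<in> I" for i
    using central_commutator.z_closed[OF factor_I[OF that]]
      monoid.one_closed[OF group.is_monoid[OF factor_group[OF that]]] by blast
  then have "D \<subseteq> carrier P" unfolding D_def carrier_product_group by (rule PiE_mono)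
  then show ?thesis using assms by blast
qed

lemma D_apply: "p \<in> D \<Longrightarrow> i \<in> I \<Longrightarrow> p i \<in> {\<one>\<^bsub>Ks ! i\<^esub>, zs i}"
  by (auto simp: D_def PiE_iff)

lemma D_I: "p \<in> carrier P \<Longrightarrow> (\<And>i. i \<in> I \<Longrightarrow> p i \<in> {\<one>\<^bsub>Ks ! i\<^esub>, zs i}) \<Longrightarrow> p \<in> D"
  unfolding D_def carrier_product_group PiE_iff by blast

lemma N_eq: "N = {p \<in> D. sign p = 1}"
proof -
  have 1: "(\<Pi>\<^sub>E i\<in>I. derived (Ks ! i) (carrier (Ks ! i))) = D"
    unfolding D_def by (rule PiE_cong) (rule central_commutator.derived_eq[OF factor_I])
  have 2: "sign p = (- 1) ^ card {i \<in> I. p i \<noteq> \<one>\<^bsub>Ks ! i\<^esub>}" for p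
    by (simp add: sign_def prod.If_cases Int_def Collect_neg_eq[symmetric])
  have 3: "even n \<longleftrightarrow> (- 1 :: int) ^ n = 1" for n :: nat by (cases "even n") simp_all
  show ?thesis unfolding amalg_kernel_def 1 2 3 ..
qed

lemma sign_mult:
  assumes "p \<in> D" "q \<in> D"
  shows "p \<otimes>\<^bsub>P\<^esub> q \<in> D" "sign (p \<otimes>\<^bsub>P\<^esub> q) = sign p * sign q"
proof -
  have *: "p i \<otimes>\<^bsub>Ks ! i\<^esub> q i \<in> {\<one>\<^bsub>Ks ! i\<^esub>, zs i} \<and>
      (if p i \<otimes>\<^bsub>Ks ! i\<^esub> q i = \<one>\<^bsub>Ks ! i\<^esub> then 1 else - 1 :: int) =
      (if p i = \<one>\<^bsub>Ks ! i\<^esub> then 1 else - 1) * (if q i = \<one>\<^bsub>Ks ! i\<^esub> then 1 else - 1)"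
    if i: "i \<in> I" for i
  proof -
    interpret K: central_commutator "Ks ! i" "zs i" using i by (rule factor_I)
    show ?thesis using D_apply[OF assms(1) i] D_apply[OF assms(2) i]
      by (auto simp: K.z_z K.z_closed K.z_not_one)
  qed
  show "p \<otimes>\<^bsub>P\<^esub> q \<in> D"
  proof (rule D_I)
    show "p \<otimes>\<^bsub>P\<^esub> q \<in> carrier P" using assms D_P by simp
    show "(p \<otimes>\<^bsub>P\<^esub> q) i \<in> {\<one>\<^bsub>Ks ! i\<^esub>, zs i}" if "i \<in> I" for i
      unfolding P_apply[OF that] using *[OF that] by blast
  qed
  show "sign (p \<otimes>\<^bsub>P\<^esub> q) = sign p * sign q"
    unfolding sign_def prod.distrib[symmetric] by (rule prod.cong) (use * in \<open>simp_all add: P_apply\<close>)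
qed

lemma D_central:
  assumes "p \<in> D" "x \<in> carrier P"
  shows "p \<otimes>\<^bsub>P\<^esub> x = x \<otimes>\<^bsub>P\<^esub> p"
proof (rule P_ext)
  fix i assume i: "i \<in> I"
  interpret K: central_commutator "Ks ! i" "zs i" using i by (rule factor_I)
  show "(p \<otimes>\<^bsub>P\<^esub> x) i = (x \<otimes>\<^bsub>P\<^esub> p) i"
    unfolding P_apply[OF i] using D_apply[OF assms(1) i] P_closed[OF assms(2) i]
    by (auto simp: K.z_central)
qed (use assms D_P in auto)

lemma D_square:
  assumes "p \<in> D"
  shows "p \<otimes>\<^bsub>P\<^esub> p = \<one>\<^bsub>P\<^esub>"
proof (rule P_ext)
  fix i assume i: "i \<in> I"
  interpret K: central_commutator "Ks ! i" "zs i" using i by (rule factor_I)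
  show "(p \<otimes>\<^bsub>P\<^esub> p) i = \<one>\<^bsub>P\<^esub> i"
    unfolding P_apply[OF i] P_one[OF i] using D_apply[OF assms(1) i] by (auto simp: K.z_z)
qed (use assms D_P in auto)

lemma one_D: "\<one>\<^bsub>P\<^esub> \<in> D" "sign \<one>\<^bsub>P\<^esub> = 1"
proof -
  show "\<one>\<^bsub>P\<^esub> \<in> D" by (rule D_I) (simp_all add: P_one)
  show "sign \<one>\<^bsub>P\<^esub> = 1" by (simp add: sign_def P_one)
qed

lemma N_normal: "N \<lhd> P"
  unfolding P.normal_inv_iff
proof (intro conjI ballI)
  show "subgroup N P"
  proof (rule P.subgroupI)
    show "N \<subseteq> carrier P" using D_P by (auto simp: N_eq)
    show "N \<noteq> {}" using one_D by (auto simp: N_eq)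
    show "inv\<^bsub>P\<^esub> p \<in> N" if p: "p \<in> N" for p
    proof -
      have "inv\<^bsub>P\<^esub> p = p" using p D_square D_P by (intro P.inv_equality) (simp_all add: N_eq)
      then show ?thesis using p by simp
    qed
    show "p \<otimes>\<^bsub>P\<^esub> q \<in> N" if "p \<in> N" "q \<in> N" for p q
      using that sign_mult by (simp add: N_eq)
  qed
  fix x h assume x: "x \<in> carrier P" "h \<in> N"
  have h: "h \<in> D" "h \<in> carrier P" using x D_P by (simp_all add: N_eq)
  have "x \<otimes>\<^bsub>P\<^esub> h \<otimes>\<^bsub>P\<^esub> inv\<^bsub>P\<^esub> x = h"
    unfolding D_central[OF h(1) x(1), symmetric] using x(1) h(2)
    by (simp only: P.m_assoc P.inv_closed P.r_inv P.r_one)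
  then show "x \<otimes>\<^bsub>P\<^esub> h \<otimes>\<^bsub>P\<^esub> inv\<^bsub>P\<^esub> x \<in> N" using x(2) by simp
qed

text \<open>The derived generator of factor \<open>j\<close> placed in the direct product. Each of
  these has sign -1, so all are identified in the central product.\<close>

definition e :: "nat \<Rightarrow> nat \<Rightarrow> 'a" where
  "e j = (\<lambda>i\<in>I. if i = j then zs j else \<one>\<^bsub>Ks ! i\<^esub>)"

lemma e: "j \<in> I \<Longrightarrow> e j \<in> D" "j \<in> I \<Longrightarrow> sign (e j) = - 1"
proof -
  assume j: "j \<in> I"
  show "e j \<in> D" using j by (auto simp: e_def D_def)
  interpret K: central_commutator "Ks ! j" "zs j" using j by (rule factor_I)
  have "sign (e j) = (\<Prod>i\<in>I. if i = j then - 1 else 1)"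
    unfolding sign_def by (rule prod.cong) (auto simp: e_def K.z_not_one)
  then show "sign (e j) = - 1" using j by simp
qed

lemma sign_pm: "sign p = 1 \<or> sign p = - 1"
proof -
  have "sign p * sign p = 1" unfolding sign_def prod.distrib[symmetric] by (rule prod.neutral) simp
  then show ?thesis by (simp add: square_eq_1_iff)
qed

text \<open>Exactly half of \<open>D\<close> has sign 1, since every factor has signed sum zero; an
  empty list would give the empty product 1 instead.\<close>

lemma card_N: "2 * card N = 2 ^ length Ks"
proof -
  have "2 * int (card {p \<in> PiE I (\<lambda>i. {\<one>\<^bsub>Ks ! i\<^esub>, zs i}). (\<Prod>i\<in>I. if p i = \<one>\<^bsub>Ks ! i\<^esub> then 1 else - 1 :: int) = 1}) =
      (\<Prod>i\<in>I. int (card {\<one>\<^bsub>Ks ! i\<^esub>, zs i})) +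
      (\<Prod>i\<in>I. \<Sum>x\<in>{\<one>\<^bsub>Ks ! i\<^esub>, zs i}. if x = \<one>\<^bsub>Ks ! i\<^esub> then 1 else - 1)"
    by (rule card_PiE_sign) auto
  moreover have "card {\<one>\<^bsub>Ks ! i\<^esub>, zs i} = 2"
    "(\<Sum>x\<in>{\<one>\<^bsub>Ks ! i\<^esub>, zs i}. if x = \<one>\<^bsub>Ks ! i\<^esub> then 1 else - 1 :: int) = 0" if "i \<in> I" for i
    using central_commutator.z_not_one[OF factor_I[OF that]] by auto
  moreover have "0 \<in> I" using nonempty by simp
  ultimately have "2 * int (card N) = 2 ^ length Ks"
    unfolding N_eq D_def sign_def by (simp add: prod_zero)
  then have "int (2 * card N) = int (2 ^ length Ks)" by simp
  then show ?thesis by (simp only: of_nat_eq_iff)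
qed

end

text \<open>\<open>\<rho>\<close> presents an arbitrary copy \<open>G\<close> of the central product
  as a quotient of the direct product, so that squares and commutators are computed
  coordinatewise.\<close>

locale central_product_map = central_product_factors Ks zs + G: group G
  for Ks :: "'a monoid list" and zs and G :: "('g, 'r) monoid_scheme" (structure) +
  fixes \<rho> :: "(nat \<Rightarrow> 'a) \<Rightarrow> 'g"
  assumes rho_hom: "\<rho> \<in> hom P G" and rho_surj: "\<rho> ` carrier P = carrier G"
    and rho_kernel: "p \<in> carrier P \<Longrightarrow> \<rho> p = \<one> \<longleftrightarrow> p \<in> N"
begin

sublocale R: group_hom P G \<rho>
  by unfold_locales (rule rho_hom)

sublocale G: finite_group G
proof
  show "finite (carrier G)" using rho_surj P.finite_carrier by (metis finite_imageI)
qed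

lemma rho_eq_iff:
  assumes "p \<in> carrier P" "q \<in> carrier P"
  shows "\<rho> p = \<rho> q \<longleftrightarrow> (\<exists>n\<in>N. p = n \<otimes>\<^bsub>P\<^esub> q)"
proof
  assume "\<rho> p = \<rho> q"
  then have "\<rho> (p \<otimes>\<^bsub>P\<^esub> inv\<^bsub>P\<^esub> q) = \<one>" using assms by (simp)
  then have "p \<otimes>\<^bsub>P\<^esub> inv\<^bsub>P\<^esub> q \<in> N" using rho_kernel[of "p \<otimes>\<^bsub>P\<^esub> inv\<^bsub>P\<^esub> q"] assms by simp
  moreover have "p = (p \<otimes>\<^bsub>P\<^esub> inv\<^bsub>P\<^esub> q) \<otimes>\<^bsub>P\<^esub> q"
    using assms by (simp only: P.m_assoc P.inv_closed P.l_inv P.r_one)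
  ultimately show "\<exists>n\<in>N. p = n \<otimes>\<^bsub>P\<^esub> q" by blast
next
  assume "\<exists>n\<in>N. p = n \<otimes>\<^bsub>P\<^esub> q"
  then obtain n where n: "n \<in> N" "p = n \<otimes>\<^bsub>P\<^esub> q" by blast
  have nP: "n \<in> carrier P" using n(1) D_P by (simp add: N_eq)
  then have "\<rho> n = \<one>" using rho_kernel n(1) by blast
  then show "\<rho> p = \<rho> q" unfolding n(2) R.hom_mult[OF nP assms(2)] using R.hom_closed[OF assms(2)] by simp
qed

lemma card_rho_preimage:
  assumes "S \<subseteq> carrier G"
  shows "card {p \<in> carrier P. \<rho> p \<in> S} = card N * card S"
proof -
  have fS: "finite S" using assms G.finite_carrier finite_subset by blast
  have "card {p \<in> carrier P. \<rho> p \<in> S} = (\<Sum>g\<in>S. card {p \<in> {p \<in> carrier P. \<rho> p \<in> S}. \<rho> p = g})"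
    using sum.group[of "{p \<in> carrier P. \<rho> p \<in> S}" S \<rho> "\<lambda>_. 1::nat"] P.finite_carrier fS
    by (simp add: image_subset_iff)
  also have "\<dots> = (\<Sum>g\<in>S. card N)"
  proof (rule sum.cong[OF HOL.refl])
    fix g assume g: "g \<in> S"
    then obtain q where q: "q \<in> carrier P" "g = \<rho> q" using assms rho_surj by blast
    have NP: "n \<in> carrier P" if "n \<in> N" for n using that D_P by (simp add: N_eq)
    have "{p \<in> {p \<in> carrier P. \<rho> p \<in> S}. \<rho> p = g} = (\<lambda>n. n \<otimes>\<^bsub>P\<^esub> q) ` N"
    proof (intro equalityI subsetI)
      fix p assume "p \<in> {p \<in> {p \<in> carrier P. \<rho> p \<in> S}. \<rho> p = g}"
      then show "p \<in> (\<lambda>n. n \<otimes>\<^bsub>P\<^esub> q) ` N" using rho_eq_iff[of p q] q by auto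
    next
      fix p assume "p \<in> (\<lambda>n. n \<otimes>\<^bsub>P\<^esub> q) ` N"
      then obtain n where n: "n \<in> N" "p = n \<otimes>\<^bsub>P\<^esub> q" by blast
      then have "p \<in> carrier P" using NP q(1) by simp
      moreover from this have "\<rho> p = g" using rho_eq_iff[of p q] q n by blast
      ultimately show "p \<in> {p \<in> {p \<in> carrier P. \<rho> p \<in> S}. \<rho> p = g}" using g by simp
    qed
    moreover have "inj_on (\<lambda>n. n \<otimes>\<^bsub>P\<^esub> q) N"
      by (rule inj_onI) (use NP q(1) P.right_cancel in blast)
    ultimately show "card {p \<in> {p \<in> carrier P. \<rho> p \<in> S}. \<rho> p = g} = card N"
      by (simp only: card_image)
  qed
  finally show ?thesis by simp
qed

text \<open>Any other coordinate gives the same element, by \<open>rho_eq_c_iff\<close>.\<close>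

definition c :: 'g where "c = \<rho> (e 0)"

lemma zero_I: "0 \<in> I" using nonempty by simp

lemma c_closed: "c \<in> carrier G"
  unfolding c_def using e(1)[OF zero_I] D_P R.hom_closed by blast

lemma rho_eq_c_iff:
  assumes p: "p \<in> carrier P"
  shows "\<rho> p = c \<longleftrightarrow> p \<in> D \<and> sign p = - 1"
proof -
  have eD: "e 0 \<in> D" "sign (e 0) = - 1" using e[OF zero_I] by auto
  show ?thesis
  proof
    assume "\<rho> p = c"
    then obtain n where "n \<in> N" "p = n \<otimes>\<^bsub>P\<^esub> e 0"
      using rho_eq_iff[OF p D_P[OF eD(1)]] by (auto simp: c_def)
    then show "p \<in> D \<and> sign p = - 1" using sign_mult[of n "e 0"] eD by (simp add: N_eq)
  next
    assume pD: "p \<in> D \<and> sign p = - 1"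
    have "p \<otimes>\<^bsub>P\<^esub> e 0 \<in> N" using sign_mult[of p "e 0"] pD eD by (simp add: N_eq)
    moreover have "p = (p \<otimes>\<^bsub>P\<^esub> e 0) \<otimes>\<^bsub>P\<^esub> e 0"
      using P.m_assoc[OF p D_P[OF eD(1)] D_P[OF eD(1)]] D_square[OF eD(1)] P.r_one[OF p] by simp
    ultimately show "\<rho> p = c" unfolding c_def using rho_eq_iff[OF p D_P[OF eD(1)]] by blast
  qed
qed

lemma c_not_one: "c \<noteq> \<one>"
  using rho_kernel[OF D_P] e[OF zero_I] unfolding c_def N_eq by simp

text \<open>The preimage of \<open><c>\<close> in the direct product is \<open>D\<close>, so the
  quotient of \<open>G\<close> by \<open><c>\<close> is the full product of the quotients of the
  factors.\<close>

definition A :: "(nat \<Rightarrow> 'a set) monoid" where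
  "A = product_group I (\<lambda>i. central_commutator.quot (Ks ! i) (zs i))"

definition tau :: "(nat \<Rightarrow> 'a) \<Rightarrow> nat \<Rightarrow> 'a set" where
  "tau p = (\<lambda>i\<in>I. central_commutator.proj (Ks ! i) (zs i) (p i))"

lemma tau_closed: "p \<in> carrier P \<Longrightarrow> tau p \<in> carrier A"
  using central_commutator.proj_surj[OF factor_I] P_closed
  by (auto simp: A_def tau_def PiE_iff carrier_product_group)

lemma tau_mult:
  assumes "p \<in> carrier P" "q \<in> carrier P"
  shows "tau (p \<otimes>\<^bsub>P\<^esub> q) = tau p \<otimes>\<^bsub>A\<^esub> tau q"
  using central_commutator.proj_mult[OF factor_I] P_closed[OF assms(1)] P_closed[OF assms(2)]
  by (auto simp: A_def tau_def P_apply mult_product_group intro!: restrict_ext)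

lemma comm_group_A: "comm_group A"
proof -
  interpret A: group A
    unfolding A_def by (rule product_group) (rule central_commutator.group_quot[OF factor_I])
  show ?thesis
  proof (rule A.group_comm_groupI)
    fix x y assume "x \<in> carrier A" "y \<in> carrier A"
    then show "x \<otimes>\<^bsub>A\<^esub> y = y \<otimes>\<^bsub>A\<^esub> x"
      using comm_groupE(4)[OF central_commutator.comm_quot[OF factor_I]]
      by (auto simp: A_def PiE_iff carrier_product_group mult_product_group intro!: restrict_ext)
  qed
qed

lemma tau_surj: "tau ` carrier P = carrier A"
proof
  show "tau ` carrier P \<subseteq> carrier A" using tau_closed by blast
  show "carrier A \<subseteq> tau ` carrier P"
  proof
    fix a assume a: "a \<in> carrier A"
    have "\<forall>i\<in>I. \<exists>x. x \<in> carrier (Ks ! i) \<and> a i = central_commutator.proj (Ks ! i) (zs i) x"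
    proof
      fix i assume i: "i \<in> I"
      have "a i \<in> central_commutator.proj (Ks ! i) (zs i) ` carrier (Ks ! i)"
        using a i unfolding central_commutator.proj_surj[OF factor_I[OF i]] by (auto simp: A_def PiE_iff carrier_product_group)
      then show "\<exists>x. x \<in> carrier (Ks ! i) \<and> a i = central_commutator.proj (Ks ! i) (zs i) x" by blast
    qed
    from bchoice[OF this] obtain p where
      p: "\<forall>i\<in>I. p i \<in> carrier (Ks ! i) \<and> a i = central_commutator.proj (Ks ! i) (zs i) (p i)" ..
    have "restrict p I \<in> carrier P" using p by (auto simp: PiE_iff carrier_product_group)
    moreover have "a = tau (restrict p I)"
      using a p by (intro PiE_ext[where k = I and s = "\<lambda>i. carrier (central_commutator.quot (Ks ! i) (zs i))"])
        (auto simp: tau_def A_def PiE_iff carrier_product_group)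
    ultimately show "a \<in> tau ` carrier P" by blast
  qed
qed

lemma tau_one_iff:
  assumes "p \<in> carrier P"
  shows "tau p = \<one>\<^bsub>A\<^esub> \<longleftrightarrow> p \<in> D"
proof -
  have iff: "central_commutator.proj (Ks ! i) (zs i) (p i) = \<one>\<^bsub>central_commutator.quot (Ks ! i) (zs i)\<^esub> \<longleftrightarrow>
      p i \<in> {\<one>\<^bsub>Ks ! i\<^esub>, zs i}" if "i \<in> I" for i
    using central_commutator.proj_one_iff[OF factor_I[OF that] P_closed[OF assms that]] .
  have "tau p = \<one>\<^bsub>A\<^esub> \<longleftrightarrow> (\<forall>i\<in>I. p i \<in> {\<one>\<^bsub>Ks ! i\<^esub>, zs i})"
    unfolding tau_def A_def one_product_group using iff by (auto simp: restrict_def fun_eq_iff split: if_splits)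
  also have "\<dots> \<longleftrightarrow> p \<in> D" using D_I[OF assms] D_apply by blast
  finally show ?thesis .
qed

text \<open>The choice of preimage is immaterial: two of them differ by an element of
  \<open>N\<close>, and \<open>N\<close> lies in \<open>D\<close>, the kernel of
  \<open>tau\<close>.\<close>

definition proj :: "'g \<Rightarrow> nat \<Rightarrow> 'a set" where
  "proj g = tau (SOME p. p \<in> carrier P \<and> \<rho> p = g)"

lemma proj_rho:
  assumes p: "p \<in> carrier P"
  shows "proj (\<rho> p) = tau p"
proof -
  interpret A: comm_group A by (rule comm_group_A)
  define q where "q = (SOME q. q \<in> carrier P \<and> \<rho> q = \<rho> p)"
  have "q \<in> carrier P \<and> \<rho> q = \<rho> p" unfolding q_def by (rule someI[of _ p]) (use p in simp)
  then obtain n where n: "n \<in> N" "q = n \<otimes>\<^bsub>P\<^esub> p" using rho_eq_iff[of q p] p by blast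
  have nD: "n \<in> D" "n \<in> carrier P" using n(1) D_P by (auto simp: N_eq)
  have "tau q = tau n \<otimes>\<^bsub>A\<^esub> tau p" unfolding n(2) by (rule tau_mult[OF nD(2) p])
  also have "tau n = \<one>\<^bsub>A\<^esub>" using tau_one_iff[OF nD(2)] nD(1) by simp
  finally show ?thesis using tau_closed[OF p] by (simp add: proj_def q_def)
qed

lemma central_extension:
  assumes "CHAR('f::{field,finite}) = 2"
  shows "central_extension TYPE('f) G A proj c"
proof (intro central_extension.intro central_extension_axioms.intro G.finite_group_axioms comm_group_A assms c_not_one)
  show "proj \<in> hom G A"
  proof (rule homI)
    fix g assume "g \<in> carrier G"
    then obtain p where p: "p \<in> carrier P" "g = \<rho> p" using rho_surj by blast
    show "proj g \<in> carrier A" unfolding p(2) proj_rho[OF p(1)] by (rule tau_closed[OF p(1)])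
    fix h assume "h \<in> carrier G"
    then obtain q where q: "q \<in> carrier P" "h = \<rho> q" using rho_surj by blast
    show "proj (g \<otimes> h) = proj g \<otimes>\<^bsub>A\<^esub> proj h"
      unfolding p(2) q(2) R.hom_mult[OF p(1) q(1), symmetric] proj_rho[OF p(1)] proj_rho[OF q(1)]
        proj_rho[OF P.m_closed[OF p(1) q(1)]] by (rule tau_mult[OF p(1) q(1)])
  qed
  show "proj ` carrier G = carrier A"
    unfolding rho_surj[symmetric] tau_surj[symmetric] image_image
    by (rule image_cong) (simp_all only: proj_rho)
  show "{g \<in> carrier G. proj g = \<one>\<^bsub>A\<^esub>} = {\<one>, c}"
  proof -
    have "proj g = \<one>\<^bsub>A\<^esub> \<longleftrightarrow> g = \<one> \<or> g = c" if g: "g \<in> carrier G" for g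
    proof -
      obtain p where p: "p \<in> carrier P" "g = \<rho> p" using g rho_surj by blast
      have "proj g = \<one>\<^bsub>A\<^esub> \<longleftrightarrow> p \<in> D" unfolding p(2) proj_rho[OF p(1)] by (rule tau_one_iff[OF p(1)])
      also have "\<dots> \<longleftrightarrow> g = \<one> \<or> g = c"
        unfolding p(2) rho_kernel[OF p(1)] rho_eq_c_iff[OF p(1)] N_eq using sign_pm[of p] by blast
      finally show ?thesis .
    qed
    then show ?thesis using c_closed by auto
  qed
qed

lemma square_mem_D:
  assumes p: "p \<in> carrier P"
  shows "p \<otimes>\<^bsub>P\<^esub> p \<in> D \<longleftrightarrow> p \<in> PiE I (\<lambda>i. central_commutator.quadratic (Ks ! i) (zs i))"
proof -
  have q: "p i \<in> central_commutator.quadratic (Ks ! i) (zs i) \<longleftrightarrow> (p \<otimes>\<^bsub>P\<^esub> p) i \<in> {\<one>\<^bsub>Ks ! i\<^esub>, zs i}"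
    if i: "i \<in> I" for i
    unfolding central_commutator.quadratic_def[OF factor_I[OF i]] P_apply[OF i] using P_closed[OF p i] by simp
  have "p \<otimes>\<^bsub>P\<^esub> p \<in> D \<longleftrightarrow> (\<forall>i\<in>I. (p \<otimes>\<^bsub>P\<^esub> p) i \<in> {\<one>\<^bsub>Ks ! i\<^esub>, zs i})"
    using D_I[OF P.m_closed[OF p p]] D_apply by blast
  also have "\<dots> \<longleftrightarrow> (\<forall>i\<in>I. p i \<in> central_commutator.quadratic (Ks ! i) (zs i))" using q by blast
  also have "\<dots> \<longleftrightarrow> p \<in> PiE I (\<lambda>i. central_commutator.quadratic (Ks ! i) (zs i))"
    using p by (auto simp: PiE_iff carrier_product_group)
  finally show ?thesis .
qed

lemma sign_square: "sign (p \<otimes>\<^bsub>P\<^esub> p) = (\<Prod>i\<in>I. if p i \<otimes>\<^bsub>Ks ! i\<^esub> p i = \<one>\<^bsub>Ks ! i\<^esub> then 1 else - 1)"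
  unfolding sign_def by (rule prod.cong) (simp_all add: P_apply)

lemma square_roots_iff:
  assumes p: "p \<in> carrier P"
  shows "\<rho> p \<in> Omega1 G \<longleftrightarrow> p \<otimes>\<^bsub>P\<^esub> p \<in> N"
    and "\<rho> p \<in> square_roots G c \<longleftrightarrow> p \<otimes>\<^bsub>P\<^esub> p \<in> D \<and> sign (p \<otimes>\<^bsub>P\<^esub> p) = - 1"
proof -
  have "\<rho> p [^] (2::nat) = \<rho> (p \<otimes>\<^bsub>P\<^esub> p)"
    unfolding G.nat_pow_two[OF R.hom_closed[OF p]] by (rule R.hom_mult[OF p p, symmetric])
  then show "\<rho> p \<in> Omega1 G \<longleftrightarrow> p \<otimes>\<^bsub>P\<^esub> p \<in> N"
    "\<rho> p \<in> square_roots G c \<longleftrightarrow> p \<otimes>\<^bsub>P\<^esub> p \<in> D \<and> sign (p \<otimes>\<^bsub>P\<^esub> p) = - 1"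
    unfolding square_roots_def mem_Collect_eq rho_kernel[OF P.m_closed[OF p p], symmetric]
      rho_eq_c_iff[OF P.m_closed[OF p p], symmetric]
    using R.hom_closed[OF p] by (simp_all only: simp_thms)
qed

text \<open>The tuples above square roots of 1 or \<open>c\<close> have all coordinates in the sets
  \<open>quadratic\<close>, with product of signs 1 or -1. Dividing by the kernel and clearing the 2
  of \<open>card_PiE_sign\<close> gives the factor \<open>2 ^ length Ks\<close>.\<close>

lemma card_square_roots:
  shows "2 ^ length Ks * int (card (Omega1 G)) =
      (\<Prod>i\<in>I. int (card (central_commutator.quadratic (Ks ! i) (zs i)))) +
      (\<Prod>i\<in>I. central_commutator.sign_sum (Ks ! i) (zs i))"
    and "2 ^ length Ks * int (card (square_roots G c)) =
      (\<Prod>i\<in>I. int (card (central_commutator.quadratic (Ks ! i) (zs i)))) -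
      (\<Prod>i\<in>I. central_commutator.sign_sum (Ks ! i) (zs i))"
proof -
  let ?X = "\<lambda>i. central_commutator.quadratic (Ks ! i) (zs i)"
  let ?s = "\<lambda>i x. if x \<otimes>\<^bsub>Ks ! i\<^esub> x = \<one>\<^bsub>Ks ! i\<^esub> then 1 else - 1 :: int"
  have sub: "?X i \<subseteq> carrier (Ks ! i)" if "i \<in> I" for i
    unfolding central_commutator.quadratic_def[OF factor_I[OF that]] by blast
  then have fin: "finite (?X i)" if "i \<in> I" for i using finite_factor that finite_subset by blast
  have XP: "PiE I ?X \<subseteq> carrier P" unfolding carrier_product_group using sub by (rule PiE_mono)
  have prd: "(\<Prod>i\<in>I. \<Sum>x\<in>?X i. ?s i x) = (\<Prod>i\<in>I. central_commutator.sign_sum (Ks ! i) (zs i))"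
    by (rule prod.cong) (simp_all add: central_commutator.sign_sum_def factor_I)
  have "{p \<in> carrier P. \<rho> p \<in> Omega1 G} = {p \<in> PiE I ?X. (\<Prod>i\<in>I. ?s i (p i)) = 1}"
    using square_roots_iff(1) square_mem_D XP unfolding sign_square[symmetric] N_eq by blast
  then have 1: "card N * card (Omega1 G) = card {p \<in> PiE I ?X. (\<Prod>i\<in>I. ?s i (p i)) = 1}"
    using card_rho_preimage[of "Omega1 G"] by (simp add: square_roots_def)
  have "{p \<in> carrier P. \<rho> p \<in> square_roots G c} = {p \<in> PiE I ?X. (\<Prod>i\<in>I. ?s i (p i)) = - 1}"
    using square_roots_iff(2) square_mem_D XP unfolding sign_square[symmetric] by blast
  then have 2: "card N * card (square_roots G c) = card {p \<in> PiE I ?X. (\<Prod>i\<in>I. ?s i (p i)) = - 1}"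
    using card_rho_preimage[of "square_roots G c"] by (simp add: square_roots_def)
  have N: "2 * int (card N) = 2 ^ length Ks" using arg_cong[OF card_N, of int] by simp
  have fI: "finite I" by simp
  have "2 * int (card N * card (Omega1 G)) = (\<Prod>i\<in>I. int (card (?X i))) + (\<Prod>i\<in>I. \<Sum>x\<in>?X i. ?s i x)"
    unfolding 1 by (rule card_PiE_sign(1)[OF fI fin]) auto
  then show "2 ^ length Ks * int (card (Omega1 G)) = (\<Prod>i\<in>I. int (card (?X i))) +
      (\<Prod>i\<in>I. central_commutator.sign_sum (Ks ! i) (zs i))"
    unfolding prd N[symmetric] by simp
  have "2 * int (card N * card (square_roots G c)) = (\<Prod>i\<in>I. int (card (?X i))) - (\<Prod>i\<in>I. \<Sum>x\<in>?X i. ?s i x)"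
    unfolding 2 by (rule card_PiE_sign(2)[OF fI fin]) auto
  then show "2 ^ length Ks * int (card (square_roots G c)) = (\<Prod>i\<in>I. int (card (?X i))) -
      (\<Prod>i\<in>I. central_commutator.sign_sum (Ks ! i) (zs i))"
    unfolding prd N[symmetric] by simp
qed

text \<open>With a single noncommuting coordinate the commutator is \<open>e j\<close>, of sign -1,
  which survives in \<open>G\<close>; two such coordinates would cancel each other.\<close>

lemma rho_noncommuting:
  assumes p: "p \<in> carrier P" and q: "q \<in> carrier P" and j: "j \<in> I"
    and "p j \<otimes>\<^bsub>Ks ! j\<^esub> q j \<noteq> q j \<otimes>\<^bsub>Ks ! j\<^esub> p j"
    and "\<And>i. i \<in> I \<Longrightarrow> i \<noteq> j \<Longrightarrow> p i \<otimes>\<^bsub>Ks ! i\<^esub> q i = q i \<otimes>\<^bsub>Ks ! i\<^esub> p i"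
  shows "\<rho> p \<otimes> \<rho> q \<noteq> \<rho> q \<otimes> \<rho> p"
proof
  assume comm: "\<rho> p \<otimes> \<rho> q = \<rho> q \<otimes> \<rho> p"
  have eP: "e j \<in> carrier P" using e(1)[OF j] D_P by blast
  have "p \<otimes>\<^bsub>P\<^esub> q = (q \<otimes>\<^bsub>P\<^esub> p) \<otimes>\<^bsub>P\<^esub> e j"
  proof (rule P_ext)
    fix i assume i: "i \<in> I"
    interpret K: central_commutator "Ks ! i" "zs i" using i by (rule factor_I)
    have "p i \<otimes>\<^bsub>Ks ! i\<^esub> q i = q i \<otimes>\<^bsub>Ks ! i\<^esub> p i \<otimes>\<^bsub>Ks ! i\<^esub> e j i"
      using K.commutator[OF P_closed[OF p i] P_closed[OF q i]] assms(4,5) i P_closed[OF p i] P_closed[OF q i]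
      by (auto simp: e_def)
    then show "(p \<otimes>\<^bsub>P\<^esub> q) i = (q \<otimes>\<^bsub>P\<^esub> p \<otimes>\<^bsub>P\<^esub> e j) i" unfolding P_apply[OF i] .
  qed (use p q eP in \<open>simp_all only: P.m_closed\<close>)
  then have "\<rho> p \<otimes> \<rho> q = \<rho> q \<otimes> \<rho> p \<otimes> \<rho> (e j)"
    using R.hom_mult p q eP P.m_closed by metis
  then have "\<rho> (e j) = \<one>"
    using comm R.hom_closed[OF p] R.hom_closed[OF q] R.hom_closed[OF eP]
    by simp
  then show False using rho_kernel[OF eP] e(2)[OF j] by (simp add: N_eq)
qed

lemma pow_two_A:
  assumes "\<And>i. i \<in> I \<Longrightarrow> \<exists>r. card (carrier (Ks ! i)) = 2 ^ r" and a: "a \<in> carrier A"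
  shows "\<exists>i. a [^]\<^bsub>A\<^esub> (2 ^ i :: nat) = \<one>\<^bsub>A\<^esub>"
proof -
  interpret A: comm_group A by (rule comm_group_A)
  obtain r where r: "\<forall>i\<in>I. card (carrier (Ks ! i)) = 2 ^ r i" using assms(1) by metis
  have "order P = (\<Prod>i\<in>I. 2 ^ r i)" using r by (simp add: order_def card_PiE carrier_product_group)
  then have ord: "order P = 2 ^ (\<Sum>i\<in>I. r i)" by (simp add: power_sum)
  obtain p where p: "p \<in> carrier P" "a = tau p" using a tau_surj by blast
  have "group_hom P A tau"
    by (intro group_hom.intro group_hom_axioms.intro P.is_group A.is_group homI tau_closed tau_mult)
  then have "tau (p [^]\<^bsub>P\<^esub> order P) = a [^]\<^bsub>A\<^esub> order P"
    unfolding p(2) by (rule group_hom.hom_nat_pow[OF _ p(1)])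
  moreover have "p [^]\<^bsub>P\<^esub> order P = \<one>\<^bsub>P\<^esub>" using P.pow_order_eq_1[OF p(1)] .
  ultimately have "a [^]\<^bsub>A\<^esub> (2 ^ (\<Sum>i\<in>I. r i) :: nat) = \<one>\<^bsub>A\<^esub>"
    using tau_one_iff[OF P.one_closed] one_D(1) ord by simp
  then show ?thesis by blast
qed

end

section \<open>Elements supported in one factor, and groups isomorphic to a central product\<close>

context central_product_factors
begin

definition single :: "nat \<Rightarrow> 'a \<Rightarrow> nat \<Rightarrow> 'a" where
  "single j x = (\<lambda>i\<in>I. if i = j then x else \<one>\<^bsub>Ks ! i\<^esub>)"

lemma single_apply: "i \<in> I \<Longrightarrow> single j x i = (if i = j then x else \<one>\<^bsub>Ks ! i\<^esub>)"
  by (simp add: single_def)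

lemma factor_one_closed: "i \<in> I \<Longrightarrow> \<one>\<^bsub>Ks ! i\<^esub> \<in> carrier (Ks ! i)"
  using monoid.one_closed[OF group.is_monoid[OF factor_group]] .

lemma single_closed: "j \<in> I \<Longrightarrow> x \<in> carrier (Ks ! j) \<Longrightarrow> single j x \<in> carrier P"
  using factor_one_closed by (auto simp: carrier_product_group single_def)

lemma single_mult:
  assumes "j \<in> I" "x \<in> carrier (Ks ! j)" "y \<in> carrier (Ks ! j)"
  shows "single j x \<otimes>\<^bsub>P\<^esub> single j y = single j (x \<otimes>\<^bsub>Ks ! j\<^esub> y)"
proof (rule P_ext)
  fix i assume i: "i \<in> I"
  interpret K: group "Ks ! i" using i by (rule factor_group)
  show "(single j x \<otimes>\<^bsub>P\<^esub> single j y) i = single j (x \<otimes>\<^bsub>Ks ! j\<^esub> y) i"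
    unfolding P_apply[OF i] single_apply[OF i] by simp
next
  interpret K: group "Ks ! j" using assms(1) by (rule factor_group)
  show "single j (x \<otimes>\<^bsub>Ks ! j\<^esub> y) \<in> carrier P" using assms by (intro single_closed) auto
qed (use assms single_closed in simp)

lemma single_z: "e j = single j (zs j)"
  by (simp add: e_def single_def)

lemma single_one: "single j \<one>\<^bsub>Ks ! j\<^esub> = \<one>\<^bsub>P\<^esub>"
  by (auto simp: single_def one_product_group)

lemma exists_central_product_map:
  fixes G :: "('g, 'r) monoid_scheme"
  assumes G: "group G" and iso: "G \<cong> central_product Ks"
  obtains \<rho> where "central_product_map Ks zs G \<rho>"
proof -
  interpret G: group G by (rule G)
  interpret N: normal N P by (rule N_normal)
  interpret Q: group "P Mod N" by (rule N.factorgroup_is_group)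
  obtain \<psi> where "\<psi> \<in> iso G (P Mod N)" using iso by (auto simp: is_iso_def central_product_def)
  then have "inv_into (carrier G) \<psi> \<in> iso (P Mod N) G" by (rule G.iso_set_sym)
  then obtain \<phi> where \<phi>: "\<phi> \<in> hom (P Mod N) G" "bij_betw \<phi> (carrier (P Mod N)) (carrier G)"
    by (auto simp: iso_def)
  define \<rho> where "\<rho> = \<phi> \<circ> (\<lambda>p. N #>\<^bsub>P\<^esub> p)"
  have can: "(\<lambda>p. N #>\<^bsub>P\<^esub> p) \<in> hom P (P Mod N)" by (rule N.r_coset_hom_Mod)
  have can_surj: "(\<lambda>p. N #>\<^bsub>P\<^esub> p) ` carrier P = carrier (P Mod N)"
    by (auto simp: FactGroup_def RCOSETS_def)
  have hom: "\<rho> \<in> hom P G" unfolding \<rho>_def by (rule hom_compose[OF can \<phi>(1)])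
  have surj: "\<rho> ` carrier P = carrier G"
    unfolding \<rho>_def image_comp[symmetric] can_surj using \<phi>(2) by (rule bij_betw_imp_surj_on)
  have ker: "\<rho> p = \<one>\<^bsub>G\<^esub> \<longleftrightarrow> p \<in> N" if p: "p \<in> carrier P" for p
  proof -
    have one: "\<phi> \<one>\<^bsub>P Mod N\<^esub> = \<one>\<^bsub>G\<^esub>" by (rule hom_one[OF \<phi>(1) Q.is_group G.is_group])
    have pc: "N #>\<^bsub>P\<^esub> p \<in> carrier (P Mod N)" using can_surj p by blast
    have "\<rho> p = \<one>\<^bsub>G\<^esub> \<longleftrightarrow> N #>\<^bsub>P\<^esub> p = \<one>\<^bsub>P Mod N\<^esub>"
      using inj_onD[OF bij_betw_imp_inj_on[OF \<phi>(2)] _ pc Q.one_closed] one by (auto simp: \<rho>_def)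
    also have "\<dots> \<longleftrightarrow> N #>\<^bsub>P\<^esub> p = N" by (simp add: FactGroup_def)
    also have "\<dots> \<longleftrightarrow> p \<in> N"
      using P.coset_join1[OF _ p N.subgroup_axioms] P.coset_join2[OF p N.subgroup_axioms] by blast
    finally show ?thesis .
  qed
  have "central_product_map Ks zs G \<rho>"
    by (intro central_product_map.intro central_product_map_axioms.intro central_product_factors_axioms G
        hom surj ker)
  then show thesis by (rule that)
qed

end

context central_product_map
begin

text \<open>The theorem describes its element only as a generator of the derived subgroup. A
  commutator coming from factor 0 is nontrivial but dies in the abelian group \<open>A\<close>, so
  it is \<open>c\<close>, and a derived subgroup of order two leaves no other generator.\<close>

lemma c_unique:
  assumes char: "CHAR('f::{field,finite}) = 2"
    and derived: "derived G (carrier G) = generate G {d}" "card (derived G (carrier G)) = 2"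
  shows "d = c"
proof -
  interpret E: central_extension G A proj c "TYPE('f)" by (rule central_extension[OF char])
  interpret K: central_commutator "Ks ! 0" "zs 0" by (rule factor_I[OF zero_I])
  obtain x y where xy: "x \<in> carrier (Ks ! 0)" "y \<in> carrier (Ks ! 0)"
    "x \<otimes>\<^bsub>Ks ! 0\<^esub> y = y \<otimes>\<^bsub>Ks ! 0\<^esub> x \<otimes>\<^bsub>Ks ! 0\<^esub> zs 0"
    using K.noncommuting by blast
  define p where "p = \<rho> (single 0 x)"
  define q where "q = \<rho> (single 0 y)"
  have pG: "p \<in> carrier G" "q \<in> carrier G"
    using R.hom_closed single_closed[OF zero_I] xy by (simp_all add: p_def q_def)
  have "x \<otimes>\<^bsub>Ks ! 0\<^esub> y \<noteq> y \<otimes>\<^bsub>Ks ! 0\<^esub> x"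
    using xy K.z_not_one K.z_closed by simp
  then have "p \<otimes> q \<noteq> q \<otimes> p"
    unfolding p_def q_def using single_closed[OF zero_I] xy zero_I
    by (intro rho_noncommuting[where j = 0]) (simp_all add: single_apply)
  moreover define g where "g = p \<otimes> q \<otimes> inv p \<otimes> inv q"
  have gG: "g \<in> carrier G" using pG by (simp add: g_def)
  have "inv q \<otimes> (q \<otimes> p) = p" using pG by (simp add: G.m_assoc[symmetric])
  then have "p \<otimes> q = g \<otimes> (q \<otimes> p)" using pG by (simp add: g_def G.m_assoc)
  ultimately have "g \<noteq> \<one>" using pG by auto
  have pq: "proj p \<in> carrier A" "proj q \<in> carrier A" using pG E.hom_closed by blast+
  have "proj g = proj p \<otimes>\<^bsub>A\<^esub> proj q \<otimes>\<^bsub>A\<^esub> inv\<^bsub>A\<^esub> proj p \<otimes>\<^bsub>A\<^esub> inv\<^bsub>A\<^esub> proj q"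
    unfolding g_def using pG by (simp only: E.hom_mult E.hom_inv G.m_closed G.inv_closed)
  also have "\<dots> = proj q \<otimes>\<^bsub>A\<^esub> (proj p \<otimes>\<^bsub>A\<^esub> inv\<^bsub>A\<^esub> proj p) \<otimes>\<^bsub>A\<^esub> inv\<^bsub>A\<^esub> proj q"
    using E.A.m_comm[OF pq] pq by (simp only: E.A.m_assoc E.A.m_closed E.A.inv_closed)
  also have "\<dots> = \<one>\<^bsub>A\<^esub>"
    using pq by (simp only: E.A.r_inv E.A.r_one)
  finally have "proj g = \<one>\<^bsub>A\<^esub>" .
  then have "g = c" using E.kernelD[OF gG] \<open>g \<noteq> \<one>\<close> by blast
  have "g \<in> derived_set G (carrier G)" using pG by (auto simp: g_def)
  then have "c \<in> derived G (carrier G)" unfolding \<open>g = c\<close> derived_def by (rule generate.incl)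
  moreover have "\<one> \<in> derived G (carrier G)" unfolding derived_def by (rule generate.one)
  moreover have "finite (derived G (carrier G))" using derived(2) card_gt_0_iff by fastforce
  ultimately have eq: "derived G (carrier G) = {\<one>, c}"
    using card_seteq[of "derived G (carrier G)" "{\<one>, c}"] derived(2) c_not_one by auto
  have "d \<in> generate G {d}" by (rule generate.incl) simp
  then have "d \<in> {\<one>, c}" using eq derived(1) by simp
  moreover have "d \<noteq> \<one>"
  proof
    assume "d = \<one>"
    then have "generate G {d} \<subseteq> {\<one>}"
      using G.generate_subgroup_incl[OF _ G.triv_subgroup] by simp
    then show False using eq derived(1) c_not_one by auto
  qed
  ultimately show ?thesis by simp
qed

end

text \<open>\<open>r\<close> counts the additional copies of \<open>D8\<close>, and
  \<open>\<epsilon>\<close> records the choice of \<open>H\<close>, so that the sign separating the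
  two families is \<open>(- 1) ^ \<epsilon>\<close>.\<close>

lemma central_product_theorem:
  fixes G :: "('g, 'r) monoid_scheme"
  assumes char: "CHAR('f::{field,finite}) = 2" and nm: "n \<ge> m" "m \<ge> 1"
    and H: "(H = D8 \<and> \<epsilon> = 0) \<or> (H = Q8 \<and> \<epsilon> = 1)"
    and G: "group G" and iso: "G \<cong> central_product ([M2 (n + 1) 1, M2_1_1 (m + 1), H] @ replicate r D8)"
    and derived: "derived G (carrier G) = generate G {c}" "card (derived G (carrier G)) = 2"
  shows "n = 1 \<Longrightarrow> int (card (Omega1 G)) = 2 ^ (2 * (r + 3)) + (- 1) ^ \<epsilon> * 2 ^ (r + 4)"
    and "n = 1 \<Longrightarrow> int (card (square_roots G c)) = 2 ^ (2 * (r + 3)) - (- 1) ^ \<epsilon> * 2 ^ (r + 4)"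
    and "n \<ge> 2 \<Longrightarrow> card (Omega1 G) = 2 ^ (2 * (r + 3))"
    and "n \<ge> 2 \<Longrightarrow> card (square_roots G c) = 2 ^ (2 * (r + 3))"
    and "card (normalized_unitary G :: ('g \<Rightarrow> 'f) set) =
      (if n = 1 then 2 else 4) * CARD('f) ^ ((order G + card (Omega1 G)) div 2 - 1)"
proof -
  define Ks where "Ks = [M2 (n + 1) 1, M2_1_1 (m + 1), H] @ replicate r D8"
  \<comment> \<open>Parameters by position: 0 is \<open>M2\<close>, 1 is \<open>M2_1_1\<close>, 2 is
    \<open>H\<close>, later ones are \<open>D8\<close>. Only position 1 has
    \<open>\<alpha> i = 0\<close>, and only \<open>Q8\<close> has
    \<open>\<beta> i = 1\<close>.\<close>
  define w where "w = (\<lambda>i::nat. if i = 0 then n else if i = 1 then m + 1 else 1)"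
  define \<alpha> where "\<alpha> = (\<lambda>i::nat. if i = 1 then 0 else 1 :: nat)"
  define \<beta> where "\<beta> = (\<lambda>i::nat. if i = 2 then \<epsilon> else 0 :: nat)"
  have len: "length Ks = r + 3" by (simp add: Ks_def)
  have n1: "n \<ge> 1" using nm by simp
  have "\<exists>a b z. heisenberg_group (Ks ! i) a b z (w i) (\<alpha> i) (\<beta> i)" if i: "i < length Ks" for i
  proof -
    consider "i = 0" | "i = 1" | "i = 2" | j where "i = j + 3" "j < r"
    proof -
      have "i = 0 \<or> i = 1 \<or> i = 2 \<or> i = (i - 3) + 3 \<and> i - 3 < r" using i len by linarith
      then show thesis using that by blast
    qed
    then show ?thesis
    proof cases
      case 1
      then show ?thesis using heisenberg_M2[OF n1] by (simp add: Ks_def w_def \<alpha>_def \<beta>_def)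
    next
      case 2
      then show ?thesis using heisenberg_M2_1_1[of m] by (simp add: Ks_def w_def \<alpha>_def \<beta>_def)
    next
      case 3
      then show ?thesis using H heisenberg_D8 heisenberg_Q8 by (auto simp: Ks_def w_def \<alpha>_def \<beta>_def)
    next
      case 4
      then have "Ks ! i = D8" by (simp add: Ks_def nth_append)
      then show ?thesis using heisenberg_D8 4 by (simp add: w_def \<alpha>_def \<beta>_def)
    qed
  qed
  then obtain as bs zs where hg:
    "\<And>i. i < length Ks \<Longrightarrow> heisenberg_group (Ks ! i) (as i) (bs i) (zs i) (w i) (\<alpha> i) (\<beta> i)"
    by metis
  have "central_commutator (Ks ! i) (zs i)" if i: "i < length Ks" for i
  proof -
    interpret K: heisenberg_group "Ks ! i" "as i" "bs i" "zs i" "w i" "\<alpha> i" "\<beta> i" using i by (rule hg)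
    show ?thesis by (rule K.C.central_commutator_axioms)
  qed
  then interpret F: central_product_factors Ks zs
    by (intro central_product_factors.intro) (simp_all add: Ks_def)
  obtain \<rho> where "central_product_map Ks zs G \<rho>"
    using F.exists_central_product_map[OF G] iso unfolding Ks_def[symmetric] by blast
  then interpret M: central_product_map Ks zs G \<rho> .
  have c: "M.c = c" using M.c_unique[OF char derived] by simp
  interpret E: central_extension G M.A M.proj c "TYPE('f)"
    using M.central_extension[OF char] by (simp only: c)

  have I3: "(\<Prod>i\<in>F.I. f i) = f 0 * f 1 * f 2 * (\<Prod>i<r. f (i + 3))" for f :: "nat \<Rightarrow> 'b::comm_monoid_mult"
  proof -
    have "F.I = {..<Suc (Suc (Suc r))}" using len by simp
    then show ?thesis
      by (simp only: prod.lessThan_Suc_shift) (simp add: numeral_2_eq_2 numeral_3_eq_3 mult.assoc)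
  qed
  have quad: "card (central_commutator.quadratic (Ks ! i) (zs i)) = 8"
    and sgn: "central_commutator.sign_sum (Ks ! i) (zs i) =
      2 * (1 + (- 1) ^ \<alpha> i + (- 1) ^ \<beta> i + (- 1) ^ (\<alpha> i + \<beta> i + 2 ^ (w i - 1)))"
    and sqi: "card (square_involutions (central_commutator.quot (Ks ! i) (zs i))) = (if w i = 1 then 1 else 2)"
    and crd: "\<exists>r. card (carrier (Ks ! i)) = 2 ^ r"
    if i: "i \<in> F.I" for i
  proof -
    have "i < length Ks" using i by simp
    then interpret K: heisenberg_group "Ks ! i" "as i" "bs i" "zs i" "w i" "\<alpha> i" "\<beta> i" by (rule hg)
    show "card (central_commutator.quadratic (Ks ! i) (zs i)) = 8" by (rule K.card_quadratic)
    show "central_commutator.sign_sum (Ks ! i) (zs i) =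
      2 * (1 + (- 1) ^ \<alpha> i + (- 1) ^ \<beta> i + (- 1) ^ (\<alpha> i + \<beta> i + 2 ^ (w i - 1)))" by (rule K.sign_sum_eq)
    show "card (square_involutions (central_commutator.quot (Ks ! i) (zs i))) = (if w i = 1 then 1 else 2)"
      by (rule K.card_square_involutions_quot)
    show "\<exists>r. card (carrier (Ks ! i)) = 2 ^ r" using K.card_carrier by blast
  qed

  have eps: "\<epsilon> = 0 \<or> \<epsilon> = 1" using H by auto
  have quads: "(\<Prod>i\<in>F.I. int (card (central_commutator.quadratic (Ks ! i) (zs i)))) = 8 ^ (r + 3)"
    using quad len by simp
  have "(\<Prod>i\<in>F.I. central_commutator.sign_sum (Ks ! i) (zs i)) =
      (\<Prod>i\<in>F.I. 2 * (1 + (- 1) ^ \<alpha> i + (- 1) ^ \<beta> i + (- 1) ^ (\<alpha> i + \<beta> i + 2 ^ (w i - 1))))"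
    using sgn by (intro prod.cong) auto
  \<comment> \<open>The three leading factors contribute 4, 8 and 4 up to the sign of
    \<open>H\<close>, each further \<open>D8\<close> contributes 4; for \<open>n \<ge> 2\<close> the
    factor \<open>M2\<close> contributes 0.\<close>
  also have "\<dots> = (if n = 1 then 128 * (- 1) ^ \<epsilon> * 4 ^ r else 0)"
    unfolding I3 using eps nm by (auto simp: \<alpha>_def \<beta>_def w_def)
  finally have sgns: "(\<Prod>i\<in>F.I. central_commutator.sign_sum (Ks ! i) (zs i)) =
      (if n = 1 then 128 * (- 1) ^ \<epsilon> * 4 ^ r else 0)" .
  define t where "t = (2::int) ^ r"
  have pw: "(4::int) ^ r = t * t" "(8::int) ^ r = t * t * t" "(2::int) ^ (2 * r) = t * t"
  proof -
    show "(4::int) ^ r = t * t" unfolding t_def power_mult_distrib[symmetric] by simp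
    show "(8::int) ^ r = t * t * t" unfolding t_def power_mult_distrib[symmetric] by simp
    show "(2::int) ^ (2 * r) = t * t" unfolding t_def mult_2 power_add ..
  qed
  have t0: "t > 0" by (simp add: t_def)
  \<comment> \<open>\<open>8 * t\<close> is \<open>2 ^ length Ks\<close>, and
    \<open>512 * t * t * t\<close> is the number of tuples of quadratic elements, eight per
    factor.\<close>
  have counts: "8 * t * int (card (Omega1 G)) = 512 * t * t * t + (if n = 1 then 128 * (- 1) ^ \<epsilon> * (t * t) else 0)"
    "8 * t * int (card (square_roots G c)) = 512 * t * t * t - (if n = 1 then 128 * (- 1) ^ \<epsilon> * (t * t) else 0)"
    using M.card_square_roots unfolding quads sgns unfolding len c by (simp_all add: power_add t_def[symmetric] pw mult_ac)
  have canc: "x = y" if "8 * t * x = 8 * t * y" for x y :: int using that t0 by simp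
  have e: "(2::int) ^ (2 * (r + 3)) = 64 * (t * t)" "(2::int) ^ (r + 4) = 16 * t"
    by (simp_all add: power_add pw t_def)
  show "int (card (Omega1 G)) = 2 ^ (2 * (r + 3)) + (- 1) ^ \<epsilon> * 2 ^ (r + 4)" if "n = 1"
    unfolding e by (rule canc) (use counts(1) that in \<open>simp add: algebra_simps\<close>)
  show "int (card (square_roots G c)) = 2 ^ (2 * (r + 3)) - (- 1) ^ \<epsilon> * 2 ^ (r + 4)" if "n = 1"
    unfolding e by (rule canc) (use counts(2) that in \<open>simp add: algebra_simps\<close>)
  show "card (Omega1 G) = 2 ^ (2 * (r + 3))" if n: "n \<ge> 2"
  proof -
    have "int (card (Omega1 G)) = 2 ^ (2 * (r + 3))"
      unfolding e by (rule canc) (use counts(1) n in simp)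
    then show ?thesis by (metis of_nat_eq_iff of_nat_numeral of_nat_power)
  qed
  show "card (square_roots G c) = 2 ^ (2 * (r + 3))" if n: "n \<ge> 2"
  proof -
    have "int (card (square_roots G c)) = 2 ^ (2 * (r + 3))"
      unfolding e by (rule canc) (use counts(2) n in simp)
    then show ?thesis by (metis of_nat_eq_iff of_nat_numeral of_nat_power)
  qed

  have "0 < length Ks" "1 < length Ks" using len by simp_all
  interpret K0: heisenberg_group "Ks ! 0" "as 0" "bs 0" "zs 0" "w 0" "\<alpha> 0" "\<beta> 0"
    by (rule hg[OF \<open>0 < length Ks\<close>])
  interpret K1: heisenberg_group "Ks ! 1" "as 1" "bs 1" "zs 1" "w 1" "\<alpha> 1" "\<beta> 1"
    by (rule hg[OF \<open>1 < length Ks\<close>])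
  have I0: "0 \<in> F.I" using len by simp

  \<comment> \<open>For \<open>n = 1\<close> factor 0 has the parameters of \<open>D8\<close>. If
    coordinate 0 of a square root of \<open>c\<close> is noncentral there, an involution of that
    factor fails to commute with it. Otherwise some other coordinate has nontrivial square, and an
    element not commuting with it can be turned into an involution of \<open>G\<close>.\<close>
  have image_n1: "card E.image = CARD('f) ^ card E.ram" if n: "n = 1"
  proof (rule E.card_image_noncommuting)
    fix t assume t: "t \<in> square_roots G c"
    then have "t \<in> carrier G" using E.square_rootsD by blast
    then obtain p where p: "p \<in> carrier F.P" "t = \<rho> p" using M.rho_surj by blast
    have pp: "p \<otimes>\<^bsub>F.P\<^esub> p \<in> F.D" "F.sign (p \<otimes>\<^bsub>F.P\<^esub> p) = - 1"
      using t M.square_roots_iff(2)[OF p(1)] unfolding p(2) c by blast+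
    have found: "\<exists>h\<in>Omega1 G. t \<otimes>\<^bsub>G\<^esub> h \<noteq> h \<otimes>\<^bsub>G\<^esub> t"
      if "q \<in> carrier F.P" "q \<otimes>\<^bsub>F.P\<^esub> q \<in> F.N" "j \<in> F.I"
        "p j \<otimes>\<^bsub>Ks ! j\<^esub> q j \<noteq> q j \<otimes>\<^bsub>Ks ! j\<^esub> p j"
        "\<And>i. i \<in> F.I \<Longrightarrow> i \<noteq> j \<Longrightarrow> p i \<otimes>\<^bsub>Ks ! i\<^esub> q i = q i \<otimes>\<^bsub>Ks ! i\<^esub> p i" for q j
      using M.rho_noncommuting[OF p(1) that(1,3,4,5)] M.square_roots_iff(1)[OF that(1)] that(2)
      unfolding p(2) by blast
    have single_comm: "p i \<otimes>\<^bsub>Ks ! i\<^esub> F.single j y i = F.single j y i \<otimes>\<^bsub>Ks ! i\<^esub> p i"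
      if "i \<in> F.I" "i \<noteq> j" for i j y
    proof -
      interpret K: group "Ks ! i" by (rule F.factor_group[OF that(1)])
      show ?thesis using that F.P_closed[OF p(1) that(1)] by (simp add: F.single_apply)
    qed
    have found_single: "\<exists>h\<in>Omega1 G. t \<otimes>\<^bsub>G\<^esub> h \<noteq> h \<otimes>\<^bsub>G\<^esub> t"
      if j: "j \<in> F.I" and y: "y \<in> carrier (Ks ! j)" "y \<otimes>\<^bsub>Ks ! j\<^esub> y = \<one>\<^bsub>Ks ! j\<^esub>"
        "p j \<otimes>\<^bsub>Ks ! j\<^esub> y \<noteq> y \<otimes>\<^bsub>Ks ! j\<^esub> p j" for j y
    proof (rule found[OF F.single_closed[OF j y(1)] _ j _ single_comm])
      show "F.single j y \<otimes>\<^bsub>F.P\<^esub> F.single j y \<in> F.N"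
        unfolding F.single_mult[OF j y(1) y(1)] y(2) F.single_one using F.one_D by (simp add: F.N_eq)
      show "p j \<otimes>\<^bsub>Ks ! j\<^esub> F.single j y j \<noteq> F.single j y j \<otimes>\<^bsub>Ks ! j\<^esub> p j"
        using y(3) j by (simp add: F.single_apply)
    qed
    have w0: "w 0 = 1" "\<alpha> 0 = 1" "\<beta> 0 = 0" using n by (simp_all add: w_def \<alpha>_def \<beta>_def)
    show "\<exists>h\<in>Omega1 G. t \<otimes>\<^bsub>G\<^esub> h \<noteq> h \<otimes>\<^bsub>G\<^esub> t"
    proof (cases "p 0 \<in> {\<one>\<^bsub>Ks ! 0\<^esub>, zs 0}")
      case False
      obtain y where "y \<in> carrier (Ks ! 0)" "y \<otimes>\<^bsub>Ks ! 0\<^esub> y = \<one>\<^bsub>Ks ! 0\<^esub>"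
        "p 0 \<otimes>\<^bsub>Ks ! 0\<^esub> y \<noteq> y \<otimes>\<^bsub>Ks ! 0\<^esub> p 0"
        using K0.exists_noncommuting_involution[OF w0 F.P_closed[OF p(1) I0] False] by blast
      then show ?thesis by (rule found_single[OF I0])
    next
      case True
      have "\<exists>i\<in>F.I. p i \<otimes>\<^bsub>Ks ! i\<^esub> p i \<noteq> \<one>\<^bsub>Ks ! i\<^esub>"
      proof (rule ccontr)
        assume "\<not> (\<exists>i\<in>F.I. p i \<otimes>\<^bsub>Ks ! i\<^esub> p i \<noteq> \<one>\<^bsub>Ks ! i\<^esub>)"
        then have "F.sign (p \<otimes>\<^bsub>F.P\<^esub> p) = 1" unfolding M.sign_square by (intro prod.neutral) simp
        then show False using pp(2) by simp
      qed
      then obtain i where i: "i \<in> F.I" "p i \<otimes>\<^bsub>Ks ! i\<^esub> p i \<noteq> \<one>\<^bsub>Ks ! i\<^esub>" by blast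
      have "i \<noteq> 0" using i(2) True K0.z_z by auto
      moreover have "i \<noteq> 1"
      proof
        assume "i = 1"
        have I1: "1 \<in> F.I" using len by simp
        have "p 1 \<in> K1.C.quadratic"
          using M.square_mem_D[OF p(1)] pp(1) PiE_mem[OF _ I1] by metis
        then have "p 1 \<otimes>\<^bsub>Ks ! 1\<^esub> p 1 = \<one>\<^bsub>Ks ! 1\<^esub>"
          using nm by (intro K1.quadratic_square_one) (simp_all add: w_def \<alpha>_def \<beta>_def)
        then show False using i(2) \<open>i = 1\<close> by simp
      qed
      ultimately have wi: "w i = 1" by (simp add: w_def)
      have "i < length Ks" using i(1) by simp
      then interpret K: heisenberg_group "Ks ! i" "as i" "bs i" "zs i" "w i" "\<alpha> i" "\<beta> i" by (rule hg)
      have piK: "p i \<in> carrier (Ks ! i)" by (rule F.P_closed[OF p(1) i(1)])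
      have "p i \<notin> {\<one>\<^bsub>Ks ! i\<^esub>, zs i}" using i(2) K.z_z by auto
      then obtain y where y: "y \<in> carrier (Ks ! i)" "p i \<otimes>\<^bsub>Ks ! i\<^esub> y \<noteq> y \<otimes>\<^bsub>Ks ! i\<^esub> p i"
        using K.exists_noncommuting[OF wi piK] by blast
      show ?thesis
      proof (cases "y \<otimes>\<^bsub>Ks ! i\<^esub> y = \<one>\<^bsub>Ks ! i\<^esub>")
        case True
        show ?thesis by (rule found_single[OF i(1) y(1) True y(2)])
      next
        case False
        then have yy: "y \<otimes>\<^bsub>Ks ! i\<^esub> y = zs i" using K.quadratic_all[OF wi y(1)] by blast
        have a0: "as 0 \<in> carrier (Ks ! 0)" "as 0 \<otimes>\<^bsub>Ks ! 0\<^esub> as 0 = zs 0"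
          using K0.a_closed K0.a_square w0 by auto
        \<comment> \<open>\<open>y\<close> squares to \<open>zs i\<close> and \<open>as 0\<close> to
          \<open>zs 0\<close>. These are identified in \<open>G\<close>, so the product becomes an
          involution there; in coordinate 0 it still commutes with \<open>p\<close>, which is
          central at that place.\<close>
        let ?q = "F.single i y \<otimes>\<^bsub>F.P\<^esub> F.single 0 (as 0)"
        have qc: "F.single i y \<in> carrier F.P" "F.single 0 (as 0) \<in> carrier F.P"
          using F.single_closed i(1) y(1) I0 a0(1) by blast+
        have qi: "?q i = y"
          using i(1) \<open>i \<noteq> 0\<close> y(1) unfolding F.P_apply[OF i(1)] F.single_apply[OF i(1)] by simp
        have q0: "?q 0 = as 0"
          using \<open>i \<noteq> 0\<close> a0(1) unfolding F.P_apply[OF I0] F.single_apply[OF I0] by simp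
        have qj: "?q j = \<one>\<^bsub>Ks ! j\<^esub>" if "j \<in> F.I" "j \<noteq> i" "j \<noteq> 0" for j
        proof -
          interpret Kj: group "Ks ! j" by (rule F.factor_group[OF that(1)])
          show ?thesis using that(2,3) unfolding F.P_apply[OF that(1)] F.single_apply[OF that(1)] by simp
        qed
        have "?q \<otimes>\<^bsub>F.P\<^esub> ?q = F.e i \<otimes>\<^bsub>F.P\<^esub> F.e 0"
        proof (rule F.P_ext)
          fix j assume j: "j \<in> F.I"
          interpret Kj: central_commutator "Ks ! j" "zs j" by (rule F.factor_I[OF j])
          consider "j = i" | "j = 0" | "j \<noteq> i" "j \<noteq> 0" by blast
          then show "(?q \<otimes>\<^bsub>F.P\<^esub> ?q) j = (F.e i \<otimes>\<^bsub>F.P\<^esub> F.e 0) j"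
          proof cases
            case 1
            then show ?thesis using \<open>i \<noteq> 0\<close> qi yy i(1)
              by (simp only: F.P_apply F.single_z F.single_apply if_True if_False K.r_one K.z_closed simp_thms)
          next
            case 2
            then show ?thesis using \<open>i \<noteq> 0\<close> \<open>i \<noteq> 0\<close>[symmetric] q0 a0 I0
              by (simp only: F.P_apply F.single_z F.single_apply if_True if_False K0.l_one K0.z_closed simp_thms)
          next
            case 3
            then show ?thesis using qj[OF j 3] j
              by (simp only: F.P_apply F.single_z F.single_apply if_True if_False Kj.l_one Kj.one_closed simp_thms)
          qed
        next
          show "?q \<otimes>\<^bsub>F.P\<^esub> ?q \<in> carrier F.P" "F.e i \<otimes>\<^bsub>F.P\<^esub> F.e 0 \<in> carrier F.P"
            using qc F.e(1) F.D_P i(1) I0 by simp_all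
        qed
        then have qN: "?q \<otimes>\<^bsub>F.P\<^esub> ?q \<in> F.N"
          using F.sign_mult[OF F.e(1)[OF i(1)] F.e(1)[OF I0]] F.e(2)[OF i(1)] F.e(2)[OF I0]
          by (simp add: F.N_eq)
        show ?thesis
        proof (rule found[OF F.P.m_closed[OF qc] qN i(1)])
          show "p i \<otimes>\<^bsub>Ks ! i\<^esub> ?q i \<noteq> ?q i \<otimes>\<^bsub>Ks ! i\<^esub> p i" unfolding qi by (rule y(2))
          fix j assume j: "j \<in> F.I" "j \<noteq> i"
          interpret Kj: central_commutator "Ks ! j" "zs j" by (rule F.factor_I[OF j(1)])
          have pj: "p j \<in> carrier (Ks ! j)" by (rule F.P_closed[OF p(1) j(1)])
          show "p j \<otimes>\<^bsub>Ks ! j\<^esub> ?q j = ?q j \<otimes>\<^bsub>Ks ! j\<^esub> p j"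
          proof (cases "j = 0")
            case True
            have "p 0 \<otimes>\<^bsub>Ks ! 0\<^esub> as 0 = as 0 \<otimes>\<^bsub>Ks ! 0\<^esub> p 0"
              using \<open>p 0 \<in> {\<one>\<^bsub>Ks ! 0\<^esub>, zs 0}\<close> a0(1) K0.C.z_central[OF a0(1)] by auto
            then show ?thesis unfolding True q0 .
          next
            case False
            then show ?thesis using qj[OF j] pj by simp
          qed
        qed
      qed
    qed
  qed

  have image_n2: "card E.image = CARD('f) ^ card E.ram" if n: "n \<ge> 2"
  proof -
    \<comment> \<open>The square of \<open>s\<close> is central in factor 0 and trivial in all other
      coordinates, hence central in \<open>G\<close>; it is a square root of \<open>c\<close> and,
      by construction, a square.\<close>
    obtain s where s: "s \<in> carrier (Ks ! 0)"
      "(s \<otimes>\<^bsub>Ks ! 0\<^esub> s) \<otimes>\<^bsub>Ks ! 0\<^esub> (s \<otimes>\<^bsub>Ks ! 0\<^esub> s) = zs 0"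
      "\<And>x. x \<in> carrier (Ks ! 0) \<Longrightarrow>
        (s \<otimes>\<^bsub>Ks ! 0\<^esub> s) \<otimes>\<^bsub>Ks ! 0\<^esub> x = x \<otimes>\<^bsub>Ks ! 0\<^esub> (s \<otimes>\<^bsub>Ks ! 0\<^esub> s)"
    proof (rule K0.exists_central_square)
      show "w 0 \<ge> 2" "\<alpha> 0 = 1" using n by (simp_all add: w_def \<alpha>_def)
    qed (rule that)
    let ?ss = "s \<otimes>\<^bsub>Ks ! 0\<^esub> s"
    have ss: "?ss \<in> carrier (Ks ! 0)" using s(1) by (rule K0.m_closed[OF _ s(1)])
    have sP: "F.single 0 s \<in> carrier F.P" "F.single 0 ?ss \<in> carrier F.P"
      using F.single_closed[OF I0] s(1) ss by blast+
    have w: "\<rho> (F.single 0 s) \<otimes>\<^bsub>G\<^esub> \<rho> (F.single 0 s) = \<rho> (F.single 0 ?ss)"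
      unfolding M.R.hom_mult[OF sP(1,1), symmetric] F.single_mult[OF I0 s(1,1)] ..
    show ?thesis
    proof (rule E.card_image_square)
      have "\<rho> (F.single 0 ?ss) \<otimes>\<^bsub>G\<^esub> \<rho> (F.single 0 ?ss) = c"
        unfolding M.R.hom_mult[OF sP(2,2), symmetric] F.single_mult[OF I0 ss ss] s(2)
          F.single_z[symmetric] M.c_def[symmetric] by (rule c)
      then show "\<rho> (F.single 0 ?ss) \<in> square_roots G c"
        using M.R.hom_closed[OF sP(2)] by (intro E.square_rootsI)
      show "\<rho> (F.single 0 s) \<in> carrier G" by (rule M.R.hom_closed[OF sP(1)])
      show "\<rho> (F.single 0 s) \<otimes>\<^bsub>G\<^esub> \<rho> (F.single 0 s) \<in> {\<rho> (F.single 0 ?ss), \<rho> (F.single 0 ?ss) \<otimes>\<^bsub>G\<^esub> c}"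
        unfolding w by blast
      fix t assume "t \<in> square_roots G c"
      then have "t \<in> carrier G" using E.square_rootsD by blast
      then obtain p where p: "p \<in> carrier F.P" "t = \<rho> p" using M.rho_surj by blast
      have "p \<otimes>\<^bsub>F.P\<^esub> F.single 0 ?ss = F.single 0 ?ss \<otimes>\<^bsub>F.P\<^esub> p"
      proof (rule F.P_ext)
        fix i assume i: "i \<in> F.I"
        interpret Ki: group "Ks ! i" by (rule F.factor_group[OF i])
        show "(p \<otimes>\<^bsub>F.P\<^esub> F.single 0 ?ss) i = (F.single 0 ?ss \<otimes>\<^bsub>F.P\<^esub> p) i"
          unfolding F.P_apply[OF i] F.single_apply[OF i] using s(3) F.P_closed[OF p(1) i] by auto
      qed (use p(1) sP(2) in simp_all)
      then show "t \<otimes>\<^bsub>G\<^esub> \<rho> (F.single 0 ?ss) = \<rho> (F.single 0 ?ss) \<otimes>\<^bsub>G\<^esub> t"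
        unfolding p(2) M.R.hom_mult[OF p(1) sP(2), symmetric] M.R.hom_mult[OF sP(2) p(1), symmetric] by simp
    qed
  qed

  have image: "1 * card E.image = CARD('f) ^ card E.ram"
    using image_n1 image_n2 n1 by (cases "n = 1") simp_all
  have theta: "card (square_involutions M.A) = (if n = 1 then 2 else 4)"
  proof -
    have "square_involutions M.A =
        (\<Pi>\<^sub>E i\<in>F.I. square_involutions (central_commutator.quot (Ks ! i) (zs i)))"
      unfolding M.A_def
      by (rule square_involutions_product_group) (rule central_commutator.group_quot[OF F.factor_I])
    then have "card (square_involutions M.A) = (\<Prod>i\<in>F.I. if w i = 1 then 1 else 2)"
      using sqi by (simp add: card_PiE)
    \<comment> \<open>Position 1 contributes 2 because \<open>m + 1 \<ge> 2\<close>, position 0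
      contributes 2 exactly for \<open>n \<ge> 2\<close>, and the remaining factors contribute
      1.\<close>
    also have "\<dots> = (if n = 1 then 2 else 4)" unfolding I3 using nm by (simp add: w_def)
    finally show ?thesis .
  qed
  have "card (unitary M.A :: (_ \<Rightarrow> 'f) set) =
      card (square_involutions M.A) * CARD('f) ^ ((card (carrier M.A) + card (Omega1 M.A)) div 2 - 1)"
    using M.pow_two_A[OF crd] by (intro card_unitary_abelian char E.A.comm_group_axioms E.A.finite_carrier)
  from E.card_unitary_extension[OF this image]
  show "card (normalized_unitary G :: ('g \<Rightarrow> 'f) set) =
      (if n = 1 then 2 else 4) * CARD('f) ^ ((order G + card (Omega1 G)) div 2 - 1)"
    unfolding M.G.normalized_unitary_eq[OF char] theta order_def by simp
qed

theorem theorem4p12: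
  fixes n m k :: nat
    and G :: "nat \<Rightarrow> ('g, 'r) monoid_scheme"
    and c :: "nat \<Rightarrow> 'g"
  assumes char_F: "CHAR('f::{field,finite}) = 2"
    and "n \<ge> m" and "m \<ge> 1" and "k \<ge> 3"
    and group_G: "\<And>l. l \<in> {1, 2} \<Longrightarrow> group (G l)"
    and iso_G: "\<And>l. l \<in> {1, 2} \<Longrightarrow>
      G l \<cong> central_product
        ([M2 (n + 1) 1, M2_1_1 (m + 1), if l = 1 then D8 else Q8] @ replicate (k - 3) D8)"
    and derived_G: "\<And>l. l \<in> {1, 2} \<Longrightarrow> derived (G l) (carrier (G l)) = generate (G l) {c l}"
    and order_derived_G: "\<And>l. l \<in> {1, 2} \<Longrightarrow> card (derived (G l) (carrier (G l))) = 2"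
  shows
    "(n = 1 \<longrightarrow>
        card (Omega1 (G 1)) = 2 ^ (2 * k) + 2 ^ (k + 1) \<and>
        card (square_roots (G 2) (c 2)) = 2 ^ (2 * k) + 2 ^ (k + 1) \<and>
        card (square_roots (G 1) (c 1)) = 2 ^ (2 * k) - 2 ^ (k + 1) \<and>
        card (Omega1 (G 2)) = 2 ^ (2 * k) - 2 ^ (k + 1)) \<and>
     (n \<ge> 2 \<longrightarrow> (\<forall>l \<in> {1, 2}.
        card (Omega1 (G l)) = 2 ^ (2 * k) \<and>
        card (square_roots (G l) (c l)) = 2 ^ (2 * k))) \<and>
     (\<forall>l \<in> {1, 2}.
        (n = 1 \<longrightarrow> card (normalized_unitary (G l) :: ('g \<Rightarrow> 'f) set) =
           2 * CARD('f) ^ ((order (G l) + card (Omega1 (G l))) div 2 - 1)) \<and>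
        (n \<ge> 2 \<longrightarrow> card (normalized_unitary (G l) :: ('g \<Rightarrow> 'f) set) =
           4 * CARD('f) ^ ((order (G l) + card (Omega1 (G l))) div 2 - 1)))"
proof -
  define r where "r = k - 3"
  have k: "k = r + 3" using \<open>k \<ge> 3\<close> by (simp add: r_def)
  define \<epsilon> where "\<epsilon> = (\<lambda>l::nat. if l = 1 then 0 else 1 :: nat)"
  have H: "((if l = 1 then D8 else Q8) = D8 \<and> \<epsilon> l = 0) \<or> ((if l = 1 then D8 else Q8) = Q8 \<and> \<epsilon> l = 1)" for l
    by (simp add: \<epsilon>_def)
  note core = central_product_theorem[OF char_F \<open>n \<ge> m\<close> \<open>m \<ge> 1\<close> H group_G iso_G[folded r_def] derived_G order_derived_G]
  \<comment> \<open>The counts were obtained over the integers; this bound makes the subtraction of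
    natural numbers in the statement agree with them.\<close>
  have le: "(2::nat) ^ (k + 1) \<le> 2 ^ (2 * k)" using k by (intro power_increasing) simp_all
  then have sub: "int (2 ^ (2 * k) - 2 ^ (k + 1)) = 2 ^ (2 * k) - 2 ^ (k + 1)" by (simp add: of_nat_diff)
  have add: "int (2 ^ (2 * k) + 2 ^ (k + 1)) = 2 ^ (2 * k) + 2 ^ (k + 1)" by simp
  have k': "r + 4 = k + 1" "r + 3 = k" using k by simp_all
  have inj: "x = y" if "int x = int y" for x y using that by simp
  have l: "1 \<in> {1, 2::nat}" "2 \<in> {1, 2::nat}" by simp_all
  have "card (Omega1 (G 1)) = 2 ^ (2 * k) + 2 ^ (k + 1)"
    "card (square_roots (G 1) (c 1)) = 2 ^ (2 * k) - 2 ^ (k + 1)"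
    "card (Omega1 (G 2)) = 2 ^ (2 * k) - 2 ^ (k + 1)"
    "card (square_roots (G 2) (c 2)) = 2 ^ (2 * k) + 2 ^ (k + 1)" if n: "n = 1"
    using core(1)[OF l(1,1,1,1) n] core(2)[OF l(1,1,1,1) n]
      core(1)[OF l(2,2,2,2) n] core(2)[OF l(2,2,2,2) n] sub add
    unfolding k' \<epsilon>_def by (auto intro!: inj)
  moreover have "card (Omega1 (G l)) = 2 ^ (2 * k)" "card (square_roots (G l) (c l)) = 2 ^ (2 * k)"
    if "l \<in> {1, 2}" "n \<ge> 2" for l
    using core(3,4)[OF that(1,1,1,1) that(2)] by (simp_all only: k')
  moreover have "card (normalized_unitary (G l) :: ('g \<Rightarrow> 'f) set) =
      (if n = 1 then 2 else 4) * CARD('f) ^ ((order (G l) + card (Omega1 (G l))) div 2 - 1)"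
    if "l \<in> {1, 2}" for l
    by (rule core(5)[OF that that that that])
  ultimately show ?thesis by simp
qed

end
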